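(* Let $\mathsf L(x)=\mathfrak L(L(x),M(x))$ be a composite with values in \[ \mathbb M_{19}=\{\mathfrak L(L,M):\ M^2=-I_2,\ L>0,\ L^{-1}+2MR_\perp<0\}, \] and let $\mathsf L^*=\mathfrak L(L^*,M^* )$ be its effective tensor, which lies in $\mathbb M_{19}$. Put \[ \sigma(x)=-R_\perp M(x),\qquad \mu(x)=\frac{2}{\mathrm{Tr}\,(L(x)^{-1}\sigma(x))}, \] so that $\mathfrak L(\mu(x)\sigma(x),R_\perp\sigma(x))$ takes values in \[ \mathbb M_7=\{\mathfrak L(\mu\sigma,R_\perp\sigma):\ \sigma=\sigma^T,\ \det\sigma=1,\ \sigma>0,\ \mu>1/2\}. \] Then the effective tensor of the composite $\mathfrak L(\mu(x)\sigma(x),R_\perp\sigma(x))$ is $\mathfrak L(\mu^*\sigma^*,R_\perp\sigma^* )\in\mathbb M_7$, where $\sigma^*$ is the effective conductivity of the two-dimensional conducting composite with local conductivity $\sigma(x)$, and \[ M^*=R_\perp\sigma^*,\qquad \mathrm{Tr}\,\big((L^* )^{-1}\sigma^*\big)=\frac{2}{\mu^*}. \]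
   Context: Let $R_\perp=\begin{pmatrix}0&-1\\1&0\end{pmatrix}$ and let $I_2$ be the $2\times2$ identity. Let $\mathcal T=\mathbb R^2\oplus\mathbb R^2$. Operators on $\mathcal T$ are written as $2\times2$ block matrices with real $2\times 2$ blocks, and $A\otimes B$ is the block matrix with blocks $A_{ij}B$. Put $\mathsf T=R_\perp\otimes R_\perp$. $\mathrm{Sym}^+(\mathcal T)$ is the set of symmetric positive definite operators on $\mathcal T$. For real $2\times2$ matrices $L=L^T$ and $M$, \[ \mathfrak L(L,M)=\begin{pmatrix} L & LM \\ {M^T}L & {M^T}LM \end{pmatrix}+\mathsf T . \] In the sets in the claim $L$ ranges over real symmetric and $M$ over real $2\times2$ matrices. Inequalities between matrices are in the sense of quadratic forms. A composite is a $[0,1]^2$-periodic measurable map $\mathsf L:\mathbb R^2\to\mathrm{Sym}^+(\mathcal T)$ with values in a compact subset of $\mathrm{Sym}^+(\mathcal T)$. Its effective tensor $\mathsf L^*\in\mathrm{Sym}^+(\mathcal T)$ is defined by $\mathsf L^*E_0=\int_{[0,1]^2}\mathsf L(x)E(x)\,dx$ for $E_0\in\mathcal T$, where $E=E_0+(\nabla\varphi_1,\nabla\varphi_2)$ with $\varphi_1,\varphi_2\in H^1_{\rm per}$ is the unique such field for which both $\mathbb R^2$-components of $\mathsf L E$ are divergence-free. The effective conductivity $\sigma^*$ of a periodic, bounded, uniformly positive definite symmetric $2\times2$ conductivity $\sigma(x)$ is defined in the same way with a single potential: $\sigma^*e_0=\int_{[0,1]^2}\sigma(e_0+\nabla\varphi)\,dx$,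 $\nabla\cdot\sigma(e_0+\nabla\varphi)=0$, $\varphi\in H^1_{\rm per}$. *)

theory Defs
  imports "HOL-Analysis.Analysis"
begin

section \<open>Matrices and block operators\<close>

type_synonym vec2 = "real^2"
type_synonym mat2 = "real^2^2"

text \<open>An element \<open>E\<close> of \<open>\<real>\<^sup>2 \<oplus> \<real>\<^sup>2\<close> is a pair of vectors \<open>E $ 1\<close>, \<open>E $ 2\<close>;
  an operator \<open>A\<close> on that space is a block matrix with blocks \<open>A $ i $ j\<close>.\<close>

type_synonym tens = "vec2^2"
type_synonym block = "mat2^2^2"

definition block_apply :: "block \<Rightarrow> tens \<Rightarrow> tens"  (infixr "*b" 71)
  where "A *b E = (\<chi> i. \<Sum>j\<in>UNIV. (A $ i $ j) *v (E $ j))"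

definition kron :: "mat2 \<Rightarrow> mat2 \<Rightarrow> block"
  where "kron A B = (\<chi> i. \<chi> j. (A $ i $ j) *\<^sub>R B)"

definition Rperp :: mat2
  where "Rperp = vector [vector [0, -1], vector [1, 0]]"

definition Tperp :: block
  where "Tperp = kron Rperp Rperp"

text \<open>The order of the type of vectors is the componentwise one, so definiteness of quadratic
  forms needs its own predicates. They do not include symmetry.\<close>

definition pos_def :: "mat2 \<Rightarrow> bool"
  where "pos_def A \<longleftrightarrow> (\<forall>v. v \<noteq> 0 \<longrightarrow> v \<bullet> (A *v v) > 0)"

definition neg_def :: "mat2 \<Rightarrow> bool"
  where "neg_def A \<longleftrightarrow> (\<forall>v. v \<noteq> 0 \<longrightarrow> v \<bullet> (A *v v) < 0)"

definition Sym_pos :: "block set"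
  where "Sym_pos = {A. (\<forall>E F. (A *b E) \<bullet> F = E \<bullet> (A *b F)) \<and> (\<forall>E. E \<noteq> 0 \<longrightarrow> E \<bullet> (A *b E) > 0)}"

definition frakL :: "mat2 \<Rightarrow> mat2 \<Rightarrow> block"
  where "frakL L M = vector [vector [L, L ** M],
                             vector [transpose M ** L, transpose M ** L ** M]] + Tperp"

definition M19 :: "block set"
  where "M19 = {frakL L M | L M. transpose L = L \<and> M ** M = - mat 1 \<and> pos_def L
                  \<and> neg_def (matrix_inv L + 2 *\<^sub>R (M ** Rperp))}"

definition M7 :: "block set"
  where "M7 = {frakL (\<mu> *\<^sub>R \<sigma>) (Rperp ** \<sigma>) | \<mu> \<sigma>. transpose \<sigma> = \<sigma> \<and> det \<sigma> = 1
                 \<and> pos_def \<sigma> \<and> \<mu> > 1/2}"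


section \<open>Periodic Sobolev functions\<close>

abbreviation cell :: "vec2 set"
  where "cell \<equiv> cbox 0 1"

definition periodic :: "(vec2 \<Rightarrow> 'a) \<Rightarrow> bool"
  where "periodic f \<longleftrightarrow> (\<forall>x i. f (x + axis i 1) = f x)"

definition L2_per :: "(vec2 \<Rightarrow> 'a::euclidean_space) \<Rightarrow> bool"
  where "L2_per f \<longleftrightarrow> periodic f \<and> f \<in> borel_measurable lebesgue
           \<and> set_integrable lebesgue cell (\<lambda>x. (norm (f x))\<^sup>2)"

text \<open>Continuously differentiable periodic test functions, together with their gradients.\<close>

definition test_fun :: "(vec2 \<Rightarrow> real) \<Rightarrow> (vec2 \<Rightarrow> vec2) \<Rightarrow> bool"
  where "test_fun \<psi> d\<psi> \<longleftrightarrow> periodic \<psi> \<and> (\<forall>x. GDERIV \<psi> x :> d\<psi> x) \<and> continuous_on UNIV d\<psi>"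

text \<open>\<open>H1_per_grad \<phi> g\<close>: \<open>\<phi>\<close> is in \<open>H\<^sup>1\<close> of the torus, with weak gradient \<open>g\<close>.\<close>

definition H1_per_grad :: "(vec2 \<Rightarrow> real) \<Rightarrow> (vec2 \<Rightarrow> vec2) \<Rightarrow> bool"
  where "H1_per_grad \<phi> g \<longleftrightarrow> L2_per \<phi> \<and> L2_per g
           \<and> (\<forall>\<psi> d\<psi>. test_fun \<psi> d\<psi> \<longrightarrow>
                (LINT x:cell|lebesgue. \<phi> x *\<^sub>R d\<psi> x) = - (LINT x:cell|lebesgue. \<psi> x *\<^sub>R g x))"

text \<open>Weak divergence of a periodic field. It is only used for square integrable fields, for
  which the integrals exist.\<close>

definition div_free :: "(vec2 \<Rightarrow> vec2) \<Rightarrow> bool"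
  where "div_free J \<longleftrightarrow>
           (\<forall>\<psi> d\<psi>. test_fun \<psi> d\<psi> \<longrightarrow> (LINT x:cell|lebesgue. J x \<bullet> d\<psi> x) = 0)"


section \<open>Composites and effective tensors\<close>

definition composite :: "(vec2 \<Rightarrow> block) \<Rightarrow> bool"
  where "composite A \<longleftrightarrow> periodic A \<and> A \<in> borel_measurable lebesgue
           \<and> (\<exists>K. compact K \<and> K \<subseteq> Sym_pos \<and> range A \<subseteq> K)"

definition cell_field :: "(vec2 \<Rightarrow> block) \<Rightarrow> tens \<Rightarrow> (vec2 \<Rightarrow> tens) \<Rightarrow> bool"
  where "cell_field A E0 E \<longleftrightarrow>
           (\<exists>\<phi>1 \<phi>2 g1 g2. H1_per_grad \<phi>1 g1 \<and> H1_per_grad \<phi>2 g2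
              \<and> E = (\<lambda>x. E0 + vector [g1 x, g2 x]))
           \<and> (\<forall>i. div_free (\<lambda>x. (A x *b E x) $ i))"

text \<open>For a composite the field \<open>E\<close> below exists and is unique up to null sets (Lax-Milgram),
  so exactly one effective tensor satisfies this predicate.\<close>

definition is_effective_tensor :: "(vec2 \<Rightarrow> block) \<Rightarrow> block \<Rightarrow> bool"
  where "is_effective_tensor A A' \<longleftrightarrow>
           (\<forall>E0. \<exists>E. cell_field A E0 E \<and> A' *b E0 = (LINT x:cell|lebesgue. A x *b E x))"

definition effective_tensor :: "(vec2 \<Rightarrow> block) \<Rightarrow> block"
  where "effective_tensor A = (THE A'. is_effective_tensor A A')"

definition conducting_composite :: "(vec2 \<Rightarrow> mat2) \<Rightarrow> bool"
  where "conducting_composite \<sigma> \<longleftrightarrow> periodic \<sigma> \<and> \<sigma> \<in> borel_measurable lebesgue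
           \<and> (\<forall>x. transpose (\<sigma> x) = \<sigma> x) \<and> bounded (range \<sigma>)
           \<and> (\<exists>\<alpha>>0. \<forall>x v. v \<bullet> (\<sigma> x *v v) \<ge> \<alpha> * (norm v)\<^sup>2)"

definition conductivity_field :: "(vec2 \<Rightarrow> mat2) \<Rightarrow> vec2 \<Rightarrow> (vec2 \<Rightarrow> vec2) \<Rightarrow> bool"
  where "conductivity_field \<sigma> e0 e \<longleftrightarrow>
           (\<exists>\<phi> g. H1_per_grad \<phi> g \<and> e = (\<lambda>x. e0 + g x)) \<and> div_free (\<lambda>x. \<sigma> x *v e x)"

definition is_effective_conductivity :: "(vec2 \<Rightarrow> mat2) \<Rightarrow> mat2 \<Rightarrow> bool"
  where "is_effective_conductivity \<sigma> \<sigma>' \<longleftrightarrow>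
           (\<forall>e0. \<exists>e. conductivity_field \<sigma> e0 e \<and> \<sigma>' *v e0 = (LINT x:cell|lebesgue. \<sigma> x *v e x))"

definition effective_conductivity :: "(vec2 \<Rightarrow> mat2) \<Rightarrow> mat2"
  where "effective_conductivity \<sigma> = (THE \<sigma>'. is_effective_conductivity \<sigma> \<sigma>')"

end

theory Submission
  imports Defs
begin

text \<open>Write R for Rperp and M = R ** sigma. Then M^2 = -1 says exactly that sigma is symmetric with
  determinant 1, and the flux of a field (e1, e2) is (j - R e2, M^T j + R e1) with
  j = L (e1 + M e2). Hence both components of the flux are divergence-free iff h = R j is a
  conductivity field of sigma alone. Testing e1 + M e2 = L^-1 j against the conductivity fields
  K c of mean c gives M* = R sigma* and the quadratic form of L*^-1 as the mean of that of L^-1 on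
  the fields R K. Since det sigma = 1, rotated fluxes are again conductivity fields, so
  R sigma K = K R sigma*. This yields det sigma* = 1 and K^T sigma K = (det K) sigma*, and
  Tr (L*^-1 sigma*) is the mean of (det K) Tr (L^-1 sigma). The last expression depends on L only
  through mu, and for L = mu sigma it determines L*. The bound mu* > 1/2 holds because det K >= 0 has mean 1.

  The cell problems are solved by minimizing over trigonometric polynomials. That
  curl-free periodic fields of mean zero are limits of gradients of trigonometric polynomials
  follows from the totality of the trigonometric system.
\<close>

section \<open>Square integrable periodic fields\<close>

text \<open>\<open>Tperp\<close> adds only rotated gradients to the flux. These are divergence-free,
  so it drops out of the equations, and the remaining system is triangular. Once h is chosen, e1 =
  L^-1 j - R sigma e2 is a gradient exactly when R e1 = sigma e2 - R L^-1 R h is divergence-free, a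
  scalar problem for e2 with a source. Hence scalar problems with square integrable sources are all
  that has to be solved. The mean of e1 then fixes the mean of h, through the matrix
  \<open>S\<close>.

  Two gaps separate minimizers over trigonometric polynomials from the definitions. A limit of
  gradients needs a periodic potential, which the Poincare inequality supplies. An equation tested
  on trigonometric polynomials must hold for all C^1 test functions, which the Hodge decomposition
  supplies.

  A further obstacle is uniformity: \<open>M19\<close> and \<open>M7\<close> are given by strict
  inequalities, while a composite needs a compact range of positive tensors. The new coefficients
  are therefore written as continuous functions of the original tensor on a compact set.\<close>

abbreviation cm :: "vec2 measure" where "cm \<equiv> lebesgue_on cell"

definition l2sq :: "(vec2 \<Rightarrow> 'a::euclidean_space) \<Rightarrow> real"
  where "l2sq f = (\<integral>x. (norm (f x))\<^sup>2 \<partial>cm)"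

lemma set_integral_cm: "(LINT x:cell|lebesgue. f x) = integral\<^sup>L cm (f::vec2\<Rightarrow>'a::euclidean_space)"
  by (simp add: integral_restrict_space set_lebesgue_integral_def)

lemma emeasure_cell: "emeasure lborel cell = 1"
  by (subst emeasure_lborel_cbox) (auto intro!: prod.neutral simp: Basis_vec_def inner_axis)

lemma finite_cm [simp]: "finite_measure cm"
  by (rule finite_measureI) (simp add: emeasure_restrict_space emeasure_cell)

lemma prob_cm: "measure cm cell = 1"
  by (simp add: measure_def emeasure_restrict_space emeasure_cell)

lemma integral_cm_const [simp]: "(\<integral>x. c \<partial>cm) = (c::'a::euclidean_space)"
  by (simp add: prob_cm)

lemma integrable_cm_const [simp]: "integrable cm (\<lambda>x. c::'a::euclidean_space)"
  by (simp add: finite_measure.integrable_const)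

lemma L2_per_iff: "L2_per f \<longleftrightarrow> periodic f \<and> f \<in> borel_measurable lebesgue \<and> integrable cm (\<lambda>x. (norm (f x))\<^sup>2)"
  by (simp add: L2_per_def integrable_restrict_space set_integrable_def)

lemma L2_perD:
  assumes "L2_per f"
  shows "periodic f" "f \<in> borel_measurable lebesgue" "f \<in> borel_measurable cm" "integrable cm (\<lambda>x. (norm (f x))\<^sup>2)"
  using assms by (auto simp: L2_per_iff measurable_restrict_space1)

lemma L2_per_bound:
  assumes "L2_per f" "periodic g" "g \<in> borel_measurable lebesgue" "\<And>x. norm (g x) \<le> C * norm (f x)"
  shows "L2_per g"
proof -
  have "integrable cm (\<lambda>x. (norm (g x))\<^sup>2)"
  proof (rule Bochner_Integration.integrable_bound[of cm "\<lambda>x. C\<^sup>2 * (norm (f x))\<^sup>2"])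
    show "integrable cm (\<lambda>x. C\<^sup>2 * (norm (f x))\<^sup>2)" using L2_perD(4)[OF assms(1)] by simp
    show "(\<lambda>x. (norm (g x))\<^sup>2) \<in> borel_measurable cm"
      using measurable_restrict_space1[OF assms(3)] by measurable
    show "AE x in cm. norm ((norm (g x))\<^sup>2) \<le> norm (C\<^sup>2 * (norm (f x))\<^sup>2)"
      using assms(4) by (auto intro!: AE_I2 simp: power_mult_distrib[symmetric] intro: power_mono)
  qed
  thus ?thesis using assms by (simp add: L2_per_iff)
qed

lemma L2_per_add:
  assumes "L2_per f" "L2_per g" shows "L2_per (\<lambda>x. f x + g x)"
proof -
  note [measurable] = L2_perD(2,3)[OF assms(1)] L2_perD(2,3)[OF assms(2)]
  have "integrable cm (\<lambda>x. (norm (f x + g x))\<^sup>2)"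
  proof (rule Bochner_Integration.integrable_bound[of cm "\<lambda>x. 2 * (norm (f x))\<^sup>2 + 2 * (norm (g x))\<^sup>2"])
    show "integrable cm (\<lambda>x. 2 * (norm (f x))\<^sup>2 + 2 * (norm (g x))\<^sup>2)"
      using L2_perD(4)[OF assms(1)] L2_perD(4)[OF assms(2)] by simp
    have "(norm (f x + g x))\<^sup>2 \<le> 2 * (norm (f x))\<^sup>2 + 2 * (norm (g x))\<^sup>2" for x
    proof -
      have "(norm (f x + g x))\<^sup>2 \<le> (norm (f x) + norm (g x))\<^sup>2" by (intro power_mono norm_triangle_ineq) auto
      also have "\<dots> \<le> 2 * (norm (f x))\<^sup>2 + 2 * (norm (g x))\<^sup>2"
        using sum_squares_bound[of "norm (f x)" "norm (g x)"] by (simp add: power2_sum)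
      finally show ?thesis .
    qed
    thus "AE x in cm. norm ((norm (f x + g x))\<^sup>2) \<le> norm (2 * (norm (f x))\<^sup>2 + 2 * (norm (g x))\<^sup>2)"
      by (auto intro!: AE_I2)
  qed measurable
  moreover have "periodic (\<lambda>x. f x + g x)"
    using L2_perD(1)[OF assms(1)] L2_perD(1)[OF assms(2)] by (simp add: periodic_def)
  ultimately show ?thesis by (simp add: L2_per_iff)
qed

lemma L2_per_linear:
  assumes "bounded_linear T" "L2_per f" shows "L2_per (\<lambda>x. T (f x))"
proof -
  obtain C where C: "\<And>x. norm (T x) \<le> norm x * C" using bounded_linear.bounded[OF assms(1)] by blast
  have "T \<in> borel_measurable borel"
    by (intro borel_measurable_continuous_onI linear_continuous_on assms)
  from measurable_compose[OF L2_perD(2)[OF assms(2)] this]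
  have m: "(\<lambda>x. T (f x)) \<in> borel_measurable lebesgue" .
  show ?thesis
    by (rule L2_per_bound[OF assms(2) _ m, of C])
       (use C L2_perD(1)[OF assms(2)] in \<open>auto simp: periodic_def mult.commute\<close>)
qed

lemma L2_per_scaleR: "L2_per f \<Longrightarrow> L2_per (\<lambda>x. c *\<^sub>R f x)"
  by (rule L2_per_linear[OF bounded_linear_scaleR_right])

lemma L2_per_minus: "L2_per f \<Longrightarrow> L2_per (\<lambda>x. - f x)"
  using L2_per_scaleR[of f "-1"] by simp

lemma L2_per_diff: "L2_per f \<Longrightarrow> L2_per g \<Longrightarrow> L2_per (\<lambda>x. f x - g x)"
  using L2_per_add[of f "\<lambda>x. - g x"] L2_per_minus[of g] by simp

lemma L2_per_const: "L2_per (\<lambda>x. c)"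
  by (simp add: L2_per_iff periodic_def)

lemma L2_per_continuous:
  assumes "continuous_on UNIV f" "periodic f" shows "L2_per f"
proof -
  have "continuous_on cell (\<lambda>x. (norm (f x))\<^sup>2)"
    by (intro continuous_intros continuous_on_subset[OF assms(1)]) auto
  from continuous_imp_integrable[OF this] have "integrable cm (\<lambda>x. (norm (f x))\<^sup>2)" .
  moreover have "f \<in> borel_measurable lebesgue"
    using continuous_imp_measurable_on_sets_lebesgue[OF assms(1)] by simp
  ultimately show ?thesis using assms by (simp add: L2_per_iff)
qed

lemma L2_integrable:
  assumes "L2_per f" shows "integrable cm f"
proof (rule Bochner_Integration.integrable_bound[of cm "\<lambda>x. 1 + (norm (f x))\<^sup>2"])
  show "integrable cm (\<lambda>x. 1 + (norm (f x))\<^sup>2)" using L2_perD(4)[OF assms] by simp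
  show "f \<in> borel_measurable cm" using L2_perD(3)[OF assms] .
  have "norm (f x) \<le> 1 + (norm (f x))\<^sup>2" for x
    using sum_squares_bound[of 1 "norm (f x)"] norm_ge_zero[of "f x"] by (simp del: norm_ge_zero)
  thus "AE x in cm. norm (f x) \<le> norm (1 + (norm (f x))\<^sup>2)"
    by (auto intro!: AE_I2)
qed

lemma L2_inner_integrable:
  assumes "L2_per f" "L2_per g" shows "integrable cm (\<lambda>x. f x \<bullet> g x)"
proof (rule Bochner_Integration.integrable_bound[of cm "\<lambda>x. (norm (f x))\<^sup>2 + (norm (g x))\<^sup>2"])
  note [measurable] = L2_perD(3)[OF assms(1)] L2_perD(3)[OF assms(2)]
  show "integrable cm (\<lambda>x. (norm (f x))\<^sup>2 + (norm (g x))\<^sup>2)"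
    using L2_perD(4)[OF assms(1)] L2_perD(4)[OF assms(2)] by simp
  show "(\<lambda>x. f x \<bullet> g x) \<in> borel_measurable cm" by measurable
  have "\<bar>f x \<bullet> g x\<bar> \<le> (norm (f x))\<^sup>2 + (norm (g x))\<^sup>2" for x
    using Cauchy_Schwarz_ineq2[of "f x" "g x"] sum_squares_bound[of "norm (f x)" "norm (g x)"]
      mult_nonneg_nonneg[OF norm_ge_zero norm_ge_zero, of "f x" "g x"] by linarith
  thus "AE x in cm. norm (f x \<bullet> g x) \<le> norm ((norm (f x))\<^sup>2 + (norm (g x))\<^sup>2)"
    by (auto intro!: AE_I2)
qed

lemma l2sq_nonneg: "l2sq f \<ge> 0"
  by (simp add: l2sq_def)

text \<open>Cauchy-Schwarz in weighted form, from the square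
  \<open>(t * norm (f x) - norm (g x))\<^sup>2 / t\<close>. The free weight later serves to make
  errors small or to match a coercivity constant.\<close>

lemma l2_young:
  assumes "L2_per f" "L2_per g" "t > 0"
  shows "2 * \<bar>\<integral>x. f x \<bullet> g x \<partial>cm\<bar> \<le> t * l2sq f + l2sq g / t"
proof -
  have i: "integrable cm (\<lambda>x. f x \<bullet> g x)" using L2_inner_integrable assms by blast
  have p: "2 * \<bar>f x \<bullet> g x\<bar> \<le> t * (norm (f x))\<^sup>2 + (norm (g x))\<^sup>2 / t" for x
  proof -
    have "0 \<le> (t * norm (f x) - norm (g x))\<^sup>2 / t" using assms by simp
    also have "\<dots> = t * (norm (f x))\<^sup>2 + (norm (g x))\<^sup>2 / t - 2 * (norm (f x) * norm (g x))"
      using assms by (simp add: power2_eq_square field_simps)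
    finally show ?thesis using Cauchy_Schwarz_ineq2[of "f x" "g x"] by linarith
  qed
  have "2 * \<bar>\<integral>x. f x \<bullet> g x \<partial>cm\<bar> \<le> 2 * (\<integral>x. \<bar>f x \<bullet> g x\<bar> \<partial>cm)"
    using integral_norm_bound[of cm "\<lambda>x. f x \<bullet> g x"] by simp
  also have "\<dots> = (\<integral>x. 2 * \<bar>f x \<bullet> g x\<bar> \<partial>cm)" by simp
  also have "\<dots> \<le> (\<integral>x. t * (norm (f x))\<^sup>2 + (norm (g x))\<^sup>2 / t \<partial>cm)"
    by (rule integral_mono) (use p i L2_perD(4)[OF assms(1)] L2_perD(4)[OF assms(2)] in auto)
  also have "\<dots> = t * l2sq f + l2sq g / t"
    using L2_perD(4)[OF assms(1)] L2_perD(4)[OF assms(2)] by (simp add: l2sq_def)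
  finally show ?thesis .
qed

lemma l2_tendsto_inner:
  assumes "\<And>n. L2_per (f n)" "L2_per u" "L2_per g" "(\<lambda>n. l2sq (\<lambda>x. f n x - u x)) \<longlonglongrightarrow> 0"
  shows "(\<lambda>n. \<integral>x. f n x \<bullet> g x \<partial>cm) \<longlonglongrightarrow> (\<integral>x. u x \<bullet> g x \<partial>cm)"
proof (rule LIMSEQ_I)
  fix e :: real assume e: "e > 0"
  \<comment> \<open>This weight keeps the term in \<open>g\<close> below \<open>e\<close> whatever
    the size of \<open>g\<close>. Convergence brings the other term below \<open>e\<close>, and the
    factor 2 in \<open>l2_young\<close> absorbs the sum.\<close>
  define t where "t = (l2sq g + 1) / e"
  have t: "t > 0" using e l2sq_nonneg[of g] by (simp add: t_def)
  have "e / t > 0" using e t by simp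
  from LIMSEQ_D[OF assms(4) this] obtain N where
    N: "\<And>n. n \<ge> N \<Longrightarrow> l2sq (\<lambda>x. f n x - u x) < e / t" by (auto simp: abs_of_nonneg l2sq_nonneg)
  show "\<exists>N. \<forall>n\<ge>N. norm ((\<integral>x. f n x \<bullet> g x \<partial>cm) - (\<integral>x. u x \<bullet> g x \<partial>cm)) < e"
  proof (intro exI allI impI)
    fix n assume n: "n \<ge> N"
    have "(\<integral>x. f n x \<bullet> g x \<partial>cm) - (\<integral>x. u x \<bullet> g x \<partial>cm) = (\<integral>x. (f n x - u x) \<bullet> g x \<partial>cm)"
      by (simp add: inner_diff_left L2_inner_integrable assms)
    moreover have "2 * \<bar>\<integral>x. (f n x - u x) \<bullet> g x \<partial>cm\<bar> \<le> t * l2sq (\<lambda>x. f n x - u x) + l2sq g / t"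
      by (intro l2_young L2_per_diff assms t)
    moreover have "t * l2sq (\<lambda>x. f n x - u x) < e" using N[OF n] t by (simp add: field_simps)
    moreover have "l2sq g / t < e" using e t l2sq_nonneg[of g] by (simp add: t_def field_simps)
    ultimately show "norm ((\<integral>x. f n x \<bullet> g x \<partial>cm) - (\<integral>x. u x \<bullet> g x \<partial>cm)) < e" by simp
  qed
qed

lemma l2sq_diff_commute: "l2sq (\<lambda>x. f x - g x) = l2sq (\<lambda>x. g x - f x)"
  by (simp add: l2sq_def norm_minus_commute)

lemma l2_norm_le:
  assumes "L2_per f" "t > 0"
  shows "2 * (\<integral>x. norm (f x) \<partial>cm) \<le> t + l2sq f / t"
proof -
  have p: "2 * norm (f x) \<le> t + (norm (f x))\<^sup>2 / t" for x
  proof -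
    have "0 \<le> (t - norm (f x))\<^sup>2 / t" using assms by simp
    also have "\<dots> = t + (norm (f x))\<^sup>2 / t - 2 * norm (f x)"
      using assms by (simp add: power2_eq_square field_simps)
    finally show ?thesis by linarith
  qed
  have "2 * (\<integral>x. norm (f x) \<partial>cm) = (\<integral>x. 2 * norm (f x) \<partial>cm)" by simp
  also have "\<dots> \<le> (\<integral>x. t + (norm (f x))\<^sup>2 / t \<partial>cm)"
    by (rule integral_mono) (use p L2_integrable[OF assms(1)] L2_perD(4)[OF assms(1)] in auto)
  also have "\<dots> = t + l2sq f / t"
    using L2_perD(4)[OF assms(1)] by (simp add: l2sq_def prob_cm)
  finally show ?thesis .
qed

text \<open>Riesz-Fischer: a subsequence with summable increments converges almost everywhere, and
  Fatou's lemma carries the Cauchy estimate to the limit. The limit has to be periodic and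
  measurable on the whole plane, not only on the cell.\<close>

lemma l2_complete:
  fixes f :: "nat \<Rightarrow> vec2 \<Rightarrow> 'a::euclidean_space"
  assumes L2: "\<And>n. L2_per (f n)"
    and cauchy: "\<And>e. e > 0 \<Longrightarrow> \<exists>N. \<forall>m\<ge>N. \<forall>n\<ge>N. l2sq (\<lambda>x. f m x - f n x) < e"
  obtains g where "L2_per g" "(\<lambda>n. l2sq (\<lambda>x. f n x - g x)) \<longlonglongrightarrow> 0"
proof -
  note [measurable] = L2_perD(2,3)[OF L2]
  have "\<forall>k. \<exists>N. \<forall>m\<ge>N. \<forall>n\<ge>N. l2sq (\<lambda>x. f m x - f n x) < (1/4)^k" using cauchy by simp
  then obtain s where s: "\<And>k m n. m \<ge> s k \<Longrightarrow> n \<ge> s k \<Longrightarrow> l2sq (\<lambda>x. f m x - f n x) < (1/4)^k"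
    by metis
  \<comment> \<open>Adding \<open>k\<close> and all earlier thresholds makes \<open>r\<close>
    monotone, at least \<open>s k\<close>, and at least \<open>k\<close>; all three are
    used.\<close>
  define r where "r k = k + sum s {..k}" for k
  have rs: "r k \<ge> s k" for k using member_le_sum[of k "{..k}" s] by (simp add: r_def)
  have r1: "r (Suc k) \<ge> r k" for k by (simp add: r_def)
  define d where "d k x = f (r (Suc k)) x - f (r k) x" for k x
  have Ld: "L2_per (d k)" for k unfolding d_def by (intro L2_per_diff L2)
  have dk: "(\<integral>x. norm (d k x) \<partial>cm) \<le> (1/2)^k" for k
  proof -
    have "l2sq (d k) < (1/4)^k" unfolding d_def using s[of k "r (Suc k)" "r k"] rs[of k] r1[of k] by simp
    hence "l2sq (d k) / (1/2)^k \<le> (1/4)^k / (1/2)^k" by (intro divide_right_mono) auto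
    also have "\<dots> = (1/2)^k" by (simp add: power_divide[symmetric])
    finally show ?thesis using l2_norm_le[OF Ld, of "(1/2)^k" k] by simp
  qed
  have "(\<integral>\<^sup>+x. (\<Sum>k. ennreal (norm (d k x))) \<partial>cm) = (\<Sum>k. \<integral>\<^sup>+x. ennreal (norm (d k x)) \<partial>cm)"
    by (intro nn_integral_suminf) (use L2_perD(3)[OF Ld] in measurable)
  also have "\<dots> = (\<Sum>k. ennreal (\<integral>x. norm (d k x) \<partial>cm))"
    using L2_integrable[OF Ld] by (simp add: nn_integral_eq_integral)
  also have "\<dots> \<le> (\<Sum>k. ennreal ((1/2)^k))"
    using dk by (intro suminf_le ennreal_leI) auto
  also have "\<dots> = ennreal (\<Sum>k. (1/2)^k)"
    by (rule suminf_ennreal2) (auto intro: summable_geometric)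
  also have "\<dots> < top" by simp
  finally have fin: "(\<integral>\<^sup>+x. (\<Sum>k. ennreal (norm (d k x))) \<partial>cm) < top" .
  have "AE x in cm. (\<Sum>k. ennreal (norm (d k x))) \<noteq> \<infinity>"
  proof (rule nn_integral_PInf_AE)
    have [measurable]: "d k \<in> borel_measurable cm" for k using L2_perD(3)[OF Ld] .
    show "(\<lambda>x. \<Sum>k. ennreal (norm (d k x))) \<in> borel_measurable cm" by measurable
    show "(\<integral>\<^sup>+x. (\<Sum>k. ennreal (norm (d k x))) \<partial>cm) \<noteq> \<infinity>" using fin by (metis infinity_ennreal_def less_irrefl)
  qed
  hence conv: "AE x in cm. convergent (\<lambda>k. f (r k) x)"
  proof eventually_elim
    case (elim x)
    hence "summable (\<lambda>k. norm (d k x))"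
      by (intro summable_suminf_not_top) auto
    hence "summable (\<lambda>k. d k x)" by (rule summable_norm_cancel)
    hence "convergent (\<lambda>n. (\<Sum>k<n. d k x))" by (simp add: summable_iff_convergent)
    hence "convergent (\<lambda>n. f (r n) x - f (r 0) x)"
      unfolding d_def by (subst (asm) sum_lessThan_telescope)
    thus ?case by (simp add: convergent_diff_const_right_iff)
  qed
  \<comment> \<open>Where the subsequence diverges, \<open>lim\<close> still depends only on the
    sequence of values, so \<open>g\<close> is periodic at every point.\<close>
  define g where "g x = lim (\<lambda>k. f (r k) x)" for x
  have gm: "g \<in> borel_measurable lebesgue" unfolding g_def by measurable
  hence [measurable]: "g \<in> borel_measurable cm" by (rule measurable_restrict_space1)
  have gp: "periodic g" using L2_perD(1)[OF L2] by (simp add: periodic_def g_def)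
  have rk: "r k \<ge> k" for k by (simp add: r_def)
  have key: "\<exists>N. \<forall>n\<ge>N. (\<integral>\<^sup>+x. ennreal ((norm (f n x - g x))\<^sup>2) \<partial>cm) \<le> ennreal e" if "e > 0" for e
  proof -
    from cauchy[OF that] obtain N where N: "\<And>m n. m \<ge> N \<Longrightarrow> n \<ge> N \<Longrightarrow> l2sq (\<lambda>x. f m x - f n x) < e"
      by metis
    show ?thesis
    proof (intro exI allI impI)
      fix n assume n: "n \<ge> N"
      have "AE x in cm. ennreal ((norm (f n x - g x))\<^sup>2) = liminf (\<lambda>k. ennreal ((norm (f n x - f (r k) x))\<^sup>2))"
        using conv
      proof eventually_elim
        case (elim x)
        hence "(\<lambda>k. f (r k) x) \<longlonglongrightarrow> g x" by (simp add: g_def convergent_LIMSEQ_iff)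
        hence "(\<lambda>k. ennreal ((norm (f n x - f (r k) x))\<^sup>2)) \<longlonglongrightarrow> ennreal ((norm (f n x - g x))\<^sup>2)"
          by (intro tendsto_intros tendsto_ennrealI)
        thus ?case by (rule lim_imp_Liminf[OF sequentially_bot, symmetric])
      qed
      hence "(\<integral>\<^sup>+x. ennreal ((norm (f n x - g x))\<^sup>2) \<partial>cm)
           = (\<integral>\<^sup>+x. liminf (\<lambda>k. ennreal ((norm (f n x - f (r k) x))\<^sup>2)) \<partial>cm)"
        by (rule nn_integral_cong_AE)
      also have "\<dots> \<le> liminf (\<lambda>k. \<integral>\<^sup>+x. ennreal ((norm (f n x - f (r k) x))\<^sup>2) \<partial>cm)"
        by (rule nn_integral_liminf) measurable
      also have "(\<lambda>k. \<integral>\<^sup>+x. ennreal ((norm (f n x - f (r k) x))\<^sup>2) \<partial>cm) = (\<lambda>k. ennreal (l2sq (\<lambda>x. f n x - f (r k) x)))"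
        unfolding l2sq_def
        by (intro ext nn_integral_eq_integral L2_perD(4) L2_per_diff L2) auto
      also have "liminf (\<lambda>k. ennreal (l2sq (\<lambda>x. f n x - f (r k) x))) \<le> liminf (\<lambda>k. ennreal e)"
      proof (rule Liminf_mono)
        have "\<forall>k\<ge>N. ennreal (l2sq (\<lambda>x. f n x - f (r k) x)) \<le> ennreal e"
          using N[OF n] rk by (meson ennreal_leI le_trans less_imp_le)
        thus "\<forall>\<^sub>F k in sequentially. ennreal (l2sq (\<lambda>x. f n x - f (r k) x)) \<le> ennreal e"
          using eventually_sequentially by blast
      qed
      also have "\<dots> = ennreal e" by (simp add: Liminf_const)
      finally show "(\<integral>\<^sup>+x. ennreal ((norm (f n x - g x))\<^sup>2) \<partial>cm) \<le> ennreal e" .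
    qed
  qed
  have int: "integrable cm (\<lambda>x. (norm (f n x - g x))\<^sup>2)"
    if "(\<integral>\<^sup>+x. ennreal ((norm (f n x - g x))\<^sup>2) \<partial>cm) \<le> ennreal e" for n e
    using that by (intro integrableI_bounded) (auto simp: le_less_trans)
  obtain N0 where N0: "\<And>n. n \<ge> N0 \<Longrightarrow> (\<integral>\<^sup>+x. ennreal ((norm (f n x - g x))\<^sup>2) \<partial>cm) \<le> ennreal 1"
    using key[of 1] by auto
  have "L2_per (\<lambda>x. f N0 x - g x)"
    using int[OF N0[OF order_refl]] gp gm L2_perD(1,2)[OF L2[of N0]]
    by (simp add: L2_per_iff periodic_def)
  from L2_per_diff[OF L2[of N0] this] have Lg: "L2_per g" by simp
  have "(\<lambda>n. l2sq (\<lambda>x. f n x - g x)) \<longlonglongrightarrow> 0"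
  proof (rule LIMSEQ_I)
    fix e :: real assume e: "e > 0"
    obtain N where N: "\<And>n. n \<ge> N \<Longrightarrow> (\<integral>\<^sup>+x. ennreal ((norm (f n x - g x))\<^sup>2) \<partial>cm) \<le> ennreal (e/2)"
      using key[of "e/2"] e by auto
    have "l2sq (\<lambda>x. f n x - g x) < e" if "n \<ge> N" for n
    proof -
      have "ennreal (l2sq (\<lambda>x. f n x - g x)) \<le> ennreal (e/2)"
        using N[OF that] nn_integral_eq_integral[OF L2_perD(4)[OF L2_per_diff[OF L2[of n] Lg]]]
        by (simp add: l2sq_def)
      thus ?thesis using e by (simp add: ennreal_le_iff)
    qed
    thus "\<exists>no. \<forall>n\<ge>no. norm (l2sq (\<lambda>x. f n x - g x) - 0) < e"
      by (intro exI[of _ N]) (auto simp: abs_of_nonneg l2sq_nonneg)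
  qed
  with Lg that show ?thesis by blast
qed

section \<open>Periodic test functions\<close>

lemma integral_cm_continuous:
  assumes "continuous_on UNIV f"
  shows "integral\<^sup>L cm f = integral cell (f::vec2\<Rightarrow>'a::euclidean_space)" "integrable cm f" "f integrable_on cell"
proof -
  have c: "continuous_on cell f" using assms continuous_on_subset by blast
  show i: "integrable cm f" by (rule continuous_imp_integrable[OF c])
  show "integral\<^sup>L cm f = integral cell f" by (rule lebesgue_integral_eq_integral[OF i]) simp
  show "f integrable_on cell" by (rule integrable_continuous[OF c])
qed

text \<open>The translated cell is cut along the face where coordinate \<open>i\<close> equals 1;
  the part beyond it, moved back by one period, fills the slab below \<open>s\<close>.\<close>

lemma integral_cell_translate:
  fixes f :: "vec2 \<Rightarrow> 'a::euclidean_space"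
  assumes f: "continuous_on UNIV f" "periodic f" and s: "0 \<le> s" "s \<le> 1"
  shows "integral cell (\<lambda>x. f (x + s *\<^sub>R axis i 1)) = integral cell f"
proof -
  let ?a = "axis i 1 :: vec2"
  \<comment> \<open>Upper corner of that slab: \<open>s\<close> in coordinate \<open>i\<close> and 1
    in the other.\<close>
  define p where "p = 1 + s *\<^sub>R ?a - ?a"
  have int: "f integrable_on cbox u v" for u v
    using f(1) by (intro integrable_continuous) (blast intro: continuous_on_subset)
  have a: "?a \<in> Basis" by (auto simp: Basis_vec_def)
  have ax: "x \<bullet> ?a = x $ i" for x by (simp add: inner_axis)
  have i12: "i = 1 \<or> i = 2" by (rule exhaust_2)
  have e1: "cbox (s *\<^sub>R ?a) (1 + s *\<^sub>R ?a) \<inter> {x. x \<bullet> ?a \<le> 1} = cell \<inter> {x. x \<bullet> ?a \<ge> s}"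
    using i12 s unfolding ax by (auto simp: mem_box_cart forall_2 axis_def)
  have e2: "cbox (s *\<^sub>R ?a) (1 + s *\<^sub>R ?a) \<inter> {x. x \<bullet> ?a \<ge> 1} = cbox (0 + ?a) (p + ?a)"
    using i12 s unfolding ax by (auto simp: mem_box_cart forall_2 axis_def p_def)
  have e3: "cell \<inter> {x. x \<bullet> ?a \<le> s} = cbox 0 p"
    using i12 s unfolding ax by (auto simp: mem_box_cart forall_2 axis_def p_def)
  have per: "f \<circ> (+) ?a = f" using f(2) by (auto simp: periodic_def add.commute)
  have "(\<lambda>x. f (x + s *\<^sub>R ?a)) = f \<circ> (+) (s *\<^sub>R ?a)" by (auto simp: add.commute)
  hence "integral cell (\<lambda>x. f (x + s *\<^sub>R ?a)) = integral (cbox (s *\<^sub>R ?a) (1 + s *\<^sub>R ?a)) f"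
    using integral_shift_cbox_plus[of 0 1 f "s *\<^sub>R ?a"] by simp
  also have "\<dots> = integral (cell \<inter> {x. x \<bullet> ?a \<ge> s}) f + integral (cbox (0 + ?a) (p + ?a)) f"
    using integral_split[OF int a, of "s *\<^sub>R ?a" "1 + s *\<^sub>R ?a" 1] unfolding e1 e2 .
  also have "integral (cbox (0 + ?a) (p + ?a)) f = integral (cell \<inter> {x. x \<bullet> ?a \<le> s}) f"
    using integral_shift_cbox_plus[of 0 p f ?a] unfolding per e3 by simp
  also have "integral (cell \<inter> {x. x \<bullet> ?a \<ge> s}) f + \<dots> = integral cell f"
    using integral_split[OF int a, of 0 1 s] by simp
  finally show ?thesis .
qed

lemma test_funD:
  assumes "test_fun \<psi> d\<psi>"
  shows "periodic \<psi>" "GDERIV \<psi> x :> d\<psi> x" "continuous_on UNIV d\<psi>" "continuous_on UNIV \<psi>" "periodic d\<psi>"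
proof -
  show p: "periodic \<psi>" and g: "GDERIV \<psi> x :> d\<psi> x" and "continuous_on UNIV d\<psi>" for x
    using assms by (auto simp: test_fun_def)
  show "continuous_on UNIV \<psi>"
    using g by (auto simp: gderiv_def intro!: continuous_at_imp_continuous_on has_derivative_continuous)
  show "periodic d\<psi>"
    unfolding periodic_def
  proof (intro allI)
    fix x i
    let ?a = "axis i 1 :: vec2"
    have "((\<lambda>y. \<psi> (y + ?a)) has_derivative (\<lambda>h. h \<bullet> d\<psi> (x + ?a))) (at x)"
      by (rule has_derivative_compose[where g=\<psi> and f="\<lambda>y. y + ?a"])
         (use g in \<open>auto simp: gderiv_def intro!: derivative_eq_intros\<close>)
    moreover have "(\<lambda>y. \<psi> (y + ?a)) = \<psi>" using p by (auto simp: periodic_def)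
    ultimately have "(\<lambda>h. h \<bullet> d\<psi> (x + ?a)) = (\<lambda>h. h \<bullet> d\<psi> x)"
      using g[of x, unfolded gderiv_def] by (auto intro: has_derivative_unique)
    hence "h \<bullet> (d\<psi> (x + ?a) - d\<psi> x) = 0" for h by (auto simp: inner_diff_right dest: fun_cong)
    from this[of "d\<psi> (x + ?a) - d\<psi> x"] show "d\<psi> (x + ?a) = d\<psi> x" by simp
  qed
qed

lemma test_fun_L2:
  assumes "test_fun \<psi> d\<psi>" shows "L2_per \<psi>" "L2_per d\<psi>"
  using test_funD[OF assms] L2_per_continuous by blast+

lemma test_fun_const: "test_fun (\<lambda>x. c) (\<lambda>x. 0)"
  by (auto simp: test_fun_def periodic_def gderiv_def)

lemma test_fun_add: "test_fun \<psi> d\<psi> \<Longrightarrow> test_fun \<eta> d\<eta> \<Longrightarrow> test_fun (\<lambda>x. \<psi> x + \<eta> x) (\<lambda>x. d\<psi> x + d\<eta> x)"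
  by (auto simp: test_fun_def periodic_def intro!: GDERIV_add continuous_intros)

lemma test_fun_mult: "test_fun \<psi> d\<psi> \<Longrightarrow> test_fun \<eta> d\<eta> \<Longrightarrow>
    test_fun (\<lambda>x. \<psi> x * \<eta> x) (\<lambda>x. \<psi> x *\<^sub>R d\<eta> x + \<eta> x *\<^sub>R d\<psi> x)"
  using test_funD(4)[of \<psi> d\<psi>] test_funD(4)[of \<eta> d\<eta>]
  by (auto simp: test_fun_def periodic_def intro!: GDERIV_mult continuous_intros)

lemma test_fun_cmult: "test_fun \<psi> d\<psi> \<Longrightarrow> test_fun (\<lambda>x. c * \<psi> x) (\<lambda>x. c *\<^sub>R d\<psi> x)"
  using test_fun_mult[OF test_fun_const[of c]] by simp

text \<open>The mean of \<open>\<psi>\<close> over a translated cell does not depend on the shift,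
  so its derivative along each axis, taken under the integral, is zero.\<close>

lemma test_fun_integral_grad:
  assumes t: "test_fun \<psi> d\<psi>" shows "(\<integral>x. d\<psi> x \<partial>cm) = 0"
proof -
  note tD = test_funD[OF t]
  have "integral cell (\<lambda>x. d\<psi> x $ i) = 0" for i
  proof -
    let ?a = "axis i 1 :: vec2"
    define w where "w x = d\<psi> x $ i" for x
    have cw: "continuous_on UNIV w" "periodic w"
      using tD(3,5) by (auto simp: w_def[abs_def] periodic_def intro!: continuous_intros)
    have der: "((\<lambda>s. \<psi> (x + s *\<^sub>R ?a)) has_field_derivative w (x + s *\<^sub>R ?a)) (at s within {0<..<1})" for x s
    proof -
      have "((\<lambda>s. \<psi> (x + s *\<^sub>R ?a)) has_derivative (\<lambda>h. (h *\<^sub>R ?a) \<bullet> d\<psi> (x + s *\<^sub>R ?a))) (at s)"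
        by (rule has_derivative_compose[where g=\<psi> and f="\<lambda>s. x + s *\<^sub>R ?a"])
           (use tD(2) in \<open>auto simp: gderiv_def intro!: derivative_eq_intros\<close>)
      moreover have "(\<lambda>h. (h *\<^sub>R ?a) \<bullet> d\<psi> (x + s *\<^sub>R ?a)) = (*) (w (x + s *\<^sub>R ?a))"
        by (auto simp: w_def inner_axis' mult.commute)
      ultimately show ?thesis by (simp add: has_field_derivative_def has_derivative_at_withinI)
    qed
    have cs: "continuous_on UNIV (\<lambda>x. \<psi> (x + s *\<^sub>R ?a))" for s
      by (rule continuous_on_compose2[OF tD(4)]) (auto intro!: continuous_intros)
    \<comment> \<open>The shift 1/2 is interior to the range from 0 to 1 on which translation
      invariance is available.\<close>
    have "((\<lambda>s. integral cell (\<lambda>x. \<psi> (x + s *\<^sub>R ?a))) has_field_derivative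
            integral cell (\<lambda>x. w (x + (1/2) *\<^sub>R ?a))) (at (1/2) within {0<..<1})"
    proof (rule leibniz_rule_field_derivative)
      show "continuous_on ({0<..<1} \<times> cell) (\<lambda>(s, x). w (x + s *\<^sub>R ?a))"
        unfolding split_beta by (rule continuous_on_compose2[OF cw(1)]) (auto intro!: continuous_intros)
      show "(\<lambda>x. \<psi> (x + s *\<^sub>R ?a)) integrable_on cell" for s
        by (rule integral_cm_continuous(3)[OF cs])
    qed (use der in auto)
    hence "((\<lambda>s. integral cell (\<lambda>x. \<psi> (x + s *\<^sub>R ?a))) has_field_derivative
            integral cell (\<lambda>x. w (x + (1/2) *\<^sub>R ?a))) (at (1/2))"
      using at_within_open[of "1/2" "{0<..<1::real}"] by simp
    hence "((\<lambda>s. integral cell \<psi>) has_field_derivative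
            integral cell (\<lambda>x. w (x + (1/2) *\<^sub>R ?a))) (at (1/2))"
      by (rule has_field_derivative_transform_within_open[of _ _ _ "{0<..<1}"])
         (auto intro!: integral_cell_translate tD)
    hence "integral cell (\<lambda>x. w (x + (1/2) *\<^sub>R ?a)) = 0"
      by (rule DERIV_unique) simp
    thus ?thesis using integral_cell_translate[OF cw, of "1/2" i] by (simp add: w_def[abs_def])
  qed
  moreover have "integral cell d\<psi> $ i = integral cell (\<lambda>x. d\<psi> x $ i)" for i
    using integral_linear[OF integral_cm_continuous(3)[OF tD(3)] bounded_linear_vec_nth[of i]] by (simp add: o_def)
  ultimately show ?thesis
    by (simp add: integral_cm_continuous(1)[OF tD(3)] vec_eq_iff)
qed

lemma test_fun_by_parts:
  assumes "test_fun \<psi> d\<psi>" "test_fun \<eta> d\<eta>"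
  shows "(\<integral>x. \<psi> x *\<^sub>R d\<eta> x \<partial>cm) = - (\<integral>x. \<eta> x *\<^sub>R d\<psi> x \<partial>cm)"
proof -
  note c = test_funD(3,4)[OF assms(1)] test_funD(3,4)[OF assms(2)]
  have "(\<integral>x. \<psi> x *\<^sub>R d\<eta> x + \<eta> x *\<^sub>R d\<psi> x \<partial>cm) = 0"
    by (rule test_fun_integral_grad[OF test_fun_mult[OF assms]])
  moreover have "integrable cm (\<lambda>x. \<psi> x *\<^sub>R d\<eta> x)" "integrable cm (\<lambda>x. \<eta> x *\<^sub>R d\<psi> x)"
    by (intro integral_cm_continuous(2) continuous_intros c)+
  ultimately show ?thesis by (simp add: add_eq_0_iff2)
qed

section \<open>Trigonometric polynomials\<close>

definition intvec :: "vec2 \<Rightarrow> bool" where "intvec n \<longleftrightarrow> (\<forall>i. n $ i \<in> \<int>)"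

text \<open>The phase \<theta> makes sines special cosines, so these real functions are closed under
  products. Function and gradient are generated together, which keeps potentials at hand for every
  combination of gradients.\<close>

inductive trig_poly :: "(vec2 \<Rightarrow> real) \<Rightarrow> (vec2 \<Rightarrow> vec2) \<Rightarrow> bool" where
  base: "intvec n \<Longrightarrow> trig_poly (\<lambda>x. cos (2 * pi * (n \<bullet> x) + \<theta>)) (\<lambda>x. (- (2 * pi * sin (2 * pi * (n \<bullet> x) + \<theta>))) *\<^sub>R n)"
| add: "trig_poly \<psi> d\<psi> \<Longrightarrow> trig_poly \<eta> d\<eta> \<Longrightarrow> trig_poly (\<lambda>x. \<psi> x + \<eta> x) (\<lambda>x. d\<psi> x + d\<eta> x)"
| scale: "trig_poly \<psi> d\<psi> \<Longrightarrow> trig_poly (\<lambda>x. c * \<psi> x) (\<lambda>x. c *\<^sub>R d\<psi> x)"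

lemma test_fun_cos:
  assumes "intvec n"
  shows "test_fun (\<lambda>x. cos (2 * pi * (n \<bullet> x) + \<theta>)) (\<lambda>x. (- (2 * pi * sin (2 * pi * (n \<bullet> x) + \<theta>))) *\<^sub>R n)"
  unfolding test_fun_def
proof (intro conjI allI)
  show "periodic (\<lambda>x. cos (2 * pi * (n \<bullet> x) + \<theta>))"
    unfolding periodic_def
  proof (intro allI)
    fix x i
    obtain k :: int where k: "n $ i = of_int k" using assms by (auto simp: intvec_def elim: Ints_cases)
    have "2 * pi * (n \<bullet> (x + axis i 1)) + \<theta> = (2 * pi * (n \<bullet> x) + \<theta>) + 2 * pi * of_int k"
      by (simp add: inner_add_right inner_axis k algebra_simps)
    thus "cos (2 * pi * (n \<bullet> (x + axis i 1)) + \<theta>) = cos (2 * pi * (n \<bullet> x) + \<theta>)"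
      using sin_cos_eq_iff by metis
  qed
  show "GDERIV (\<lambda>x. cos (2 * pi * (n \<bullet> x) + \<theta>)) x :> (- (2 * pi * sin (2 * pi * (n \<bullet> x) + \<theta>))) *\<^sub>R n" for x
    unfolding gderiv_def by (auto intro!: derivative_eq_intros simp: inner_commute)
  show "continuous_on UNIV (\<lambda>x. (- (2 * pi * sin (2 * pi * (n \<bullet> x) + \<theta>))) *\<^sub>R n)"
    by (intro continuous_intros)
qed

lemma trig_poly_test_fun: "trig_poly \<psi> d\<psi> \<Longrightarrow> test_fun \<psi> d\<psi>"
proof (induction rule: trig_poly.induct)
  case (base n \<theta>)
  then show ?case by (rule test_fun_cos)
qed (blast intro: test_fun_add test_fun_cmult)+

lemma trig_poly_const: "\<exists>d. trig_poly (\<lambda>x. c) d"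
  using trig_poly.scale[OF trig_poly.base[of 0 0], of c] by (auto simp: intvec_def)

lemma trig_poly_zero: "trig_poly (\<lambda>x. 0) (\<lambda>x. 0)"
  using trig_poly.scale[OF trig_poly.base[of 0 0], of 0] by (auto simp: intvec_def)

lemma trig_poly_mult:
  assumes "trig_poly \<psi> d" "trig_poly \<eta> d'"
  shows "\<exists>d''. trig_poly (\<lambda>x. \<psi> x * \<eta> x) d''"
  using assms
proof (induction arbitrary: \<eta> d' rule: trig_poly.induct)
  case (base n \<theta>)
  from base(2,1) show ?case
  proof (induction rule: trig_poly.induct)
    case (base m \<zeta>)
    have "intvec (n - m)" "intvec (n + m)" using base by (auto simp: intvec_def)
    from trig_poly.scale[OF trig_poly.add[OF trig_poly.base[OF this(1), of "\<theta> - \<zeta>"] trig_poly.base[OF this(2), of "\<theta> + \<zeta>"]], of "1/2"]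
    obtain d where d: "trig_poly (\<lambda>x. 1/2 * (cos (2 * pi * ((n - m) \<bullet> x) + (\<theta> - \<zeta>)) + cos (2 * pi * ((n + m) \<bullet> x) + (\<theta> + \<zeta>)))) d"
      by blast
    have "cos (2 * pi * (n \<bullet> x) + \<theta>) * cos (2 * pi * (m \<bullet> x) + \<zeta>)
       = 1/2 * (cos (2 * pi * ((n - m) \<bullet> x) + (\<theta> - \<zeta>)) + cos (2 * pi * ((n + m) \<bullet> x) + (\<theta> + \<zeta>)))" for x
      unfolding cos_times_cos by (simp add: inner_diff_left inner_add_left algebra_simps)
    thus ?case using d by (simp only:) blast
  next
    case (add \<psi> d\<psi> \<eta> d\<eta>)
    then obtain a b where "trig_poly (\<lambda>x. cos (2 * pi * (n \<bullet> x) + \<theta>) * \<psi> x) a"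
       "trig_poly (\<lambda>x. cos (2 * pi * (n \<bullet> x) + \<theta>) * \<eta> x) b" by blast
    from trig_poly.add[OF this] show ?case by (auto simp: distrib_left)
  next
    case (scale \<psi> d\<psi> c)
    then obtain a where "trig_poly (\<lambda>x. cos (2 * pi * (n \<bullet> x) + \<theta>) * \<psi> x) a" by blast
    from trig_poly.scale[OF this, of c] show ?case by (auto simp: mult_ac)
  qed
next
  case (add \<psi>1 d1 \<psi>2 d2)
  from add.IH[OF add.prems] obtain a b where "trig_poly (\<lambda>x. \<psi>1 x * \<eta> x) a" "trig_poly (\<lambda>x. \<psi>2 x * \<eta> x) b" by blast
  from trig_poly.add[OF this] show ?case by (auto simp: distrib_right)
next
  case (scale \<psi> d\<psi> c)
  from scale.IH[OF scale.prems] obtain a where "trig_poly (\<lambda>x. \<psi> x * \<eta> x) a" by blast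
  from trig_poly.scale[OF this, of c] show ?case by (auto simp: mult_ac)
qed

text \<open>An embedding of the torus in a real vector space whose linear functionals pull back to
  trigonometric polynomials. It reduces the approximation of periodic functions to polynomial
  approximation on a compact set.\<close>

definition torus :: "vec2 \<Rightarrow> complex \<times> complex"
  where "torus x = (cis (2 * pi * x $ 1), cis (2 * pi * x $ 2))"

lemma trig_poly_torus:
  assumes "real_polynomial_function P" shows "\<exists>d. trig_poly (\<lambda>x. P (torus x)) d"
  using assms
proof (induction rule: real_polynomial_function.induct)
  case (linear P)
  interpret bounded_linear P by fact
  \<comment> \<open>A real-linear functional is determined by its values at (1,0), (i,0), (0,1) and
    (0,i); the sines appear as cosines of phase -pi/2.\<close>
  define a b where "a i = P (if i = 1 then (1, 0) else (0, 1))" and "b i = P (if i = 1 then (\<i>, 0) else (0, \<i>))" for i :: 2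
  have sp: "torus x = (cos (2 * pi * x $ 1)) *\<^sub>R (1, 0) + (sin (2 * pi * x $ 1)) *\<^sub>R (\<i>, 0)
         + ((cos (2 * pi * x $ 2)) *\<^sub>R (0, 1) + (sin (2 * pi * x $ 2)) *\<^sub>R (0, \<i>))" for x
    by (simp add: torus_def complex_eq_iff)
  have eq: "P (torus x) = (a 1 * cos (2 * pi * (axis 1 1 \<bullet> x) + 0) + b 1 * cos (2 * pi * (axis 1 1 \<bullet> x) + - (pi/2)))
      + (a 2 * cos (2 * pi * (axis 2 1 \<bullet> x) + 0) + b 2 * cos (2 * pi * (axis 2 1 \<bullet> x) + - (pi/2)))" for x
    unfolding sp add scaleR by (simp add: a_def b_def inner_axis' cos_diff)
  have iv: "intvec (axis i 1)" for i by (auto simp: intvec_def axis_def)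
  show ?case unfolding eq
    using trig_poly.add[OF trig_poly.add[OF trig_poly.scale[OF trig_poly.base[OF iv]] trig_poly.scale[OF trig_poly.base[OF iv]]]
       trig_poly.add[OF trig_poly.scale[OF trig_poly.base[OF iv]] trig_poly.scale[OF trig_poly.base[OF iv]]]]
    by blast
next
  case (add P Q)
  then show ?case using trig_poly.add by blast
next
  case (mult P Q)
  then show ?case using trig_poly_mult by blast
qed (rule trig_poly_const)

lemma continuous_torus: "continuous_on UNIV torus"
  unfolding torus_def[abs_def] cis_conv_exp by (intro continuous_intros)

text \<open>Opposite faces of the cell have the same image. With one point interior, coordinates
  that agree modulo 1 differ by less than 1 and hence coincide.\<close>

lemma torus_inj:
  assumes "x \<in> box 0 1" "y \<in> cell" "torus x = torus y" shows "x = y"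
proof -
  have "x $ i = y $ i" for i
  proof -
    have "cis (2 * pi * x $ i) = cis (2 * pi * y $ i)"
      using exhaust_2[of i] assms(3) by (auto simp: torus_def)
    then obtain k :: int where "2 * pi * x $ i = 2 * pi * y $ i + 2 * pi * of_int k"
      using sin_cos_eq_iff[of "2 * pi * x $ i" "2 * pi * y $ i"] by (auto simp: complex_eq_iff)
    hence "2 * pi * (x $ i - y $ i - of_int k) = 0" by (simp add: algebra_simps)
    hence k: "x $ i = y $ i + of_int k" by simp
    have "0 < x $ i" "x $ i < 1" "0 \<le> y $ i" "y $ i \<le> 1"
      using assms(1,2) by (auto simp: mem_box_cart)
    hence "of_int k < (1::real)" "of_int k > (-1::real)" using k by linarith+
    hence "k = 0" by linarith
    thus ?thesis using k by simp
  qed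
  thus ?thesis by (simp add: vec_eq_iff)
qed

lemma integrable_mult_continuous:
  fixes f :: "vec2 \<Rightarrow> real"
  assumes "integrable cm f" "continuous_on UNIV \<psi>" shows "integrable cm (\<lambda>x. f x * \<psi> x)"
proof -
  have c: "continuous_on cell \<psi>" using assms(2) continuous_on_subset by blast
  have "bounded (\<psi> ` cell)" using c compact_continuous_image compact_imp_bounded compact_cbox by blast
  then obtain B where B: "\<And>x. x \<in> cell \<Longrightarrow> \<bar>\<psi> x\<bar> \<le> B" unfolding bounded_iff by auto
  show ?thesis
  proof (rule Bochner_Integration.integrable_bound[of cm "\<lambda>x. B * \<bar>f x\<bar>"])
    show "integrable cm (\<lambda>x. B * \<bar>f x\<bar>)" using assms(1) by simp
    show "(\<lambda>x. f x * \<psi> x) \<in> borel_measurable cm"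
      using assms(1) continuous_imp_measurable_on_sets_lebesgue[OF c lmeasurable_cbox[THEN fmeasurableD]] by measurable
    show "AE x in cm. norm (f x * \<psi> x) \<le> norm (B * \<bar>f x\<bar>)"
    proof (rule AE_I2)
      fix x assume "x \<in> space cm"
      hence "\<bar>\<psi> x\<bar> \<le> B" using B by simp
      hence "\<bar>f x\<bar> * \<bar>\<psi> x\<bar> \<le> \<bar>f x\<bar> * B" "0 \<le> B" by (auto intro: mult_left_mono)
      thus "norm (f x * \<psi> x) \<le> norm (B * \<bar>f x\<bar>)" by (simp add: abs_mult mult.commute)
    qed
  qed
qed

text \<open>By Stone-Weierstrass on the image of the torus, \<open>f\<close> annihilates every continuous function of
  \<open>torus x\<close>, hence, in the limit, indicators of compact subsets of the open cell. Inner regularity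
  then shows that \<open>f > 0\<close> only on a null set.\<close>

lemma trig_total_aux:
  fixes f :: "vec2 \<Rightarrow> real"
  assumes f: "integrable cm f"
    and orth: "\<And>n \<theta>. intvec n \<Longrightarrow> (\<integral>x. f x * cos (2 * pi * (n \<bullet> x) + \<theta>) \<partial>cm) = 0"
  shows "AE x in cm. f x \<le> 0"
proof -
  have tp: "(\<integral>x. f x * \<psi> x \<partial>cm) = 0" if "trig_poly \<psi> d" for \<psi> d
    using that
  proof (induction rule: trig_poly.induct)
    case (add \<psi> d\<psi> \<eta> d\<eta>)
    have "continuous_on UNIV \<psi>" "continuous_on UNIV \<eta>"
      using add trig_poly_test_fun test_funD(4) by blast+
    from integrable_mult_continuous[OF f this(1)] integrable_mult_continuous[OF f this(2)]
    show ?case using add by (simp add: distrib_left)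
  next
    case (scale \<psi> d\<psi> c)
    have "(\<lambda>x. f x * (c * \<psi> x)) = (\<lambda>x. c * (f x * \<psi> x))" by (auto simp: mult_ac)
    thus ?case using scale by simp
  qed (use orth in auto)
  have cont: "(\<integral>x. f x * F (torus x) \<partial>cm) = 0" if F: "continuous_on UNIV F" for F
  proof (rule ccontr)
    let ?I = "\<integral>x. f x * F (torus x) \<partial>cm"
    assume ne: "?I \<noteq> 0"
    define N where "N = (\<integral>x. \<bar>f x\<bar> \<partial>cm)"
    have N: "N \<ge> 0" by (simp add: N_def)
    \<comment> \<open>The approximation error is at most \<open>N * e\<close>, which the denominator
      \<open>N + 1\<close> keeps strictly below the modulus of \<open>?I\<close>.\<close>
    define e where "e = \<bar>?I\<bar> / (N + 1)"
    have e: "e > 0" using ne N by (simp add: e_def)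
    have "compact (torus ` cell)"
      by (intro compact_continuous_image continuous_on_subset[OF continuous_torus]) auto
    from Stone_Weierstrass_real_polynomial_function[OF this continuous_on_subset[OF F] e]
    obtain P where P: "real_polynomial_function P" "\<And>y. y \<in> torus ` cell \<Longrightarrow> \<bar>F y - P y\<bar> < e" by auto
    from trig_poly_torus[OF P(1)] obtain d where d: "trig_poly (\<lambda>x. P (torus x)) d" by blast
    have i1: "integrable cm (\<lambda>x. f x * P (torus x))"
      using trig_poly_test_fun[OF d] test_funD(4) integrable_mult_continuous[OF f] by blast
    have i2: "integrable cm (\<lambda>x. f x * F (torus x))"
      by (intro integrable_mult_continuous f continuous_on_compose2[OF F continuous_torus]) auto
    have "?I = (\<integral>x. f x * F (torus x) - f x * P (torus x) \<partial>cm)"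
      using tp[OF d] i1 i2 by simp
    also have "\<bar>\<dots>\<bar> \<le> (\<integral>x. \<bar>f x * F (torus x) - f x * P (torus x)\<bar> \<partial>cm)"
      using integral_norm_bound[of cm "\<lambda>x. f x * F (torus x) - f x * P (torus x)"] by simp
    also have "\<dots> \<le> (\<integral>x. \<bar>f x\<bar> * e \<partial>cm)"
    proof (rule integral_mono)
      show "integrable cm (\<lambda>x. \<bar>f x * F (torus x) - f x * P (torus x)\<bar>)" using i1 i2 by simp
      show "integrable cm (\<lambda>x. \<bar>f x\<bar> * e)" using f by simp
      fix x assume "x \<in> space cm"
      hence "\<bar>F (torus x) - P (torus x)\<bar> \<le> e" using P(2)[of "torus x"] by (auto intro: less_imp_le)
      thus "\<bar>f x * F (torus x) - f x * P (torus x)\<bar> \<le> \<bar>f x\<bar> * e"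
        by (simp add: right_diff_distrib[symmetric] abs_mult mult_left_mono)
    qed
    also have "\<dots> = N * e" by (simp add: N_def)
    finally have "\<bar>?I\<bar> \<le> N * e" .
    moreover have "\<bar>?I\<bar> = (N + 1) * e" using N by (simp add: e_def)
    ultimately have "e \<le> 0" by (simp add: distrib_right)
    thus False using e by simp
  qed
  have ind: "(\<integral>x. f x * indicator K x \<partial>cm) = 0" if K: "compact K" "K \<subseteq> box 0 1" for K
  proof (cases "K = {}")
    case False
    \<comment> \<open>Continuous cut-offs that decrease to the indicator of the image of
      \<open>K\<close>. They are functions on the target of \<open>torus\<close>, as
      \<open>cont\<close> requires.\<close>
    define F where "F k y = max 0 (1 - real k * infdist y (torus ` K))" for k y
    have cK: "closed (torus ` K)"
      by (intro compact_imp_closed compact_continuous_image continuous_on_subset[OF continuous_torus] K) auto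
    have "(\<lambda>k. \<integral>x. f x * F k (torus x) \<partial>cm) \<longlonglongrightarrow> (\<integral>x. f x * indicator K x \<partial>cm)"
    proof (rule integral_dominated_convergence[where w="\<lambda>x. \<bar>f x\<bar>"])
      have Fc: "continuous_on UNIV (F k)" for k
        unfolding F_def by (intro continuous_intros)
      show "(\<lambda>x. f x * F k (torus x)) \<in> borel_measurable cm" for k
        by (intro borel_measurable_integrable integrable_mult_continuous f continuous_on_compose2[OF Fc continuous_torus]) auto
      have "K \<in> sets lebesgue" using compact_imp_closed[OF K(1)] by auto
      moreover have "K \<subseteq> cell" using K(2) box_subset_cbox by blast
      ultimately have "K \<in> sets cm" by (simp add: sets_restrict_space_iff)
      thus "(\<lambda>x. f x * indicator K x) \<in> borel_measurable cm" using f by measurable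
      show "AE x in cm. norm (f x * F k (torus x)) \<le> \<bar>f x\<bar>" for k
        by (auto intro!: AE_I2 mult_left_le simp: abs_mult F_def infdist_nonneg)
      show "AE x in cm. (\<lambda>k. f x * F k (torus x)) \<longlonglongrightarrow> f x * indicator K x"
      proof (rule AE_I2)
        fix x assume x: "x \<in> space cm"
        show "(\<lambda>k. f x * F k (torus x)) \<longlonglongrightarrow> f x * indicator K x"
        proof (cases "x \<in> K")
          case True
          hence "F k (torus x) = 1" for k by (simp add: F_def)
          thus ?thesis using True by simp
        next
          case False
          have "torus x \<notin> torus ` K"
          proof
            assume "torus x \<in> torus ` K"
            then obtain k where "k \<in> K" "torus k = torus x" by auto
            thus False using torus_inj[of k x] K(2) x False by auto
          qed
          hence pos: "infdist (torus x) (torus ` K) > 0"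
            using in_closed_iff_infdist_zero[OF cK] \<open>K \<noteq> {}\<close> infdist_nonneg[of "torus x" "torus ` K"]
            by (auto simp: less_le)
          obtain m where m: "1 < real m * infdist (torus x) (torus ` K)"
            using reals_Archimedean3[OF pos] by blast
          have "F k (torus x) = 0" if "k \<ge> m" for k
          proof -
            have "real m * infdist (torus x) (torus ` K) \<le> real k * infdist (torus x) (torus ` K)"
              using that pos by (intro mult_right_mono) auto
            thus ?thesis using m by (simp add: F_def)
          qed
          hence "\<forall>\<^sub>F k in sequentially. f x * F k (torus x) = f x * indicator K x"
            using False by (auto simp: eventually_sequentially)
          thus ?thesis by (rule tendsto_eventually)
        qed
      qed
    qed (use f in simp)
    moreover have "(\<integral>x. f x * F k (torus x) \<partial>cm) = 0" for k
      by (rule cont) (auto simp: F_def intro!: continuous_intros)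
    ultimately show ?thesis by (simp add: LIMSEQ_const_iff)
  qed simp
  \<comment> \<open>The boundary of the cell, where \<open>torus\<close> is not injective, is left
    out here and treated as a null set at the end.\<close>
  define A where "A = {x \<in> box 0 1. f x > 0}"
  have fm: "f \<in> borel_measurable cm" using f by simp
  have "{x \<in> space cm. f x > 0} \<in> sets cm" using fm by measurable
  hence "{x \<in> cell. f x > 0} \<in> sets lebesgue" by (auto simp: sets_restrict_space_iff)
  hence "{x \<in> cell. f x > 0} \<inter> box 0 1 \<in> sets lebesgue" by auto
  moreover have "{x \<in> cell. f x > 0} \<inter> box 0 1 = A" using box_subset_cbox by (auto simp: A_def)
  ultimately have A: "A \<in> sets lebesgue" by simp
  have Ae: "emeasure lebesgue A \<le> ennreal e" if "e > 0" for e
  proof -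
    from sets_lebesgue_inner_closed[OF A that] obtain C where
      C: "closed C" "C \<subseteq> A" "A - C \<in> lmeasurable" "emeasure lebesgue (A - C) < ennreal e" .
    have CB: "C \<subseteq> box 0 1" using C(2) by (auto simp: A_def)
    have cC: "compact C" using C(1) CB bounded_box bounded_subset compact_eq_bounded_closed by blast
    have Cl: "C \<in> sets lebesgue" using C(1) by auto
    have CC: "C \<subseteq> cell" using CB box_subset_cbox by blast
    have Cs: "C \<in> sets cm" using Cl CC by (auto simp: sets_restrict_space_iff)
    have "AE x in cm. f x * indicator C x = 0"
    proof (subst integral_nonneg_eq_0_iff_AE[symmetric])
      show "integrable cm (\<lambda>x. f x * indicator C x)"
        using integrable_mult_indicator[OF Cs f] by (simp add: mult.commute)
      show "AE x in cm. 0 \<le> f x * indicator C x"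
        using C(2) by (intro AE_I2) (auto simp: A_def indicator_def)
    qed (rule ind[OF cC CB])
    hence "AE x in cm. x \<notin> C"
      by eventually_elim (use C(2) in \<open>auto simp: A_def indicator_def\<close>)
    hence "emeasure cm C = 0"
      using Cs AE_iff_measurable[of C cm "\<lambda>x. x \<notin> C"] CC by auto
    hence "emeasure lebesgue C = 0"
      using CC by (subst (asm) emeasure_restrict_space) auto
    moreover have "emeasure lebesgue A \<le> emeasure lebesgue C + emeasure lebesgue (A - C)"
    proof -
      have "A = C \<union> (A - C)" using C(2) by auto
      thus ?thesis using emeasure_subadditive[of C lebesgue "A - C"] Cl C(3) by (metis fmeasurableD)
    qed
    ultimately show ?thesis using C(4) by simp
  qed
  have "emeasure lebesgue A \<le> 0"
    by (rule ennreal_le_epsilon) (simp only: add_0 Ae)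
  hence A0: "A \<in> null_sets lebesgue" using A by auto
  have B0: "cell - box 0 1 \<in> null_sets lebesgue"
    using negligible_frontier_interval[of 0 "1::vec2"] by (simp add: negligible_iff_null_sets)
  have "AE x in lebesgue. x \<notin> A \<union> (cell - box 0 1)"
    using A0 B0 by (intro AE_not_in) auto
  hence "AE x in lebesgue. x \<in> cell \<longrightarrow> f x \<le> 0"
    by eventually_elim (auto simp: A_def)
  thus ?thesis by (subst AE_restrict_space_iff) auto
qed

lemma trig_total:
  fixes f :: "vec2 \<Rightarrow> real"
  assumes f: "integrable cm f"
    and orth: "\<And>n \<theta>. intvec n \<Longrightarrow> (\<integral>x. f x * cos (2 * pi * (n \<bullet> x) + \<theta>) \<partial>cm) = 0"
  shows "AE x in cm. f x = 0"
proof -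
  have "AE x in cm. f x \<le> 0" by (rule trig_total_aux[OF f orth])
  moreover have "AE x in cm. - f x \<le> 0"
    using orth by (intro trig_total_aux) (use f in auto)
  ultimately show ?thesis by eventually_elim auto
qed

section \<open>Poincare inequality\<close>

lemma content_cell [simp]: "measure lborel cell = 1"
  by (simp add: measure_def emeasure_cell)

text \<open>Nonnegativity of the variance of \<open>g\<close> on the unit interval.\<close>

lemma integral_square_le:
  fixes g :: "real \<Rightarrow> real"
  assumes g: "continuous_on {0..1} g"
  shows "(integral {0..1} g)\<^sup>2 \<le> integral {0..1} (\<lambda>t. (g t)\<^sup>2)"
proof -
  define c where "c = integral {0..1} g"
  have i: "g integrable_on {0..1}" "(\<lambda>t. (g t)\<^sup>2) integrable_on {0..1}"
    by (intro integrable_continuous_real continuous_intros g)+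
  have "0 \<le> integral {0..1} (\<lambda>t. (g t - c)\<^sup>2)"
    by (intro integral_nonneg integrable_continuous_real continuous_intros g) auto
  also have "(\<lambda>t. (g t - c)\<^sup>2) = (\<lambda>t. ((g t)\<^sup>2 - (2 * c) * g t) + c\<^sup>2)"
    by (auto simp: power2_eq_square algebra_simps)
  also have "integral {0..1} \<dots> = integral {0..1} (\<lambda>t. (g t)\<^sup>2) - 2 * c * c + c\<^sup>2"
  proof -
    have i2: "(\<lambda>t. (2 * c) * g t) integrable_on {0..1}" using i(1) by (intro integrable_on_mult_right)
    have ic: "(\<lambda>t::real. c\<^sup>2) integrable_on {0..1}" by (rule integrable_const_ivl)
    have "integral {0..1} (\<lambda>t. ((g t)\<^sup>2 - (2 * c) * g t) + c\<^sup>2)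
        = integral {0..1} (\<lambda>t. (g t)\<^sup>2 - (2 * c) * g t) + integral {0..1} (\<lambda>t::real. c\<^sup>2)"
      using integral_add[OF integrable_diff[OF i(2) i2] ic] .
    also have "integral {0..1} (\<lambda>t. (g t)\<^sup>2 - (2 * c) * g t) = integral {0..1} (\<lambda>t. (g t)\<^sup>2) - 2 * c * c"
      unfolding integral_diff[OF i(2) i2] integral_mult_right c_def[symmetric] ..
    finally show ?thesis by simp
  qed
  finally show ?thesis by (simp add: c_def power2_eq_square)
qed

text \<open>Contraction towards \<open>y\<close> maps the convex cell into itself with Jacobian
  \<open>t\<^sup>2\<close>; the constant 4 is the inverse Jacobian at
  \<open>t = 1/2\<close>.\<close>

lemma integral_scaled_le:
  fixes F :: "vec2 \<Rightarrow> real"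
  assumes F: "continuous_on UNIV F" "\<And>x. F x \<ge> 0" and t: "1/2 \<le> t" "t \<le> 1" and y: "y \<in> cell"
  shows "integral cell (\<lambda>x. F (t *\<^sub>R x + (1 - t) *\<^sub>R y)) \<le> 4 * integral cell F"
proof -
  define c where "c = (1 - t) *\<^sub>R y"
  have int: "F integrable_on cbox u v" for u v
    using F(1) by (intro integrable_continuous) (blast intro: continuous_on_subset)
  have box: "(c - c) /\<^sub>R t = 0" "(t *\<^sub>R 1 + c - c) /\<^sub>R t = 1" using t by auto
  have "((\<lambda>x. F (t *\<^sub>R x + c)) has_integral integral (cbox c (t *\<^sub>R 1 + c)) F /\<^sub>R t ^ DIM(vec2)) cell"
    using has_integral_affinity'[where f=F and a=c and b="t *\<^sub>R 1 + c" and m=t and c=c, OF integrable_integral[OF int]] t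
    unfolding box by simp
  hence "integral cell (\<lambda>x. F (t *\<^sub>R x + c)) = integral (cbox c (t *\<^sub>R 1 + c)) F / t\<^sup>2"
    by (simp add: integral_unique divide_inverse mult.commute)
  also have "\<dots> \<le> integral cell F / (1/2)\<^sup>2"
  proof (rule frac_le)
    have "cbox c (t *\<^sub>R 1 + c) \<subseteq> cell"
    proof
      fix z assume z: "z \<in> cbox c (t *\<^sub>R 1 + c)"
      have "0 \<le> z $ i \<and> z $ i \<le> 1" for i
      proof -
        have "(1 - t) * y $ i \<le> z $ i" "z $ i \<le> t + (1 - t) * y $ i" "0 \<le> y $ i" "y $ i \<le> 1"
          using z y by (auto simp: mem_box_cart c_def)
        moreover have "(1 - t) * y $ i \<le> 1 - t" using mult_left_mono[of "y $ i" 1 "1 - t"] calculation t by simp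
        moreover have "(1 - t) * y $ i \<ge> 0" using calculation t by simp
        ultimately show ?thesis by (intro conjI) linarith+
      qed
      thus "z \<in> cell" by (simp add: mem_box_cart)
    qed
    thus "integral (cbox c (t *\<^sub>R 1 + c)) F \<le> integral cell F"
      by (intro integral_subset_le int) (use F(2) in auto)
    show "0 \<le> integral cell F" by (intro integral_nonneg int F(2))
    show "(1/2)\<^sup>2 \<le> t\<^sup>2" using t by (intro power_mono) auto
  qed auto
  finally show ?thesis by (simp add: c_def power2_eq_square)
qed

lemma dist_cell_le:
  assumes "x \<in> cell" "y \<in> cell" shows "(norm (x - y :: vec2))\<^sup>2 \<le> 2"
proof -
  have "\<bar>x $ i - y $ i\<bar> \<le> 1" for i
  proof -
    have "0 \<le> x $ i" "x $ i \<le> 1" "0 \<le> y $ i" "y $ i \<le> 1" using assms by (auto simp: mem_box_cart)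
    thus ?thesis by linarith
  qed
  hence "(x $ i - y $ i)\<^sup>2 \<le> 1" for i by (simp add: abs_square_le_1)
  from add_mono[OF this[of 1] this[of 2]] show ?thesis
    unfolding power2_norm_eq_inner by (simp add: inner_vec_def sum_2 power2_eq_square)
qed

text \<open>Bounds the difference of two values by the gradient on the segment between the two points.
  At the point with parameter \<open>t\<close> on it, one integrates first over the endpoint whose weight is at
  least 1/2, so that the change of variables costs a factor of at most 4.\<close>

theorem poincare:
  assumes t: "test_fun \<psi> d\<psi>" and mean: "(\<integral>x. \<psi> x \<partial>cm) = 0"
  shows "l2sq \<psi> \<le> 4 * l2sq d\<psi>"
proof -
  note tD = test_funD[OF t]
  define F where "F x = (norm (d\<psi> x))\<^sup>2" for x
  have F: "continuous_on UNIV F" "\<And>x. F x \<ge> 0"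
    unfolding F_def by (auto intro!: continuous_intros tD)
  have F': "continuous_on UNIV (\<lambda>z. F (h z))" if "continuous_on UNIV h" for h :: "'z::topological_space \<Rightarrow> vec2"
    by (rule continuous_on_compose2[OF F(1) that]) auto
  have ct: "continuous_on A \<psi>" for A using tD(4) continuous_on_subset by blast
  define C where "C = integral cell F"
  have pw: "(\<psi> x - \<psi> y)\<^sup>2 \<le> 2 * integral {0..1} (\<lambda>t. F (t *\<^sub>R x + (1 - t) *\<^sub>R y))" if xy: "x \<in> cell" "y \<in> cell" for x y
  proof -
    define g where "g t = (x - y) \<bullet> d\<psi> (t *\<^sub>R x + (1 - t) *\<^sub>R y)" for t
    have gc: "continuous_on {0..1} g" unfolding g_def
      by (intro continuous_intros continuous_on_compose2[OF tD(3)]) auto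
    have "(g has_integral \<psi> (1 *\<^sub>R x + (1 - 1) *\<^sub>R y) - \<psi> (0 *\<^sub>R x + (1 - 0) *\<^sub>R y)) {0..1}"
    proof (rule fundamental_theorem_of_calculus)
      fix t :: real
      have "((\<lambda>t. \<psi> (t *\<^sub>R x + (1 - t) *\<^sub>R y)) has_derivative (\<lambda>h. (h *\<^sub>R (x - y)) \<bullet> d\<psi> (t *\<^sub>R x + (1 - t) *\<^sub>R y))) (at t)"
        by (rule has_derivative_compose[where g=\<psi> and f="\<lambda>t. t *\<^sub>R x + (1 - t) *\<^sub>R y"])
           (use tD(2) in \<open>auto simp: gderiv_def algebra_simps intro!: derivative_eq_intros\<close>)
      moreover have "(\<lambda>h. (h *\<^sub>R (x - y)) \<bullet> d\<psi> (t *\<^sub>R x + (1 - t) *\<^sub>R y)) = (\<lambda>h. h *\<^sub>R g t)"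
        by (auto simp: g_def)
      ultimately show "((\<lambda>t. \<psi> (t *\<^sub>R x + (1 - t) *\<^sub>R y)) has_vector_derivative g t) (at t within {0..1})"
        by (simp add: has_vector_derivative_def has_derivative_at_withinI)
    qed simp
    hence "integral {0..1} g = \<psi> x - \<psi> y" by (simp add: integral_unique)
    hence "(\<psi> x - \<psi> y)\<^sup>2 \<le> integral {0..1} (\<lambda>t. (g t)\<^sup>2)"
      using integral_square_le[OF gc] by simp
    also have "\<dots> \<le> integral {0..1} (\<lambda>t. 2 * F (t *\<^sub>R x + (1 - t) *\<^sub>R y))"
    proof (rule integral_le)
      show "(\<lambda>t. (g t)\<^sup>2) integrable_on {0..1}" by (intro integrable_continuous_real continuous_intros gc)
      show "(\<lambda>t. 2 * F (t *\<^sub>R x + (1 - t) *\<^sub>R y)) integrable_on {0..1}"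
        by (intro integrable_continuous_real continuous_intros continuous_on_compose2[OF F(1)]) auto
      fix t :: real
      have "(g t)\<^sup>2 \<le> (norm (x - y))\<^sup>2 * F (t *\<^sub>R x + (1 - t) *\<^sub>R y)"
        unfolding g_def F_def power_mult_distrib[symmetric]
        using Cauchy_Schwarz_ineq2 by (intro power2_le_iff_abs_le[THEN iffD2]) auto
      also have "\<dots> \<le> 2 * F (t *\<^sub>R x + (1 - t) *\<^sub>R y)"
        using dist_cell_le[OF xy] F(2) by (intro mult_right_mono) auto
      finally show "(g t)\<^sup>2 \<le> 2 * F (t *\<^sub>R x + (1 - t) *\<^sub>R y)" .
    qed
    also have "\<dots> = 2 * integral {0..1} (\<lambda>t. F (t *\<^sub>R x + (1 - t) *\<^sub>R y))" by simp
    finally show ?thesis .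
  qed
  let ?Z = "cbox (0, 0) (1, 1) :: (vec2 \<times> vec2) set"
  define G where "G z t = F (t *\<^sub>R fst z + (1 - t) *\<^sub>R snd z)" for z t
  have Gc: "continuous_on UNIV (\<lambda>(z, t). G z t)"
    unfolding G_def split_beta by (intro F' continuous_intros)
  have Gt: "integral ?Z (\<lambda>z. G z t) \<le> 4 * C" if t: "t \<in> {0..1}" for t
  proof -
    have c2: "continuous_on (cbox (0,0) (1,1)) (\<lambda>(x, y). F (t *\<^sub>R x + (1 - t) *\<^sub>R y))"
      unfolding split_beta by (rule continuous_on_subset[OF F']) (auto intro!: continuous_intros)
    have e1: "integral ?Z (\<lambda>z. G z t) = integral cell (\<lambda>x. integral cell (\<lambda>y. F (t *\<^sub>R x + (1 - t) *\<^sub>R y)))"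
      using integral_prod_continuous[OF c2] by (simp add: G_def case_prod_unfold)
    have e2: "\<dots> = integral cell (\<lambda>y. integral cell (\<lambda>x. F (t *\<^sub>R x + (1 - t) *\<^sub>R y)))"
      by (rule integral_swap_continuous[OF c2])
    have cxy: "continuous_on (cell \<times> cell) (\<lambda>(x, y). F (t *\<^sub>R x + (1 - t) *\<^sub>R y))"
      and cyx: "continuous_on (cell \<times> cell) (\<lambda>(y, x). F (t *\<^sub>R x + (1 - t) *\<^sub>R y))"
      unfolding split_beta by (rule continuous_on_subset[OF F'], auto intro!: continuous_intros)+
    have c3: "continuous_on cell (\<lambda>x. integral cell (\<lambda>y. F (t *\<^sub>R x + (1 - t) *\<^sub>R y)))"
      by (rule integral_continuous_on_param[OF cxy])
    have c4: "continuous_on cell (\<lambda>y. integral cell (\<lambda>x. F (t *\<^sub>R x + (1 - t) *\<^sub>R y)))"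
      by (rule integral_continuous_on_param[OF cyx])
    show ?thesis
    proof (cases "t \<ge> 1/2")
      case True
      have "integral cell (\<lambda>y. integral cell (\<lambda>x. F (t *\<^sub>R x + (1 - t) *\<^sub>R y))) \<le> integral cell (\<lambda>y::vec2. 4 * C)"
        unfolding C_def using True t
        by (intro integral_le integrable_continuous c4 continuous_intros integral_scaled_le F) auto
      thus ?thesis unfolding e1 e2 by simp
    next
      case False
      have "integral cell (\<lambda>y. F (t *\<^sub>R x + (1 - t) *\<^sub>R y)) \<le> 4 * C" if "x \<in> cell" for x
        using integral_scaled_le[OF F, of "1 - t" x] False t that by (simp add: C_def add.commute)
      hence "integral cell (\<lambda>x. integral cell (\<lambda>y. F (t *\<^sub>R x + (1 - t) *\<^sub>R y))) \<le> integral cell (\<lambda>y::vec2. 4 * C)"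
        by (intro integral_le integrable_continuous c3 continuous_intros) auto
      thus ?thesis unfolding e1 by simp
    qed
  qed
  have D: "continuous_on UNIV (\<lambda>z. (\<psi> (fst z) - \<psi> (snd z))\<^sup>2)"
    by (intro continuous_intros continuous_on_compose2[OF ct]) auto
  have Gi: "continuous_on ?Z (\<lambda>z. integral (cbox 0 1) (G z))"
    by (rule integral_continuous_on_param) (rule continuous_on_subset[OF Gc], simp)
  have "integral ?Z (\<lambda>z. (\<psi> (fst z) - \<psi> (snd z))\<^sup>2) \<le> integral ?Z (\<lambda>z. 2 * integral (cbox 0 1) (G z))"
  proof (rule integral_le)
    show "(\<lambda>z. (\<psi> (fst z) - \<psi> (snd z))\<^sup>2) integrable_on ?Z"
      by (intro integrable_continuous continuous_on_subset[OF D]) auto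
    show "(\<lambda>z. 2 * integral (cbox 0 1) (G z)) integrable_on ?Z"
      by (intro integrable_continuous continuous_intros Gi)
    fix z assume "z \<in> ?Z"
    hence "fst z \<in> cell" "snd z \<in> cell" by (auto simp: cbox_Pair_eq)
    from pw[OF this] show "(\<psi> (fst z) - \<psi> (snd z))\<^sup>2 \<le> 2 * integral (cbox 0 1) (G z)"
      by (simp add: G_def[abs_def])
  qed
  also have "\<dots> = 2 * integral (cbox 0 1) (\<lambda>t. integral ?Z (\<lambda>z. G z t))"
    using integral_swap_continuous[OF continuous_on_subset[OF Gc], of "(0,0)" "0" "(1,1)" 1] by simp
  also have "integral (cbox 0 1) (\<lambda>t. integral ?Z (\<lambda>z. G z t)) \<le> integral (cbox 0 1) (\<lambda>t::real. 4 * C)"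
  proof (intro integral_le integrable_continuous)
    show "continuous_on (cbox 0 1) (\<lambda>t. integral ?Z (\<lambda>z. G z t))"
      by (rule integral_continuous_on_param)
         (simp add: G_def split_beta, rule continuous_on_subset[OF F'], auto intro!: continuous_intros)
  qed (use Gt in \<open>auto intro!: continuous_intros\<close>)
  also have "integral (cbox 0 1) (\<lambda>t::real. 4 * C) = 4 * C" by simp
  finally have upper: "integral ?Z (\<lambda>z. (\<psi> (fst z) - \<psi> (snd z))\<^sup>2) \<le> 8 * C" by simp
  \<comment> \<open>With mean zero the cross term drops out, so the double integral of the squared
    difference is \<open>2 * S\<close>. Against the upper bound \<open>8 * C\<close> this gives the
    constant 4.\<close>
  define S where "S = integral cell (\<lambda>x. (\<psi> x)\<^sup>2)"
  have m0: "integral cell \<psi> = 0" using mean integral_cm_continuous(1)[OF tD(4)] by simp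
  have ip: "\<psi> integrable_on cell" "(\<lambda>x. (\<psi> x)\<^sup>2) integrable_on cell"
    by (intro integrable_continuous continuous_intros ct)+
  have inner: "integral cell (\<lambda>y. (\<psi> x - \<psi> y)\<^sup>2) = (\<psi> x)\<^sup>2 + S" for x
  proof -
    have "(\<lambda>y. (\<psi> x - \<psi> y)\<^sup>2) = (\<lambda>y. ((\<psi> x)\<^sup>2 + (\<psi> y)\<^sup>2) - (2 * \<psi> x) * \<psi> y)"
      by (auto simp: power2_eq_square algebra_simps)
    hence "integral cell (\<lambda>y. (\<psi> x - \<psi> y)\<^sup>2) = integral cell (\<lambda>y. ((\<psi> x)\<^sup>2 + (\<psi> y)\<^sup>2) - (2 * \<psi> x) * \<psi> y)"
      by (rule arg_cong)
    also have "\<dots> = integral cell (\<lambda>y. (\<psi> x)\<^sup>2 + (\<psi> y)\<^sup>2) - integral cell (\<lambda>y. (2 * \<psi> x) * \<psi> y)"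
      by (intro integral_diff integrable_continuous continuous_intros ct)
    also have "integral cell (\<lambda>y. (\<psi> x)\<^sup>2 + (\<psi> y)\<^sup>2) = integral cell (\<lambda>y::vec2. (\<psi> x)\<^sup>2) + S"
      unfolding S_def by (intro integral_add integrable_continuous continuous_intros ct)
    finally show ?thesis using m0 by simp
  qed
  have "integral ?Z (\<lambda>z. (\<psi> (fst z) - \<psi> (snd z))\<^sup>2) = integral cell (\<lambda>x. integral cell (\<lambda>y. (\<psi> x - \<psi> y)\<^sup>2))"
    using integral_prod_continuous[OF continuous_on_subset[OF D], of 0 0 1 1] by simp
  also have "\<dots> = integral cell (\<lambda>x. (\<psi> x)\<^sup>2 + S)" unfolding inner ..
  also have "\<dots> = S + integral cell (\<lambda>x::vec2. S)"
    unfolding S_def by (rule integral_add) (auto intro!: ip integrable_continuous continuous_intros)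
  finally have "2 * S \<le> 8 * C" using upper by simp
  moreover have "l2sq \<psi> = S" unfolding l2sq_def S_def
    by (subst integral_cm_continuous(1)) (auto intro!: continuous_intros ct)
  moreover have "l2sq d\<psi> = C" unfolding l2sq_def C_def F_def
    by (subst integral_cm_continuous(1)) (auto intro!: continuous_intros tD)
  ultimately show ?thesis by simp
qed

section \<open>Periodic gradient fields\<close>

lemma inner_vec2: "(x::vec2) \<bullet> y = x $ 1 * y $ 1 + x $ 2 * y $ 2"
  by (simp add: inner_vec_def sum_2)

lemma Rperp_nth [simp]: "(Rperp *v v) $ 1 = - (v $ 2)" "(Rperp *v v) $ 2 = v $ 1"
  by (simp_all add: Rperp_def matrix_vector_mult_def sum_2)

lemma inner_Rperp: "(Rperp *v u) \<bullet> v = - (u \<bullet> (Rperp *v v))" "(Rperp *v u) \<bullet> (Rperp *v v) = u \<bullet> v"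
  "u \<bullet> (Rperp *v u) = 0" "Rperp *v (Rperp *v u) = - u"
  by (simp_all add: inner_vec2 vec_eq_iff forall_2)

lemma bounded_bilinear_matvec: "bounded_bilinear ((*v) :: mat2 \<Rightarrow> vec2 \<Rightarrow> vec2)"
  unfolding bilinear_conv_bounded_bilinear[symmetric] bilinear_def
  by (auto intro!: linearI simp: matrix_vector_right_distrib matrix_vector_mult_add_rdistrib
      scaleR_matrix_vector_assoc matrix_vector_mult_scaleR)

definition coef :: "(vec2 \<Rightarrow> 'a::euclidean_space) \<Rightarrow> bool"
  where "coef B \<longleftrightarrow> periodic B \<and> B \<in> borel_measurable lebesgue \<and> bounded (range B)"

lemma L2_per_bilinear:
  assumes p: "bounded_bilinear p" and B: "coef B" and u: "L2_per u"
  shows "L2_per (\<lambda>x. p (B x) (u x))"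
proof -
  interpret p: bounded_bilinear p by fact
  obtain C where C: "\<And>x. norm (B x) \<le> C" using B by (auto simp: coef_def bounded_iff)
  obtain K where K: "\<And>a b. norm (p a b) \<le> norm a * norm b * K" "K \<ge> 0" using p.nonneg_bounded by blast
  show ?thesis
  proof (rule L2_per_bound[OF u, where C="C * K"])
    show "periodic (\<lambda>x. p (B x) (u x))" using B L2_perD(1)[OF u] by (simp add: coef_def periodic_def)
    have "continuous_on UNIV (\<lambda>x. p (fst x) (snd x))" by (intro p.continuous_on continuous_intros)
    thus "(\<lambda>x. p (B x) (u x)) \<in> borel_measurable lebesgue"
      using B L2_perD(2)[OF u] by (intro borel_measurable_continuous_Pair[where H=p]) (auto simp: coef_def)
    fix x
    have "norm (p (B x) (u x)) \<le> norm (B x) * norm (u x) * K" by (rule K)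
    also have "\<dots> \<le> C * norm (u x) * K" using C K(2) by (intro mult_right_mono) auto
    finally show "norm (p (B x) (u x)) \<le> C * K * norm (u x)" by (simp add: mult_ac)
  qed
qed

lemmas L2_per_matvec = L2_per_bilinear[OF bounded_bilinear_matvec]

lemma L2_per_Rperp: "L2_per u \<Longrightarrow> L2_per (\<lambda>x. Rperp *v u x)"
  by (rule L2_per_linear[OF matrix_vector_mul_bounded_linear])

lemma integral_cm_inner:
  assumes "integrable cm f" shows "(\<integral>x. f x \<bullet> c \<partial>cm) = (\<integral>x. f x \<partial>cm) \<bullet> c" "(\<integral>x. c \<bullet> f x \<partial>cm) = c \<bullet> (\<integral>x. f x \<partial>cm)"
  using assms by (auto simp: inner_commute)

lemma L2_scaleR_integrable:
  assumes "L2_per f" "L2_per v" shows "integrable cm (\<lambda>x. f x *\<^sub>R v x)"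
proof (rule Bochner_Integration.integrable_bound[of cm "\<lambda>x. (norm (f x))\<^sup>2 + (norm (v x))\<^sup>2"])
  note [measurable] = L2_perD(3)[OF assms(1)] L2_perD(3)[OF assms(2)]
  show "integrable cm (\<lambda>x. (norm (f x))\<^sup>2 + (norm (v x))\<^sup>2)"
    using L2_perD(4)[OF assms(1)] L2_perD(4)[OF assms(2)] by simp
  show "(\<lambda>x. f x *\<^sub>R v x) \<in> borel_measurable cm" by measurable
  have "\<bar>f x\<bar> * norm (v x) \<le> (norm (f x))\<^sup>2 + (norm (v x))\<^sup>2" for x
  proof -
    have "2 * (\<bar>f x\<bar> * norm (v x)) \<le> (norm (f x))\<^sup>2 + (norm (v x))\<^sup>2"
      using sum_squares_bound[of "norm (f x)" "norm (v x)"] by (simp add: mult.assoc)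
    moreover have "0 \<le> \<bar>f x\<bar> * norm (v x)" by simp
    ultimately show ?thesis by linarith
  qed
  thus "AE x in cm. norm (f x *\<^sub>R v x) \<le> norm ((norm (f x))\<^sup>2 + (norm (v x))\<^sup>2)"
    by (auto intro!: AE_I2)
qed

text \<open>A lemma below (\<open>l2_grad_iff\<close>) identifies these with the weak gradients of \<open>H1_per_grad\<close>.\<close>

definition l2_grad :: "(vec2 \<Rightarrow> vec2) \<Rightarrow> bool"
  where "l2_grad u \<longleftrightarrow> L2_per u \<and> (\<exists>\<psi> d. (\<forall>n. trig_poly (\<psi> n) (d n)) \<and> (\<lambda>n. l2sq (\<lambda>x. d n x - u x)) \<longlonglongrightarrow> 0)"

lemma trig_poly_L2: "trig_poly \<psi> d \<Longrightarrow> L2_per \<psi>" "trig_poly \<psi> d \<Longrightarrow> L2_per d"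
  using trig_poly_test_fun test_fun_L2 by blast+

lemma l2_gradE:
  assumes "l2_grad u"
  obtains \<psi> d where "\<And>n. trig_poly (\<psi> n) (d n)" "(\<lambda>n. l2sq (\<lambda>x. d n x - u x)) \<longlonglongrightarrow> 0"
    "L2_per u" "\<And>n. L2_per (d n)"
    "\<And>g. L2_per g \<Longrightarrow> (\<lambda>n. \<integral>x. d n x \<bullet> g x \<partial>cm) \<longlonglongrightarrow> (\<integral>x. u x \<bullet> g x \<partial>cm)"
proof -
  from assms obtain \<psi> d where *: "\<And>n. trig_poly (\<psi> n) (d n)" "(\<lambda>n. l2sq (\<lambda>x. d n x - u x)) \<longlonglongrightarrow> 0" "L2_per u"
    by (auto simp: l2_grad_def)
  have "L2_per (d n)" for n using trig_poly_L2 * by blast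
  with * that l2_tendsto_inner[OF this *(3) _ *(2)] show ?thesis by blast
qed

lemma l2_gradD: "l2_grad u \<Longrightarrow> L2_per u"
  by (simp add: l2_grad_def)

lemma l2_grad_orth:
  assumes "l2_grad u" "L2_per g" "\<And>\<psi> d. trig_poly \<psi> d \<Longrightarrow> (\<integral>x. d x \<bullet> g x \<partial>cm) = 0"
  shows "(\<integral>x. u x \<bullet> g x \<partial>cm) = 0"
proof -
  from assms(1) obtain \<psi> d where d: "\<And>n. trig_poly (\<psi> n) (d n)"
    "\<And>g. L2_per g \<Longrightarrow> (\<lambda>n. \<integral>x. d n x \<bullet> g x \<partial>cm) \<longlonglongrightarrow> (\<integral>x. u x \<bullet> g x \<partial>cm)"
    by (rule l2_gradE) blast
  from d(2)[OF assms(2)] show ?thesis using assms(3)[OF d(1)] by (simp add: LIMSEQ_const_iff)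
qed

lemma l2_grad_mean:
  assumes "l2_grad u" shows "(\<integral>x. u x \<partial>cm) = 0"
proof -
  have "(\<integral>x. u x \<bullet> c \<partial>cm) = 0" for c
  proof (rule l2_grad_orth[OF assms L2_per_const])
    fix \<psi> d assume "trig_poly \<psi> d"
    thus "(\<integral>x. d x \<bullet> c \<partial>cm) = 0"
      using test_fun_integral_grad[OF trig_poly_test_fun] by (simp add: integral_cm_inner trig_poly_L2 L2_integrable)
  qed
  hence "(\<integral>x. u x \<partial>cm) \<bullet> c = 0" for c by (simp add: integral_cm_inner L2_integrable l2_gradD[OF assms])
  thus ?thesis using inner_eq_zero_iff by blast
qed

lemma H1_per_grad_iff: "H1_per_grad \<phi> g \<longleftrightarrow> L2_per \<phi> \<and> L2_per g
    \<and> (\<forall>\<psi> d. test_fun \<psi> d \<longrightarrow> (\<integral>x. \<phi> x *\<^sub>R d x \<partial>cm) = - (\<integral>x. \<psi> x *\<^sub>R g x \<partial>cm))"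
  by (simp add: H1_per_grad_def set_integral_cm)

lemma div_free_iff: "div_free J \<longleftrightarrow> (\<forall>\<psi> d. test_fun \<psi> d \<longrightarrow> (\<integral>x. J x \<bullet> d x \<partial>cm) = 0)"
  by (simp add: div_free_def set_integral_cm)

lemma test_fun_H1: "test_fun \<psi> d \<Longrightarrow> H1_per_grad \<psi> d"
  by (auto simp: H1_per_grad_iff intro: test_fun_L2 test_fun_by_parts)

lemma l2sq_triangle:
  assumes "L2_per f" "L2_per g" "L2_per u"
  shows "l2sq (\<lambda>x. f x - g x) \<le> 2 * l2sq (\<lambda>x. f x - u x) + 2 * l2sq (\<lambda>x. g x - u x)"
proof -
  have p: "(norm (f x - g x))\<^sup>2 \<le> 2 * (norm (f x - u x))\<^sup>2 + 2 * (norm (g x - u x))\<^sup>2" for x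
  proof -
    have "(norm (f x - g x))\<^sup>2 \<le> (norm (f x - u x) + norm (g x - u x))\<^sup>2"
      using norm_triangle_ineq4[of "f x - u x" "g x - u x"] by (intro power_mono) auto
    also have "\<dots> \<le> 2 * (norm (f x - u x))\<^sup>2 + 2 * (norm (g x - u x))\<^sup>2"
      using sum_squares_bound[of "norm (f x - u x)" "norm (g x - u x)"] by (simp add: power2_sum)
    finally show ?thesis .
  qed
  have "l2sq (\<lambda>x. f x - g x) \<le> (\<integral>x. 2 * (norm (f x - u x))\<^sup>2 + 2 * (norm (g x - u x))\<^sup>2 \<partial>cm)"
    unfolding l2sq_def
    by (rule integral_mono) (use p in \<open>auto intro!: L2_perD(4) L2_per_diff assms integrable_mult_right\<close>)
  also have "\<dots> = 2 * l2sq (\<lambda>x. f x - u x) + 2 * l2sq (\<lambda>x. g x - u x)"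
    unfolding l2sq_def by (simp add: L2_perD(4) L2_per_diff assms)
  finally show ?thesis .
qed

lemma l2sq_cauchy:
  assumes "\<And>n. L2_per (f n)" "L2_per u" "(\<lambda>n. l2sq (\<lambda>x. f n x - u x)) \<longlonglongrightarrow> 0" "e > 0"
  shows "\<exists>N. \<forall>m\<ge>N. \<forall>n\<ge>N. l2sq (\<lambda>x. f m x - f n x) < e"
proof -
  from LIMSEQ_D[OF assms(3), of "e/4"] assms(4) obtain N where
    N: "\<And>n. n \<ge> N \<Longrightarrow> l2sq (\<lambda>x. f n x - u x) < e/4" by (auto simp: abs_of_nonneg l2sq_nonneg)
  have "l2sq (\<lambda>x. f m x - f n x) < e" if "m \<ge> N" "n \<ge> N" for m n
    using l2sq_triangle[OF assms(1)[of m] assms(1)[of n] assms(2)] N[OF that(1)] N[OF that(2)] by linarith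
  thus ?thesis by blast
qed

text \<open>The potentials of the approximants need not converge, but after subtraction of their
  means the Poincare inequality bounds their differences by those of the gradients. They become a
  Cauchy sequence, and integration by parts passes to the limit.\<close>

lemma l2_grad_potential:
  assumes "l2_grad u" obtains \<phi> where "H1_per_grad \<phi> u"
proof -
  from assms obtain \<psi> d where d: "\<And>n. trig_poly (\<psi> n) (d n)" "(\<lambda>n. l2sq (\<lambda>x. d n x - u x)) \<longlonglongrightarrow> 0"
    "L2_per u" "\<And>n. L2_per (d n)"
    "\<And>g. L2_per g \<Longrightarrow> (\<lambda>n. \<integral>x. d n x \<bullet> g x \<partial>cm) \<longlonglongrightarrow> (\<integral>x. u x \<bullet> g x \<partial>cm)"
    by (rule l2_gradE) blast
  define \<xi> where "\<xi> n x = \<psi> n x + - (\<integral>x. \<psi> n x \<partial>cm)" for n x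
  have t: "test_fun (\<xi> n) (d n)" for n
    unfolding \<xi>_def using test_fun_add[OF trig_poly_test_fun[OF d(1)[of n]] test_fun_const[of "- (\<integral>x. \<psi> n x \<partial>cm)"]] by simp
  have L\<xi>: "L2_per (\<xi> n)" for n using test_fun_L2(1)[OF t] .
  have m0: "(\<integral>x. \<xi> n x \<partial>cm) = 0" for n
    unfolding \<xi>_def using L2_integrable[OF trig_poly_L2(1)[OF d(1)[of n]]] by (simp add: prob_cm)
  have P: "l2sq (\<lambda>x. \<xi> m x - \<xi> n x) \<le> 4 * l2sq (\<lambda>x. d m x - d n x)" for m n
  proof (rule poincare)
    show "test_fun (\<lambda>x. \<xi> m x - \<xi> n x) (\<lambda>x. d m x - d n x)"
      using test_fun_add[OF t[of m] test_fun_cmult[OF t[of n], of "-1"]] by simp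
    show "(\<integral>x. \<xi> m x - \<xi> n x \<partial>cm) = 0" using m0 L2_integrable[OF L\<xi>] by simp
  qed
  have "\<exists>N. \<forall>m\<ge>N. \<forall>n\<ge>N. l2sq (\<lambda>x. \<xi> m x - \<xi> n x) < e" if "e > 0" for e
  proof -
    from l2sq_cauchy[OF d(4) d(3) d(2), of "e/4"] that obtain N where
      N: "\<And>m n. m \<ge> N \<Longrightarrow> n \<ge> N \<Longrightarrow> l2sq (\<lambda>x. d m x - d n x) < e/4" by auto
    have "l2sq (\<lambda>x. \<xi> m x - \<xi> n x) < e" if "m \<ge> N" "n \<ge> N" for m n
      using P[of m n] N[OF that] by linarith
    thus ?thesis by blast
  qed
  from l2_complete[OF L\<xi> this] obtain \<phi> where \<phi>: "L2_per \<phi>" "(\<lambda>n. l2sq (\<lambda>x. \<xi> n x - \<phi> x)) \<longlonglongrightarrow> 0" by blast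
  have "(\<integral>x. \<phi> x *\<^sub>R d\<eta> x \<partial>cm) = - (\<integral>x. \<eta> x *\<^sub>R u x \<partial>cm)" if te: "test_fun \<eta> d\<eta>" for \<eta> d\<eta>
  proof -
    note c = test_funD[OF te] test_fun_L2[OF te]
    have i1: "integrable cm (\<lambda>x. \<phi> x *\<^sub>R d\<eta> x)" and i1': "integrable cm (\<lambda>x. \<xi> n x *\<^sub>R d\<eta> x)"
      and i2: "integrable cm (\<lambda>x. \<eta> x *\<^sub>R u x)" and i2': "integrable cm (\<lambda>x. \<eta> x *\<^sub>R d n x)" for n
      by (intro L2_scaleR_integrable c \<phi> L\<xi> d)+
    have "(\<integral>x. \<phi> x *\<^sub>R d\<eta> x \<partial>cm) \<bullet> y = - (\<integral>x. \<eta> x *\<^sub>R u x \<partial>cm) \<bullet> y" for y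
    proof -
      have lim1: "(\<lambda>n. \<integral>x. \<xi> n x \<bullet> (d\<eta> x \<bullet> y) \<partial>cm) \<longlonglongrightarrow> (\<integral>x. \<phi> x \<bullet> (d\<eta> x \<bullet> y) \<partial>cm)"
        by (rule l2_tendsto_inner[OF L\<xi> \<phi>(1) _ \<phi>(2)]) (rule L2_per_linear[OF bounded_linear_inner_left c(7)])
      have lim2: "(\<lambda>n. \<integral>x. d n x \<bullet> (\<eta> x *\<^sub>R y) \<partial>cm) \<longlonglongrightarrow> (\<integral>x. u x \<bullet> (\<eta> x *\<^sub>R y) \<partial>cm)"
        by (rule d(5)) (rule L2_per_linear[OF bounded_linear_scaleR_left c(6)])
      have eq: "(\<integral>x. \<xi> n x \<bullet> (d\<eta> x \<bullet> y) \<partial>cm) = - (\<integral>x. d n x \<bullet> (\<eta> x *\<^sub>R y) \<partial>cm)" for n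
      proof -
        have "(\<integral>x. \<xi> n x \<bullet> (d\<eta> x \<bullet> y) \<partial>cm) = (\<integral>x. \<xi> n x *\<^sub>R d\<eta> x \<partial>cm) \<bullet> y"
          using integral_cm_inner(1)[OF i1', where c=y] by simp
        also have "\<dots> = - ((\<integral>x. \<eta> x *\<^sub>R d n x \<partial>cm) \<bullet> y)" using test_fun_by_parts[OF t te] by simp
        also have "\<dots> = - (\<integral>x. d n x \<bullet> (\<eta> x *\<^sub>R y) \<partial>cm)"
          using integral_cm_inner(1)[OF i2', where c=y] by simp
        finally show ?thesis .
      qed
      have "(\<integral>x. \<phi> x \<bullet> (d\<eta> x \<bullet> y) \<partial>cm) = - (\<integral>x. u x \<bullet> (\<eta> x *\<^sub>R y) \<partial>cm)"
        using LIMSEQ_unique[OF lim1[unfolded eq] tendsto_minus[OF lim2]] .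
      thus ?thesis using integral_cm_inner(1)[OF i1, where c=y] integral_cm_inner(1)[OF i2, where c=y] by simp
    qed
    thus ?thesis using vector_eq_rdot by blast
  qed
  hence "H1_per_grad \<phi> u" using \<phi>(1) d(3) by (simp add: H1_per_grad_iff)
  with that show ?thesis by blast
qed

text \<open>Tested at frequency \<open>n\<close>, a weak gradient has a coefficient parallel to
  \<open>n\<close>, whereas the rotated gradient of a cosine of that frequency points along
  \<open>Rperp *v n\<close>.\<close>

lemma H1_per_grad_curl_free:
  assumes H: "H1_per_grad \<phi> g" and t: "trig_poly \<eta> d"
  shows "(\<integral>x. g x \<bullet> (Rperp *v d x) \<partial>cm) = 0"
  using t
proof (induction rule: trig_poly.induct)
  case (base n \<theta>)
  have L: "L2_per g" "L2_per \<phi>" using H by (auto simp: H1_per_grad_iff)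
  \<comment> \<open>The sine factor in the gradient of the given cosine, rewritten as a cosine so
    that it is an admissible test function.\<close>
  define z where "z x = cos (2 * pi * (n \<bullet> x) + (\<theta> - pi/2))" for x
  define w where "w x = 2 * pi * cos (2 * pi * (n \<bullet> x) + \<theta>)" for x
  have "w x = - (2 * pi * sin (2 * pi * (n \<bullet> x) + (\<theta> - pi/2)))" for x
    by (simp add: w_def add_diff_eq sin_diff)
  hence z: "test_fun z (\<lambda>x. w x *\<^sub>R n)" unfolding z_def using test_fun_cos[OF base] by simp
  have Lw: "L2_per w" unfolding w_def using L2_per_scaleR[OF test_fun_L2(1)[OF test_fun_cos[OF base]]] by simp
  have zs: "sin (2 * pi * (n \<bullet> x) + \<theta>) = z x" for x
    by (simp add: z_def add_diff_eq cos_diff)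
  have "(\<integral>x. \<phi> x *\<^sub>R (w x *\<^sub>R n) \<partial>cm) = - (\<integral>x. z x *\<^sub>R g x \<partial>cm)"
    using H z unfolding H1_per_grad_iff by blast
  moreover have "(\<integral>x. \<phi> x *\<^sub>R (w x *\<^sub>R n) \<partial>cm) = (\<integral>x. \<phi> x * w x \<partial>cm) *\<^sub>R n"
    using L2_scaleR_integrable[OF L(2) Lw] by (simp add: integral_scaleR_left)
  ultimately have "- (\<integral>x. z x *\<^sub>R g x \<partial>cm) = (\<integral>x. \<phi> x * w x \<partial>cm) *\<^sub>R n"
    by simp
  hence "(- (\<integral>x. z x *\<^sub>R g x \<partial>cm)) \<bullet> (Rperp *v n) = 0"
    by (simp add: inner_Rperp(3))
  hence "(\<integral>x. z x *\<^sub>R g x \<partial>cm) \<bullet> (Rperp *v n) = 0"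
    by simp
  hence "(\<integral>x. (z x *\<^sub>R g x) \<bullet> (Rperp *v n) \<partial>cm) = 0"
    by (subst integral_cm_inner) (auto intro: L2_scaleR_integrable L test_fun_L2[OF z])
  hence "(\<integral>x. (- (2 * pi)) * ((z x *\<^sub>R g x) \<bullet> (Rperp *v n)) \<partial>cm) = 0" by simp
  also have "(\<lambda>x. (- (2 * pi)) * ((z x *\<^sub>R g x) \<bullet> (Rperp *v n)))
      = (\<lambda>x. g x \<bullet> (Rperp *v ((- (2 * pi * sin (2 * pi * (n \<bullet> x) + \<theta>))) *\<^sub>R n)))"
    unfolding zs matrix_vector_mult_scaleR by auto
  finally show ?case .
next
  case (add \<psi> d \<eta> d')
  have L: "L2_per g" using H by (auto simp: H1_per_grad_iff)
  show ?case using add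
    by (simp add: matrix_vector_right_distrib inner_add_right L2_inner_integrable L L2_per_Rperp trig_poly_L2)
next
  case (scale \<psi> d c)
  then show ?case by (simp add: matrix_vector_mult_scaleR)
qed

section \<open>Existence of solutions and the Hodge decomposition\<close>

lemma sym_inner: "transpose A = A \<Longrightarrow> ((A::mat2) *v x) \<bullet> y = x \<bullet> (A *v y)"
  by (metis dot_lmul_matrix transpose_matrix_vector)

lemma conducting_compositeD:
  assumes "conducting_composite \<sigma>"
  shows "coef \<sigma>" "(\<sigma> x *v v) \<bullet> w = v \<bullet> (\<sigma> x *v w)"
  using assms by (auto simp: conducting_composite_def coef_def intro: sym_inner)

lemma quadratic_nonneg_imp_zero:
  fixes b c :: real
  assumes "\<And>t. 0 \<le> 2 * t * b + t\<^sup>2 * c" "c \<ge> 0" shows "b = 0"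
proof (rule ccontr)
  assume b: "b \<noteq> 0"
  \<comment> \<open>The denominator \<open>c + 1\<close> avoids a separate case
    \<open>c = 0\<close>.\<close>
  have "0 \<le> 2 * (- b / (c + 1)) * b + (- b / (c + 1))\<^sup>2 * c" by (rule assms(1))
  also have "\<dots> = - (b\<^sup>2 * (c + 2)) / (c + 1)\<^sup>2"
    using assms(2) by (simp add: power2_eq_square divide_simps) (simp add: algebra_simps)
  also have "\<dots> < 0" using b assms(2) by (intro divide_neg_pos) auto
  finally show False by simp
qed

text \<open>Ritz method: coercivity forces near-minimizers of the energy \<open>E\<close> to be
  close to each other. Their limit need not be the gradient of a trigonometric polynomial, so the
  Euler equation is obtained from almost-minimality along the sequence.\<close>

theorem lax_milgram:
  assumes \<sigma>: "conducting_composite \<sigma>" and F: "L2_per F"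
  obtains u where "l2_grad u" "\<And>\<psi> d. trig_poly \<psi> d \<Longrightarrow> (\<integral>x. (\<sigma> x *v u x - F x) \<bullet> d x \<partial>cm) = 0"
proof -
  note \<sigma>D = conducting_compositeD[OF \<sigma>]
  obtain \<alpha> where \<alpha>: "\<alpha> > 0" "\<And>x v. v \<bullet> (\<sigma> x *v v) \<ge> \<alpha> * (norm v)\<^sup>2"
    using \<sigma> by (auto simp: conducting_composite_def)
  define a where "a f g = (\<integral>x. f x \<bullet> (\<sigma> x *v g x) \<partial>cm)" for f g :: "vec2 \<Rightarrow> vec2"
  have Ls: "L2_per (\<lambda>x. \<sigma> x *v f x)" if "L2_per f" for f using L2_per_matvec[OF \<sigma>D(1) that] .
  have ia: "integrable cm (\<lambda>x. f x \<bullet> (\<sigma> x *v g x))" if "L2_per f" "L2_per g" for f g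
    by (intro L2_inner_integrable that Ls)
  have coer: "\<alpha> * l2sq f \<le> a f f" if f: "L2_per f" for f
  proof -
    have "\<alpha> * l2sq f = (\<integral>x. \<alpha> * (norm (f x))\<^sup>2 \<partial>cm)" by (simp add: l2sq_def)
    also have "\<dots> \<le> a f f" unfolding a_def
      by (rule integral_mono) (use \<alpha>(2) ia[OF f f] L2_perD(4)[OF f] in auto)
    finally show ?thesis .
  qed
  have asym: "a f g = a g f" for f g
  proof -
    have "f x \<bullet> (\<sigma> x *v g x) = g x \<bullet> (\<sigma> x *v f x)" for x
      using \<sigma>D(2)[of x "f x" "g x"] by (simp add: inner_commute)
    thus ?thesis unfolding a_def by simp
  qed
  have aadd: "a (\<lambda>x. f x + g x) h = a f h + a g h" if "L2_per f" "L2_per g" "L2_per h" for f g h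
    unfolding a_def by (simp add: inner_add_left ia that)
  have ascale: "a (\<lambda>x. c *\<^sub>R f x) h = c * a f h" for c f h
    unfolding a_def by simp
  define l where "l f = (\<integral>x. f x \<bullet> F x \<partial>cm)" for f
  have ladd: "l (\<lambda>x. f x + g x) = l f + l g" if "L2_per f" "L2_per g" for f g
    unfolding l_def by (simp add: inner_add_left L2_inner_integrable that F)
  have lscale: "l (\<lambda>x. c *\<^sub>R f x) = c * l f" for c f
    unfolding l_def by simp
  define E where "E f = a f f - 2 * l f" for f
  have Eexp: "E (\<lambda>x. f x + t *\<^sub>R g x) = E f + 2 * t * (a f g - l g) + t\<^sup>2 * a g g" if f: "L2_per f" and g: "L2_per g" for f g t
  proof -
    note tg = L2_per_scaleR[OF g, of t]
    note fg = L2_per_add[OF f tg]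
    let ?X = "\<lambda>x. f x + t *\<^sub>R g x" and ?T = "\<lambda>x. t *\<^sub>R g x"
    have "a ?X ?X = a f ?X + a ?T ?X" by (rule aadd[OF f tg fg])
    moreover have "a f ?X = a ?X f" "a ?T ?X = a ?X ?T" by (rule asym)+
    moreover have "a ?X f = a f f + a ?T f" "a ?X ?T = a f ?T + a ?T ?T" by (rule aadd[OF f tg f], rule aadd[OF f tg tg])
    moreover have "a ?T f = t * a g f" "a f ?T = a ?T f" "a ?T ?T = t * a g ?T" "a g ?T = a ?T g" "a ?T g = t * a g g"
      by (rule ascale, rule asym, rule ascale, rule asym, rule ascale)
    moreover have "a g f = a f g" by (rule asym)
    ultimately have "a ?X ?X = a f f + 2 * t * a f g + t\<^sup>2 * a g g"
      by (simp add: power2_eq_square)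
    thus ?thesis unfolding E_def ladd[OF f tg] lscale by (simp add: algebra_simps)
  qed
  define S where "S = {E d | \<psi> d. trig_poly \<psi> d}"
  \<comment> \<open>Young's inequality with weight \<alpha> lets coercivity absorb the part of the
    load term that is quadratic in \<open>d\<close>.\<close>
  have lower: "- (l2sq F / \<alpha>) \<le> E d" if "L2_per d" for d
    using l2_young[OF that F \<alpha>(1)] coer[OF that] unfolding E_def l_def by linarith
  have Sne: "S \<noteq> {}" using trig_poly_zero by (auto simp: S_def)
  have Sbd: "bdd_below S"
    unfolding S_def by (rule bdd_belowI[of _ "- (l2sq F / \<alpha>)"]) (use lower trig_poly_L2 in blast)
  define m where "m = Inf S"
  have mle: "m \<le> E d" if "trig_poly \<psi> d" for \<psi> d
    unfolding m_def using Sbd that by (intro cInf_lower) (auto simp: S_def)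
  have "\<exists>\<psi> d. trig_poly \<psi> d \<and> E d < m + inverse (real (Suc n))" for n
    using cInf_lessD[OF Sne, of "m + inverse (real (Suc n))"] by (auto simp: m_def S_def)
  then obtain \<psi> d where d: "\<And>n. trig_poly (\<psi> n) (d n)" "\<And>n. E (d n) < m + inverse (real (Suc n))"
    by metis
  have Ld: "L2_per (d n)" for n using trig_poly_L2(2)[OF d(1)] .
  \<comment> \<open>The midpoint of two near-minimizers is again a competitor, so its energy is at
    least \<open>m\<close>; the parallelogram identity then bounds their distance.\<close>
  have par: "\<alpha> * l2sq (\<lambda>x. d n x - d k x) \<le> 2 * inverse (real (Suc n)) + 2 * inverse (real (Suc k))" for n k
  proof -
    define g where "g = (\<lambda>x. d k x - d n x)"
    have g: "L2_per g" unfolding g_def by (intro L2_per_diff Ld)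
    have e1: "E (d k) = E (d n) + 2 * (a (d n) g - l g) + a g g"
      using Eexp[OF Ld g, of n 1] by (simp add: g_def)
    have e2: "E (\<lambda>x. d n x + (1/2) *\<^sub>R g x) = E (d n) + (a (d n) g - l g) + a g g / 4"
      using Eexp[OF Ld g, of n "1/2"] by (simp add: power2_eq_square)
    have eq: "(\<lambda>x. d n x + (1/2) *\<^sub>R g x) = (\<lambda>x. (1/2) *\<^sub>R d n x + (1/2) *\<^sub>R d k x)"
      by (simp add: g_def vec_eq_iff field_simps fun_eq_iff)
    have "m \<le> E (\<lambda>x. d n x + (1/2) *\<^sub>R g x)"
      unfolding eq by (rule mle[OF trig_poly.add[OF trig_poly.scale[OF d(1)] trig_poly.scale[OF d(1)]]])
    hence "m \<le> E (d n) + (a (d n) g - l g) + a g g / 4" unfolding e2 .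
    hence "a g g \<le> 2 * (E (d n) - m) + 2 * (E (d k) - m)" unfolding e1 by argo
    moreover have "\<alpha> * l2sq g \<le> a g g" by (rule coer[OF g])
    ultimately have "\<alpha> * l2sq g \<le> 2 * inverse (real (Suc n)) + 2 * inverse (real (Suc k))"
      using d(2)[of n] d(2)[of k] by argo
    thus ?thesis unfolding l2sq_diff_commute[of "d n" "d k"] g_def .
  qed
  have "\<exists>N. \<forall>i\<ge>N. \<forall>j\<ge>N. l2sq (\<lambda>x. d i x - d j x) < e" if e: "e > 0" for e
  proof -
    obtain N where N: "inverse (real (Suc N)) < \<alpha> * e / 4" using reals_Archimedean[of "\<alpha> * e / 4"] \<alpha> e by auto
    have "l2sq (\<lambda>x. d i x - d j x) < e" if "i \<ge> N" "j \<ge> N" for i j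
    proof -
      have "inverse (real (Suc i)) \<le> inverse (real (Suc N))" "inverse (real (Suc j)) \<le> inverse (real (Suc N))"
        using that by (auto intro: le_imp_inverse_le)
      with par[of i j] N have "\<alpha> * l2sq (\<lambda>x. d i x - d j x) < \<alpha> * e" by linarith
      thus ?thesis using \<alpha> by simp
    qed
    thus ?thesis by blast
  qed
  from l2_complete[OF Ld this] obtain u where u: "L2_per u" "(\<lambda>n. l2sq (\<lambda>x. d n x - u x)) \<longlonglongrightarrow> 0" by blast
  have gu: "l2_grad u" unfolding l2_grad_def using u d(1) by blast
  have "(\<integral>x. (\<sigma> x *v u x - F x) \<bullet> e x \<partial>cm) = 0" if te: "trig_poly \<eta> e" for \<eta> e
  proof -
    note Le = trig_poly_L2(2)[OF te]
    have la: "(\<lambda>n. a (d n) e) \<longlonglongrightarrow> a u e"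
      unfolding a_def by (rule l2_tendsto_inner[OF Ld u(1) Ls[OF Le] u(2)])
    have "a u e - l e = 0"
    proof (rule quadratic_nonneg_imp_zero)
      show "a e e \<ge> 0" using coer[OF Le] \<alpha>(1) l2sq_nonneg[of e] by (meson mult_nonneg_nonneg less_imp_le order_trans)
      fix t
      \<comment> \<open>Perturbing a near-minimizer cannot lower the energy below \<open>m\<close>.
        In the limit the slack disappears and leaves a nonnegative quadratic in \<open>t\<close>
        without constant term.\<close>
      have "(\<lambda>n. inverse (real (Suc n)) + 2 * t * (a (d n) e - l e) + t\<^sup>2 * a e e) \<longlonglongrightarrow> 0 + 2 * t * (a u e - l e) + t\<^sup>2 * a e e"
        by (intro tendsto_intros la LIMSEQ_inverse_real_of_nat)
      from LIMSEQ_le_const[OF this] have "0 \<le> 0 + 2 * t * (a u e - l e) + t\<^sup>2 * a e e" if "\<And>n. 0 \<le> inverse (real (Suc n)) + 2 * t * (a (d n) e - l e) + t\<^sup>2 * a e e"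
        using that by blast
      moreover have "0 \<le> inverse (real (Suc n)) + 2 * t * (a (d n) e - l e) + t\<^sup>2 * a e e" for n
        using mle[OF trig_poly.add[OF d(1)[of n] trig_poly.scale[OF te, of t]]] Eexp[OF Ld Le, of n t] d(2)[of n] by linarith
      ultimately show "0 \<le> 2 * t * (a u e - l e) + t\<^sup>2 * a e e"
        by simp
    qed
    moreover have "(\<integral>x. (\<sigma> x *v u x - F x) \<bullet> e x \<partial>cm) = a u e - l e"
      unfolding a_def l_def
      by (simp add: inner_diff_left L2_inner_integrable Ls u Le F \<sigma>D(2)) (simp add: inner_commute)
    ultimately show ?thesis by simp
  qed
  with gu that show ?thesis by blast
qed

lemma conducting_composite_id: "conducting_composite (\<lambda>x. mat 1)"
  unfolding conducting_composite_def
  by (auto simp: periodic_def transpose_mat power2_norm_eq_inner intro!: exI[of _ 1])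

lemma Rperp_decomp:
  fixes y n :: vec2
  assumes "n \<noteq> 0" shows "y = ((y \<bullet> n) / (n \<bullet> n)) *\<^sub>R n + ((y \<bullet> (Rperp *v n)) / (n \<bullet> n)) *\<^sub>R (Rperp *v n)"
proof -
  have "(n \<bullet> n) *\<^sub>R y = (y \<bullet> n) *\<^sub>R n + (y \<bullet> (Rperp *v n)) *\<^sub>R (Rperp *v n)"
    by (simp add: vec_eq_iff forall_2 inner_vec2 algebra_simps)
  hence "(1 / (n \<bullet> n)) *\<^sub>R ((n \<bullet> n) *\<^sub>R y) = (1 / (n \<bullet> n)) *\<^sub>R ((y \<bullet> n) *\<^sub>R n + (y \<bullet> (Rperp *v n)) *\<^sub>R (Rperp *v n))"
    by simp
  thus ?thesis using assms by (simp add: scaleR_add_right)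
qed

text \<open>The projection \<open>v\<close> of \<open>u\<close> on gradients comes from the identity
  conductivity. The remainder \<open>r\<close> is divergence-free and curl-free, so its Fourier
  coefficient at \<open>n\<close> is orthogonal to both \<open>n\<close> and
  \<open>Rperp *v n\<close>; at \<open>n = 0\<close> it vanishes because of the means.\<close>

theorem hodge:
  assumes u: "L2_per u" and mean: "(\<integral>x. u x \<partial>cm) = 0"
    and curl: "\<And>\<psi> d. trig_poly \<psi> d \<Longrightarrow> (\<integral>x. u x \<bullet> (Rperp *v d x) \<partial>cm) = 0"
  shows "l2_grad u"
proof -
  obtain v where v: "l2_grad v" "\<And>\<psi> d. trig_poly \<psi> d \<Longrightarrow> (\<integral>x. (mat 1 *v v x - u x) \<bullet> d x \<partial>cm) = 0"
    by (rule lax_milgram[OF conducting_composite_id u]) blast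
  define r where "r x = v x - u x" for x
  note Lv = l2_gradD[OF v(1)]
  have r: "L2_per r" unfolding r_def by (intro L2_per_diff Lv u)
  have rmean: "(\<integral>x. r x \<partial>cm) = 0"
    unfolding r_def using l2_grad_mean[OF v(1)] mean L2_integrable[OF Lv] L2_integrable[OF u] by simp
  have rdiv: "(\<integral>x. r x \<bullet> d x \<partial>cm) = 0" if "trig_poly \<psi> d" for \<psi> d
    using v(2)[OF that] by (simp add: r_def)
  have rcurl: "(\<integral>x. r x \<bullet> (Rperp *v d x) \<partial>cm) = 0" if t: "trig_poly \<psi> d" for \<psi> d
  proof -
    note LR = L2_per_Rperp[OF trig_poly_L2(2)[OF t]]
    have "(\<integral>x. v x \<bullet> (Rperp *v d x) \<partial>cm) = 0"
      by (rule l2_grad_orth[OF v(1) LR])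
         (use H1_per_grad_curl_free[OF test_fun_H1[OF trig_poly_test_fun] t] in blast)
    thus ?thesis using curl[OF t] by (simp add: r_def inner_diff_left L2_inner_integrable Lv u LR)
  qed
  have "AE x in cm. r x \<bullet> y = 0" for y
  proof (rule trig_total)
    show "integrable cm (\<lambda>x. r x \<bullet> y)" using L2_integrable[OF r] by simp
    fix n \<theta> assume n: "intvec n"
    show "(\<integral>x. (r x \<bullet> y) * cos (2 * pi * (n \<bullet> x) + \<theta>) \<partial>cm) = 0"
    proof (cases "n = 0")
      case True
      thus ?thesis using rmean integral_cm_inner(1)[OF L2_integrable[OF r], of y] by simp
    next
      case False
      define z where "z x = cos (2 * pi * (n \<bullet> x) + \<theta>)" for x
      \<comment> \<open>A quarter-period shift of the phase makes \<open>z\<close> the scalar factor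
        of a gradient, so \<open>rdiv\<close> and \<open>rcurl\<close> speak about the components of
        \<open>r\<close> along \<open>n\<close> and \<open>Rperp *v n\<close>.\<close>
      have t: "trig_poly (\<lambda>x. cos (2 * pi * (n \<bullet> x) + (\<theta> + pi/2))) (\<lambda>x. (- (2 * pi * z x)) *\<^sub>R n)"
        using trig_poly.base[OF n, of "\<theta> + pi/2"] by (simp add: z_def add.assoc[symmetric] sin_add)
      have "(\<lambda>x. r x \<bullet> ((- (2 * pi * z x)) *\<^sub>R n)) = (\<lambda>x. (- (2 * pi)) * ((r x \<bullet> n) * z x))" by auto
      hence i1: "(\<integral>x. (r x \<bullet> n) * z x \<partial>cm) = 0" using rdiv[OF t] by simp
      have "(\<lambda>x. r x \<bullet> (Rperp *v ((- (2 * pi * z x)) *\<^sub>R n))) = (\<lambda>x. (- (2 * pi)) * ((r x \<bullet> (Rperp *v n)) * z x))"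
        unfolding matrix_vector_mult_scaleR by auto
      hence i2: "(\<integral>x. (r x \<bullet> (Rperp *v n)) * z x \<partial>cm) = 0" using rcurl[OF t] by simp
      have Lz: "L2_per z" unfolding z_def using trig_poly_L2(1)[OF trig_poly.base[OF n]] by blast
      have int: "integrable cm (\<lambda>x. (r x \<bullet> w) * z x)" for w
        using L2_inner_integrable[OF L2_per_linear[OF bounded_linear_inner_left r] Lz] by simp
      obtain p q where y: "y = p *\<^sub>R n + q *\<^sub>R (Rperp *v n)" using Rperp_decomp[OF False] by blast
      have "(\<lambda>x. (r x \<bullet> y) * z x) = (\<lambda>x. p * ((r x \<bullet> n) * z x) + q * ((r x \<bullet> (Rperp *v n)) * z x))"
        by (auto simp: y inner_add_right algebra_simps)
      thus ?thesis unfolding z_def[symmetric] using i1 i2 int by simp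
    qed
  qed
  from this[of "axis 1 1"] this[of "axis 2 1"]
  have "AE x in cm. r x = 0"
    by eventually_elim (auto simp: inner_axis vec_eq_iff forall_2)
  hence ae: "AE x in cm. v x = u x" by (simp add: r_def)
  from v(1) obtain \<psi> d where d: "\<And>n. trig_poly (\<psi> n) (d n)" "(\<lambda>n. l2sq (\<lambda>x. d n x - v x)) \<longlonglongrightarrow> 0"
    by (rule l2_gradE) blast
  have "l2sq (\<lambda>x. d n x - v x) = l2sq (\<lambda>x. d n x - u x)" for n
    unfolding l2sq_def
  proof (rule integral_cong_AE)
    show "AE x in cm. (norm (d n x - v x))\<^sup>2 = (norm (d n x - u x))\<^sup>2"
      using ae by eventually_elim simp
  qed (auto intro!: borel_measurable_integrable L2_perD(4) L2_per_diff Lv u trig_poly_L2(2)[OF d(1)])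
  with d u show ?thesis unfolding l2_grad_def by auto
qed

lemma H1_per_grad_l2_grad:
  assumes H: "H1_per_grad \<phi> g" shows "l2_grad g"
proof (rule hodge)
  show L: "L2_per g" using H by (simp add: H1_per_grad_iff)
  have "(\<integral>x. \<phi> x *\<^sub>R (0::vec2) \<partial>cm) = - (\<integral>x. 1 *\<^sub>R g x \<partial>cm)"
    using H test_fun_const[of 1] unfolding H1_per_grad_iff by blast
  thus "(\<integral>x. g x \<partial>cm) = 0" by simp
qed (rule H1_per_grad_curl_free[OF H])

text \<open>By the Hodge decomposition every periodic C^1 gradient is a limit of gradients of
  trigonometric polynomials, so the latter suffice as tests.\<close>

lemma div_freeI:
  assumes J: "L2_per J" and orth: "\<And>\<psi> d. trig_poly \<psi> d \<Longrightarrow> (\<integral>x. J x \<bullet> d x \<partial>cm) = 0"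
  shows "div_free J"
  unfolding div_free_iff
proof (intro allI impI)
  fix \<psi> d assume "test_fun \<psi> d"
  from l2_grad_orth[OF H1_per_grad_l2_grad[OF test_fun_H1[OF this]] J]
  show "(\<integral>x. J x \<bullet> d x \<partial>cm) = 0" using orth by (simp add: inner_commute)
qed

lemma div_free_orth:
  assumes "div_free J" "L2_per J" "l2_grad u" shows "(\<integral>x. J x \<bullet> u x \<partial>cm) = 0"
  using l2_grad_orth[OF assms(3,2)] assms(1) trig_poly_test_fun by (auto simp: div_free_iff inner_commute)

section \<open>Rotation exchanges gradients and divergence-free fields\<close>

lemma div_free_Rperp:
  assumes "l2_grad u" shows "div_free (\<lambda>x. Rperp *v u x)"
proof (rule div_freeI)
  show "L2_per (\<lambda>x. Rperp *v u x)" by (intro L2_per_Rperp l2_gradD assms)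
  fix \<psi> d assume t: "trig_poly \<psi> d"
  have "(\<integral>x. u x \<bullet> (Rperp *v d x) \<partial>cm) = 0"
    by (rule l2_grad_orth[OF assms L2_per_Rperp[OF trig_poly_L2(2)[OF t]]])
       (use H1_per_grad_curl_free[OF test_fun_H1[OF trig_poly_test_fun] t] in blast)
  thus "(\<integral>x. (Rperp *v u x) \<bullet> d x \<partial>cm) = 0" by (simp add: inner_Rperp(1))
qed

text \<open>The potential behind this gradient is the stream function of \<open>q\<close>. Mean zero
  enters because nonzero constants are divergence-free but are not gradients of periodic
  functions.\<close>

lemma l2_grad_Rperp:
  assumes "div_free q" "L2_per q" "(\<integral>x. q x \<partial>cm) = 0" shows "l2_grad (\<lambda>x. Rperp *v q x)"
proof (rule hodge)
  show "L2_per (\<lambda>x. Rperp *v q x)" by (intro L2_per_Rperp assms)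
  show "(\<integral>x. Rperp *v q x \<partial>cm) = 0"
    using integral_bounded_linear[OF matrix_vector_mul_bounded_linear L2_integrable[OF assms(2)], of Rperp] assms(3) by simp
  show "(\<integral>x. (Rperp *v q x) \<bullet> (Rperp *v d x) \<partial>cm) = 0" if "trig_poly \<psi> d" for \<psi> d
    using assms(1) trig_poly_test_fun[OF that] by (auto simp: div_free_iff inner_Rperp(2))
qed

lemma div_free_const: "div_free (\<lambda>x. c)"
  unfolding div_free_iff
  using test_fun_integral_grad integral_cm_inner(2)[OF L2_integrable] test_fun_L2(2) by fastforce

lemma div_free_add:
  assumes "div_free f" "div_free g" "L2_per f" "L2_per g" shows "div_free (\<lambda>x. f x + g x)"
  using assms by (auto simp: div_free_iff inner_add_left L2_inner_integrable test_fun_L2)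

lemma div_free_scaleR: "div_free f \<Longrightarrow> div_free (\<lambda>x. c *\<^sub>R f x)"
  by (auto simp: div_free_iff)

lemma div_free_minus: "div_free f \<Longrightarrow> div_free (\<lambda>x. - f x)"
  by (auto simp: div_free_iff)

lemma l2_grad_iff: "l2_grad g \<longleftrightarrow> (\<exists>\<phi>. H1_per_grad \<phi> g)"
  using l2_grad_potential H1_per_grad_l2_grad by metis

text \<open>Mean and curl are linear in the field, so the Hodge characterization avoids adding
  approximating sequences.\<close>

lemma l2_grad_add:
  assumes "l2_grad f" "l2_grad g" shows "l2_grad (\<lambda>x. f x + g x)"
proof (rule hodge)
  note L = l2_gradD[OF assms(1)] l2_gradD[OF assms(2)]
  show "L2_per (\<lambda>x. f x + g x)" by (intro L2_per_add L)
  show "(\<integral>x. f x + g x \<partial>cm) = 0" using L2_integrable[OF L(1)] L2_integrable[OF L(2)] l2_grad_mean assms by simp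
  fix \<psi> d assume "trig_poly \<psi> d"
  note L' = L2_per_Rperp[OF trig_poly_L2(2)[OF this]] and c = H1_per_grad_curl_free[OF _ this]
  show "(\<integral>x. (f x + g x) \<bullet> (Rperp *v d x) \<partial>cm) = 0"
    using c assms unfolding l2_grad_iff by (auto simp: inner_add_left L2_inner_integrable L L')
qed

lemma l2_grad_scaleR:
  assumes "l2_grad f" shows "l2_grad (\<lambda>x. c *\<^sub>R f x)"
proof (rule hodge)
  note L = l2_gradD[OF assms(1)]
  show "L2_per (\<lambda>x. c *\<^sub>R f x)" by (intro L2_per_scaleR L)
  show "(\<integral>x. c *\<^sub>R f x \<partial>cm) = 0" using l2_grad_mean assms by simp
  fix \<psi> d assume "trig_poly \<psi> d"
  note c = H1_per_grad_curl_free[OF _ this]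
  show "(\<integral>x. (c *\<^sub>R f x) \<bullet> (Rperp *v d x) \<partial>cm) = 0"
    using c assms unfolding l2_grad_iff by auto
qed

lemma l2_grad_diff: "l2_grad f \<Longrightarrow> l2_grad g \<Longrightarrow> l2_grad (\<lambda>x. f x - g x)"
  using l2_grad_add[of f "\<lambda>x. (-1) *\<^sub>R g x"] l2_grad_scaleR[of g "-1"] by simp

section \<open>Two-dimensional conductors\<close>

lemma conductivity_field_iff:
  "conductivity_field \<sigma> e0 e \<longleftrightarrow> l2_grad (\<lambda>x. e x - e0) \<and> div_free (\<lambda>x. \<sigma> x *v e x)"
proof -
  have "(\<exists>\<phi> g. H1_per_grad \<phi> g \<and> e = (\<lambda>x. e0 + g x)) \<longleftrightarrow> l2_grad (\<lambda>x. e x - e0)"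
    unfolding l2_grad_iff
  proof safe
    fix \<phi> assume "H1_per_grad \<phi> (\<lambda>x. e x - e0)"
    thus "\<exists>\<phi> g. H1_per_grad \<phi> g \<and> e = (\<lambda>x. e0 + g x)"
      by (intro exI[of _ \<phi>] exI[of _ "\<lambda>x. e x - e0"]) auto
  qed auto
  thus ?thesis by (simp add: conductivity_field_def)
qed

lemma L2_per_shift: "L2_per (\<lambda>x. e x - e0) \<Longrightarrow> L2_per e"
  using L2_per_add[OF _ L2_per_const[of e0], of "\<lambda>x. e x - e0"] by simp

lemma l2_grad_shift_mean:
  assumes "l2_grad (\<lambda>x. e x - e0)" shows "(\<integral>x. e x \<partial>cm) = e0"
  using l2_grad_mean[OF assms] L2_integrable[OF L2_per_shift[OF l2_gradD[OF assms]]]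
  by (simp add: prob_cm)

text \<open>The fluctuation \<open>e x - e0\<close> is a gradient, hence orthogonal to
  \<open>J\<close>; this turns the mean of a product into a product of means.\<close>

lemma div_curl:
  assumes J: "div_free J" "L2_per J" and e: "l2_grad (\<lambda>x. e x - e0)"
  shows "(\<integral>x. J x \<bullet> e x \<partial>cm) = (\<integral>x. J x \<partial>cm) \<bullet> e0"
proof -
  have Le: "L2_per e" by (rule L2_per_shift[OF l2_gradD[OF e]])
  have "0 = (\<integral>x. J x \<bullet> (e x - e0) \<partial>cm)" by (rule div_free_orth[OF J e, symmetric])
  also have "\<dots> = (\<integral>x. J x \<bullet> e x \<partial>cm) - (\<integral>x. J x \<bullet> e0 \<partial>cm)"
    by (simp add: inner_diff_right L2_inner_integrable J Le L2_integrable)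
  also have "(\<integral>x. J x \<bullet> e0 \<partial>cm) = (\<integral>x. J x \<partial>cm) \<bullet> e0"
    by (rule integral_cm_inner(1)[OF L2_integrable[OF J(2)]])
  finally show ?thesis by simp
qed

lemma integral_Rperp:
  assumes "integrable cm f" shows "(\<integral>x. Rperp *v f x \<partial>cm) = Rperp *v (\<integral>x. f x \<partial>cm)"
  by (rule integral_bounded_linear[OF matrix_vector_mul_bounded_linear assms])

lemma vec2_split: "(v::vec2) = v $ 1 *\<^sub>R axis 1 1 + v $ 2 *\<^sub>R axis 2 1"
  by (simp add: vec_eq_iff forall_2 axis_def)

lemma matvec_nth: "((A::mat2) *v v) $ i = A $ i $ 1 * v $ 1 + A $ i $ 2 * v $ 2"
  by (simp add: matrix_vector_mult_def sum_2)

lemma sym_nth: "transpose (A::mat2) = A \<longleftrightarrow> A $ 1 $ 2 = A $ 2 $ 1"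
  by (auto simp: transpose_def vec_eq_iff forall_2)

lemma symI: "(\<And>v w. ((A::mat2) *v v) \<bullet> w = v \<bullet> (A *v w)) \<Longrightarrow> transpose A = A"
  unfolding sym_nth using inner_vec2[of "A *v axis 2 1" "axis 1 1"] inner_vec2[of "axis 2 1" "A *v axis 1 1"]
  by (simp add: matvec_nth axis_def)

lemma Rperp_entry [simp]: "Rperp $ 1 $ 1 = 0" "Rperp $ 1 $ 2 = -1" "Rperp $ 2 $ 1 = 1" "Rperp $ 2 $ 2 = 0"
  by (simp_all add: Rperp_def)

text \<open>For every 2x2 matrix, \<open>A ** Rperp ** transpose A\<close> is the determinant times
  \<open>Rperp\<close>. So here the inverse of \<open>A\<close> is \<open>A\<close> conjugated by
  the rotation, the source of all duality below.\<close>

lemma sym_det_1_Rperp: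
  assumes "transpose A = (A::mat2)" "det A = 1" shows "A *v (Rperp *v (A *v v)) = Rperp *v v"
proof -
  obtain a b c where A: "A $ 1 $ 1 = a" "A $ 1 $ 2 = b" "A $ 2 $ 1 = b" "A $ 2 $ 2 = c"
    using assms(1) by (auto simp: sym_nth)
  have "a * c - b * b = 1" using assms(2) by (simp add: det_2 A)
  hence "a * (- (b * x + c * y)) + b * (a * x + b * y) = - y" "b * (- (b * x + c * y)) + c * (a * x + b * y) = x" for x y
    by algebra+
  thus ?thesis by (simp add: vec_eq_iff forall_2 matvec_nth A)
qed

section \<open>Scalar conductivity fields and the effective matrix \<open>s\<close>\<close>

locale conductor =
  fixes \<sigma> :: "vec2 \<Rightarrow> mat2"
  assumes conducting: "conducting_composite \<sigma>"
begin

lemmas \<sigma>_coef = conducting_compositeD(1)[OF conducting]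
lemmas \<sigma>_sym = conducting_compositeD(2)[OF conducting]

lemma \<sigma>_pos: "v \<noteq> 0 \<Longrightarrow> v \<bullet> (\<sigma> x *v v) > 0"
proof -
  assume v: "v \<noteq> 0"
  obtain \<alpha> where "\<alpha> > 0" "v \<bullet> (\<sigma> x *v v) \<ge> \<alpha> * (norm v)\<^sup>2"
    using conducting by (auto simp: conducting_composite_def)
  moreover have "\<alpha> * (norm v)\<^sup>2 > 0" using calculation v by simp
  ultimately show ?thesis by linarith
qed

lemma L2_\<sigma>: "L2_per f \<Longrightarrow> L2_per (\<lambda>x. \<sigma> x *v f x)"
  by (rule L2_per_matvec[OF \<sigma>_coef])

lemma div_solve:
  assumes F: "L2_per F"
  obtains e where "l2_grad (\<lambda>x. e x - e0)" "div_free (\<lambda>x. \<sigma> x *v e x - F x)"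
proof -
  have L: "L2_per (\<lambda>x. F x - \<sigma> x *v e0)" by (intro L2_per_diff F L2_\<sigma> L2_per_const)
  obtain u where u: "l2_grad u" "\<And>\<psi> d. trig_poly \<psi> d \<Longrightarrow> (\<integral>x. (\<sigma> x *v u x - (F x - \<sigma> x *v e0)) \<bullet> d x \<partial>cm) = 0"
    by (rule lax_milgram[OF conducting L]) blast
  have eq: "\<sigma> x *v u x - (F x - \<sigma> x *v e0) = \<sigma> x *v (e0 + u x) - F x" for x
    by (simp add: matrix_vector_right_distrib)
  have "div_free (\<lambda>x. \<sigma> x *v (e0 + u x) - F x)"
    using u(2) unfolding eq
    by (intro div_freeI L2_per_diff L2_\<sigma> L2_per_add L2_per_const F l2_gradD[OF u(1)])
  thus ?thesis using u(1) by (intro that[of "\<lambda>x. e0 + u x"]) auto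
qed

lemma field_exists: "\<exists>e. conductivity_field \<sigma> e0 e"
proof -
  obtain e where "l2_grad (\<lambda>x. e x - e0)" "div_free (\<lambda>x. \<sigma> x *v e x - 0)"
    by (rule div_solve[OF L2_per_const[of 0], of e0])
  thus ?thesis unfolding conductivity_field_iff by auto
qed

lemma field_L2: "conductivity_field \<sigma> e0 e \<Longrightarrow> L2_per e"
  unfolding conductivity_field_iff using L2_per_shift l2_gradD by blast

text \<open>The difference of two such fields is a gradient with divergence-free flux, so its energy
  vanishes.\<close>

lemma field_unique:
  assumes "conductivity_field \<sigma> e0 e" "conductivity_field \<sigma> e0 e'" shows "AE x in cm. e x = e' x"
proof -
  note L = field_L2[OF assms(1)] field_L2[OF assms(2)]
  define g where "g x = e x - e' x" for x
  have g: "l2_grad g"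
    using l2_grad_diff[of "\<lambda>x. e x - e0" "\<lambda>x. e' x - e0"] assms by (simp add: g_def[abs_def] conductivity_field_iff)
  have "div_free (\<lambda>x. \<sigma> x *v e x + (-1) *\<^sub>R (\<sigma> x *v e' x))"
    using assms by (intro div_free_add div_free_scaleR L2_per_scaleR L2_\<sigma> L) (auto simp: conductivity_field_iff)
  hence "div_free (\<lambda>x. \<sigma> x *v g x)" by (simp add: g_def matrix_vector_mult_diff_distrib)
  from div_free_orth[OF this L2_\<sigma>[OF l2_gradD[OF g]] g]
  have z: "(\<integral>x. (\<sigma> x *v g x) \<bullet> g x \<partial>cm) = 0" .
  have nn: "(\<sigma> x *v g x) \<bullet> g x \<ge> 0" for x
    using \<sigma>_pos[of "g x" x] by (cases "g x = 0") (auto simp: inner_commute less_imp_le)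
  have "AE x in cm. (\<sigma> x *v g x) \<bullet> g x = 0"
    using z nn integral_nonneg_eq_0_iff_AE[OF L2_inner_integrable[OF L2_\<sigma>[OF l2_gradD[OF g]] l2_gradD[OF g]]] by simp
  thus ?thesis
  proof eventually_elim
    case (elim x)
    hence "g x = 0" using \<sigma>_pos[of "g x" x] by (auto simp: inner_commute)
    thus ?case by (simp add: g_def)
  qed
qed

text \<open>\<open>K c\<close> is a conductivity field of mean \<open>c\<close>, chosen linearly in \<open>c\<close>.\<close>

definition K :: "vec2 \<Rightarrow> vec2 \<Rightarrow> vec2"
  where "K c x = c $ 1 *\<^sub>R (SOME e. conductivity_field \<sigma> (axis 1 1) e) x + c $ 2 *\<^sub>R (SOME e. conductivity_field \<sigma> (axis 2 1) e) x"

lemma field_add: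
  assumes "conductivity_field \<sigma> a e" "conductivity_field \<sigma> b f"
  shows "conductivity_field \<sigma> (r *\<^sub>R a + t *\<^sub>R b) (\<lambda>x. r *\<^sub>R e x + t *\<^sub>R f x)"
  unfolding conductivity_field_iff
proof
  note L = field_L2[OF assms(1)] field_L2[OF assms(2)]
  have "l2_grad (\<lambda>x. r *\<^sub>R (e x - a) + t *\<^sub>R (f x - b))"
    using assms by (intro l2_grad_add l2_grad_scaleR) (auto simp: conductivity_field_iff)
  thus "l2_grad (\<lambda>x. r *\<^sub>R e x + t *\<^sub>R f x - (r *\<^sub>R a + t *\<^sub>R b))"
    by (simp add: algebra_simps)
  have "div_free (\<lambda>x. r *\<^sub>R (\<sigma> x *v e x) + t *\<^sub>R (\<sigma> x *v f x))"
    using assms by (intro div_free_add div_free_scaleR L2_per_scaleR L2_\<sigma> L) (auto simp: conductivity_field_iff)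
  thus "div_free (\<lambda>x. \<sigma> x *v (r *\<^sub>R e x + t *\<^sub>R f x))"
    by (simp add: matrix_vector_right_distrib matrix_vector_mult_scaleR)
qed

lemma K_field: "conductivity_field \<sigma> c (K c)"
proof -
  have "conductivity_field \<sigma> a (SOME e. conductivity_field \<sigma> a e)" for a
    using field_exists by (rule someI_ex)
  from field_add[OF this this, of "c $ 1" "axis 1 1" "c $ 2" "axis 2 1"]
  show ?thesis unfolding K_def[abs_def] vec2_split[of c, symmetric] .
qed

lemma K_L2: "L2_per (K c)"
  by (rule field_L2[OF K_field])

lemma K_grad: "l2_grad (\<lambda>x. K c x - c)" and K_div: "div_free (\<lambda>x. \<sigma> x *v K c x)"
  using K_field[of c] by (simp_all add: conductivity_field_iff)

lemma \<sigma>K_L2: "L2_per (\<lambda>x. \<sigma> x *v K c x)"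
  by (rule L2_\<sigma>[OF K_L2])

lemma K_add: "K (a + b) x = K a x + K b x" and K_scale: "K (r *\<^sub>R a) x = r *\<^sub>R K a x"
  by (simp_all add: K_def algebra_simps)

lemma K_mean: "(\<integral>x. K c x \<partial>cm) = c"
  by (rule l2_grad_shift_mean[OF K_grad])

lemma K_nonzero:
  assumes "AE x in cm. K c x = 0" shows "c = 0"
proof -
  have "(\<integral>x. K c x \<partial>cm) = (\<integral>x. 0 \<partial>cm)"
    using assms by (intro integral_cong_AE) (auto intro: borel_measurable_integrable L2_integrable K_L2)
  thus ?thesis by (simp add: K_mean)
qed

definition s :: mat2 where "s = matrix (\<lambda>c. \<integral>x. \<sigma> x *v K c x \<partial>cm)"

lemma s_mult: "s *v c = (\<integral>x. \<sigma> x *v K c x \<partial>cm)"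
proof -
  have "linear (\<lambda>c. \<integral>x. \<sigma> x *v K c x \<partial>cm)"
    by (rule linearI)
       (simp_all add: K_add K_scale matrix_vector_right_distrib matrix_vector_mult_scaleR L2_integrable \<sigma>K_L2)
  from matrix_works[OF this[unfolded linear_matrix_vector_mul_eq[symmetric]]] show ?thesis by (simp add: s_def)
qed

lemma field_flux:
  assumes "conductivity_field \<sigma> c e" shows "(\<integral>x. \<sigma> x *v e x \<partial>cm) = s *v c"
  unfolding s_mult
proof (rule integral_cong_AE)
  show "AE x in cm. \<sigma> x *v e x = \<sigma> x *v K c x"
    using field_unique[OF assms K_field] by eventually_elim simp
qed (auto intro: borel_measurable_integrable L2_integrable L2_\<sigma> K_L2 field_L2[OF assms])

lemma effective_conductivity: "effective_conductivity \<sigma> = s"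
  unfolding effective_conductivity_def
proof (rule the_equality)
  show "is_effective_conductivity \<sigma> s"
    unfolding is_effective_conductivity_def set_integral_cm using K_field s_mult by blast
  fix t assume "is_effective_conductivity \<sigma> t"
  hence "t *v c = s *v c" for c
    unfolding is_effective_conductivity_def set_integral_cm using field_flux by metis
  thus "t = s" by (simp add: matrix_eq)
qed

lemma s_inner: "(s *v c) \<bullet> d = (\<integral>x. (\<sigma> x *v K c x) \<bullet> K d x \<partial>cm)"
  unfolding s_mult by (rule div_curl[OF K_div \<sigma>K_L2 K_grad, symmetric])

lemma s_sym: "transpose s = s"
proof (rule symI)
  fix v w
  have "(\<sigma> x *v K v x) \<bullet> K w x = (\<sigma> x *v K w x) \<bullet> K v x" for x
    using \<sigma>_sym[of x "K v x" "K w x"] by (simp add: inner_commute)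
  thus "(s *v v) \<bullet> w = v \<bullet> (s *v w)" using s_inner[of v w] s_inner[of w v] by (simp add: inner_commute)
qed

text \<open>A zero integral would force \<open>K c\<close> to vanish almost everywhere, against its
  mean \<open>c\<close>. Besides \<sigma>, this is applied to the rotated inverse of
  \<open>L\<close> and to its gap below twice \<sigma>.\<close>

lemma integral_K_pos:
  assumes B: "coef B" and pos: "\<And>x v. v \<noteq> 0 \<Longrightarrow> (B x *v v) \<bullet> v > 0" and c: "c \<noteq> 0"
  shows "(\<integral>x. (B x *v K c x) \<bullet> K c x \<partial>cm) > 0"
proof -
  have i: "integrable cm (\<lambda>x. (B x *v K c x) \<bullet> K c x)"
    by (intro L2_inner_integrable L2_per_matvec[OF B] K_L2)
  have nn: "(B x *v K c x) \<bullet> K c x \<ge> 0" for x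
    using pos[of "K c x" x] by (cases "K c x = 0") auto
  have "(\<integral>x. (B x *v K c x) \<bullet> K c x \<partial>cm) \<noteq> 0"
  proof
    assume "(\<integral>x. (B x *v K c x) \<bullet> K c x \<partial>cm) = 0"
    hence "AE x in cm. (B x *v K c x) \<bullet> K c x = 0"
      using integral_nonneg_eq_0_iff_AE[OF i] nn by simp
    hence "AE x in cm. K c x = 0"
      by eventually_elim (use pos in \<open>metis less_irrefl\<close>)
    thus False using K_nonzero c by blast
  qed
  moreover have "(\<integral>x. (B x *v K c x) \<bullet> K c x \<partial>cm) \<ge> 0" by (intro Bochner_Integration.integral_nonneg nn)
  ultimately show ?thesis by simp
qed

lemma s_pos: "c \<noteq> 0 \<Longrightarrow> (s *v c) \<bullet> c > 0"
  unfolding s_inner by (rule integral_K_pos[OF \<sigma>_coef]) (auto simp: inner_commute \<sigma>_pos)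

end

section \<open>Duality for conductivities of determinant one\<close>

locale unimodular_conductor = conductor +
  assumes det_1: "det (\<sigma> x) = 1"
begin

lemma \<sigma>_Rperp: "\<sigma> x *v (Rperp *v (\<sigma> x *v v)) = Rperp *v v"
  using conducting det_1 by (intro sym_det_1_Rperp) (auto simp: conducting_composite_def)

text \<open>Keller-Dykhne duality. The flux is divergence-free, so its rotation is a gradient up to
  the mean; by \<open>\<sigma>_Rperp\<close> the flux of this new field is
  \<open>Rperp *v K c x\<close>, divergence-free because \<open>K c\<close> is a gradient up to its
  mean.\<close>

lemma rotated_flux_field: "conductivity_field \<sigma> (Rperp *v (s *v c)) (\<lambda>x. Rperp *v (\<sigma> x *v K c x))"
  unfolding conductivity_field_iff
proof
  have "l2_grad (\<lambda>x. Rperp *v (\<sigma> x *v K c x + - (s *v c)))"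
  proof (rule l2_grad_Rperp)
    show "div_free (\<lambda>x. \<sigma> x *v K c x + - (s *v c))"
      by (intro div_free_add K_div div_free_const \<sigma>K_L2 L2_per_const)
    show "L2_per (\<lambda>x. \<sigma> x *v K c x + - (s *v c))" by (intro L2_per_add \<sigma>K_L2 L2_per_const)
    show "(\<integral>x. \<sigma> x *v K c x + - (s *v c) \<partial>cm) = 0"
      using L2_integrable[OF \<sigma>K_L2] by (simp add: s_mult[symmetric] prob_cm)
  qed
  thus "l2_grad (\<lambda>x. Rperp *v (\<sigma> x *v K c x) - Rperp *v (s *v c))"
    by (simp add: matrix_vector_mult_diff_distrib)
  have "div_free (\<lambda>x. Rperp *v (K c x - c) + Rperp *v c)"
    by (intro div_free_add div_free_Rperp K_grad div_free_const L2_per_Rperp L2_per_diff K_L2 L2_per_const)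
  thus "div_free (\<lambda>x. \<sigma> x *v (Rperp *v (\<sigma> x *v K c x)))"
    by (simp add: \<sigma>_Rperp matrix_vector_mult_diff_distrib)
qed

text \<open>Two evaluations of the mean flux of the rotated flux field.\<close>

lemma s_Rperp: "s *v (Rperp *v (s *v c)) = Rperp *v c"
  using field_flux[OF rotated_flux_field[of c]]
  by (simp add: \<sigma>_Rperp integral_Rperp L2_integrable K_L2 K_mean)

lemma det_s: "det s = 1"
proof -
  have "(s *v (Rperp *v (s *v axis 1 1))) $ 2 = (Rperp *v axis 1 1) $ 2" by (simp add: s_Rperp)
  thus ?thesis using s_sym by (simp add: matvec_nth det_2 sym_nth axis_def algebra_simps)
qed

lemma rotated_flux: "AE x in cm. \<forall>i. Rperp *v (\<sigma> x *v K (axis i 1) x) = K (Rperp *v (s *v axis i 1)) x"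
  using field_unique[OF rotated_flux_field K_field]
  by (simp add: AE_all_countable)

text \<open>The determinant of the matrix with columns \<open>K (axis 1 1) x\<close> and \<open>K (axis 2 1) x\<close>.\<close>

definition D :: "vec2 \<Rightarrow> real"
  where "D x = (Rperp *v K (axis 1 1) x) \<bullet> K (axis 2 1) x"

lemma D_integrable: "integrable cm D"
  unfolding D_def[abs_def] by (intro L2_inner_integrable L2_per_Rperp K_L2)

lemma K_split: "K c x = c $ 1 *\<^sub>R K (axis 1 1) x + c $ 2 *\<^sub>R K (axis 2 1) x"
  by (metis K_add K_scale vec2_split)

text \<open>By duality each rotated flux is a combination of the two basis fields with constant
  coefficients taken from \<open>s\<close>. Pairing it with a rotated basis field leaves only the
  determinant \<open>D\<close>.\<close>

lemma K_\<sigma>_K: "AE x in cm. \<forall>c d. (\<sigma> x *v K c x) \<bullet> K d x = D x * ((s *v c) \<bullet> d)"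
  using rotated_flux
proof eventually_elim
  case (elim x)
  define k where "k i = K (axis i 1) x" for i
  have r: "Rperp *v (\<sigma> x *v k i) = - (s $ 2 $ i) *\<^sub>R k 1 + s $ 1 $ i *\<^sub>R k 2" for i
    using elim[rule_format, of i] exhaust_2[of i]
    unfolding k_def[symmetric] by (subst (asm) K_split) (auto simp: matvec_nth axis_def k_def)
  have f: "(\<sigma> x *v k i) \<bullet> k j = D x * s $ j $ i" for i j
  proof -
    have "(\<sigma> x *v k i) \<bullet> k j = (Rperp *v (\<sigma> x *v k i)) \<bullet> (Rperp *v k j)" by (simp add: inner_Rperp)
    also have "\<dots> = D x * s $ j $ i" unfolding r
      using exhaust_2[of j] by (auto simp: D_def k_def[symmetric] inner_vec2 algebra_simps)
    finally show ?thesis .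
  qed
  have Kk: "K c x = c $ 1 *\<^sub>R k 1 + c $ 2 *\<^sub>R k 2" for c unfolding k_def by (rule K_split)
  show ?case
    unfolding Kk
    by (auto simp: matrix_vector_right_distrib matrix_vector_mult_scaleR inner_add_left inner_add_right f)
       (simp add: inner_vec2 matvec_nth algebra_simps)
qed

text \<open>On the fields the forms of \<open>\<sigma> x\<close> and \<open>s\<close> differ by the
  factor \<open>D x\<close>, and both are positive.\<close>

lemma D_nonneg: "AE x in cm. D x \<ge> 0"
  using K_\<sigma>_K
proof eventually_elim
  case (elim x)
  let ?c = "axis 1 1 :: vec2"
  have "(\<sigma> x *v K ?c x) \<bullet> K ?c x \<ge> 0"
    using \<sigma>_pos[of "K ?c x" x] by (cases "K ?c x = 0") (auto simp: inner_commute)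
  moreover have "(s *v ?c) \<bullet> ?c > 0" by (rule s_pos) (simp add: axis_eq_0_iff)
  ultimately show ?case using elim[rule_format, of ?c ?c] by (simp add: zero_le_mult_iff)
qed

lemma integral_D: "(\<integral>x. D x \<partial>cm) = 1"
proof -
  let ?c = "axis 1 1 :: vec2"
  have "(s *v ?c) \<bullet> ?c = (\<integral>x. D x * ((s *v ?c) \<bullet> ?c) \<partial>cm)"
    unfolding s_inner[of ?c ?c]
  proof (rule integral_cong_AE)
    show "AE x in cm. (\<sigma> x *v K ?c x) \<bullet> K ?c x = D x * (\<integral>x. (\<sigma> x *v K ?c x) \<bullet> K ?c x \<partial>cm)"
      using K_\<sigma>_K unfolding s_inner[of ?c ?c, symmetric] by eventually_elim auto
  qed (auto intro!: borel_measurable_integrable L2_inner_integrable \<sigma>K_L2 K_L2 borel_measurable_times D_integrable)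
  moreover have "(s *v ?c) \<bullet> ?c > 0" by (rule s_pos) (simp add: axis_eq_0_iff)
  ultimately show ?thesis by simp
qed

text \<open>Pointwise \<open>D\<close> is only known to be nonnegative; strictness comes from its
  mean being 1.\<close>

lemma integral_D_mult:
  assumes w: "integrable cm (\<lambda>x. D x * w x)" and pos: "\<And>x. w x > 0"
  shows "(\<integral>x. D x * w x \<partial>cm) > 0"
proof -
  have nn: "AE x in cm. D x * w x \<ge> 0"
    using D_nonneg by eventually_elim (use pos in \<open>auto simp: less_imp_le\<close>)
  have "(\<integral>x. D x * w x \<partial>cm) \<noteq> 0"
  proof
    assume "(\<integral>x. D x * w x \<partial>cm) = 0"
    hence "AE x in cm. D x * w x = 0" using integral_nonneg_eq_0_iff_AE[OF w nn] by simp
    hence "AE x in cm. D x = 0" by eventually_elim (use pos in \<open>metis less_irrefl mult_eq_0_iff\<close>)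
    hence "(\<integral>x. D x \<partial>cm) = (\<integral>x. 0 \<partial>cm)"
      using D_integrable by (intro integral_cong_AE) auto
    thus False by (simp add: integral_D)
  qed
  moreover have "(\<integral>x. D x * w x \<partial>cm) \<ge> 0" using nn by (rule integral_nonneg_AE)
  ultimately show ?thesis by simp
qed

end

section \<open>Effective tensors\<close>

lemma matvec_minus_right: "(A::mat2) *v (- v) = - (A *v v)"
  by (simp add: vec_eq_iff matvec_nth)

lemma matvec_minus_left: "(- A::mat2) *v v = - (A *v v)"
  by (simp add: vec_eq_iff matvec_nth)

lemma Tperp_nth [simp]: "Tperp $ i $ j = (Rperp $ i $ j) *\<^sub>R Rperp"
  by (simp add: Tperp_def kron_def)

lemma frakL_nth: "frakL L M $ 1 $ 1 = L" "frakL L M $ 1 $ 2 = L ** M - Rperp"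
  "frakL L M $ 2 $ 1 = transpose M ** L + Rperp" "frakL L M $ 2 $ 2 = transpose M ** L ** M"
  by (simp_all add: frakL_def)

lemma block_apply_nth: "(A *b E) $ i = A $ i $ 1 *v E $ 1 + A $ i $ 2 *v E $ 2"
  by (simp add: block_apply_def sum_2)

lemma frakL_apply:
  "(frakL L M *b E) $ 1 = L *v (E $ 1 + M *v E $ 2) - Rperp *v E $ 2"
  "(frakL L M *b E) $ 2 = transpose M *v (L *v (E $ 1 + M *v E $ 2)) + Rperp *v E $ 1"
  by (simp_all add: block_apply_nth frakL_nth matrix_vector_right_distrib matrix_vector_mult_add_rdistrib
      matrix_vector_mult_diff_rdistrib matrix_vector_mul_assoc matrix_mul_assoc)

lemma transpose_Rperp_mult: "transpose A = A \<Longrightarrow> transpose (Rperp ** A) *v w = - (A *v (Rperp *v w))"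
proof -
  assume "transpose A = A"
  moreover have "transpose Rperp *v w = - (Rperp *v w)"
    by (simp add: vec_eq_iff forall_2 matvec_nth transpose_def)
  ultimately show ?thesis
    by (simp add: matrix_transpose_mul matrix_vector_mul_assoc[symmetric] matvec_minus_right)
qed

lemma block_eqI:
  assumes "\<And>E. A *b E = B *b E" shows "A = B"
proof -
  have "A $ i $ j = B $ i $ j" for i j
  proof -
    have "A $ i $ j *v v = B $ i $ j *v v" for v
      using arg_cong[OF assms[of "axis j v"], of "\<lambda>E. E $ i"] exhaust_2[of j]
      by (auto simp: block_apply_nth axis_def)
    thus ?thesis by (simp add: matrix_eq)
  qed
  thus ?thesis by (simp add: vec_eq_iff)
qed

lemma pos_invertible:
  assumes "\<And>v. v \<noteq> 0 \<Longrightarrow> ((A::mat2) *v v) \<bullet> v > 0" shows "invertible A"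
proof -
  have "\<forall>v. A *v v = 0 \<longrightarrow> v = 0" using assms by (metis inner_zero_left less_irrefl)
  thus ?thesis by (metis invertible_left_inverse matrix_left_invertible_ker)
qed

lemma matrix_inv_mult:
  assumes "invertible (A::mat2)"
  shows "matrix_inv A *v (A *v v) = v" "A *v (matrix_inv A *v v) = v"
proof -
  have "A ** matrix_inv A = mat 1 \<and> matrix_inv A ** A = mat 1"
    unfolding matrix_inv_def by (rule someI_ex) (use assms in \<open>simp add: invertible_def\<close>)
  thus "matrix_inv A *v (A *v v) = v" "A *v (matrix_inv A *v v) = v"
    by (simp_all add: matrix_vector_mul_assoc)
qed

lemma matrix_inv_eqI:
  assumes "\<And>v. (A::mat2) *v (B *v v) = v" "\<And>v. B *v (A *v v) = v" shows "matrix_inv A = B" "invertible A"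
proof -
  have "A ** B = mat 1" "B ** A = mat 1"
    using assms by (simp_all add: matrix_eq matrix_vector_mul_assoc[symmetric])
  thus inv: "invertible A" by (auto simp: invertible_def)
  have "matrix_inv A *v v = B *v v" for v
    using matrix_inv_mult(1)[OF inv, of "B *v v"] assms(1) by simp
  thus "matrix_inv A = B" by (simp add: matrix_eq)
qed

lemma tens_integral:
  fixes f :: "vec2 \<Rightarrow> tens"
  assumes "\<And>i. integrable cm (\<lambda>x. f x $ i)"
  shows "(\<integral>x. f x \<partial>cm) $ i = (\<integral>x. f x $ i \<partial>cm)"
proof -
  have bl: "bounded_linear (axis i :: vec2 \<Rightarrow> tens)" for i
    by (rule bounded_linearI'[where 'a=vec2]) (auto simp: vec_eq_iff axis_def)
  have "integrable cm (\<lambda>x. axis 1 (f x $ 1) + axis 2 (f x $ 2) :: tens)"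
    by (intro Bochner_Integration.integrable_add integrable_bounded_linear[OF bl] assms)
  also have "(\<lambda>x. axis 1 (f x $ 1) + axis 2 (f x $ 2) :: tens) = f"
    by (simp add: fun_eq_iff vec_eq_iff forall_2 axis_def)
  finally show ?thesis
    by (intro integral_bounded_linear[OF bounded_linear_vec_nth, symmetric])
qed

lemma cell_field_iff:
  "cell_field A E0 E \<longleftrightarrow> (\<forall>i. l2_grad (\<lambda>x. E x $ i - E0 $ i)) \<and> (\<forall>i. div_free (\<lambda>x. (A x *b E x) $ i))"
proof -
  have "(\<exists>\<phi>1 \<phi>2 g1 g2. H1_per_grad \<phi>1 g1 \<and> H1_per_grad \<phi>2 g2 \<and> E = (\<lambda>x. E0 + vector [g1 x, g2 x]))
    \<longleftrightarrow> (\<forall>i. l2_grad (\<lambda>x. E x $ i - E0 $ i))" (is "?l \<longleftrightarrow> ?r")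
  proof
    assume ?l
    thus ?r by (auto simp: forall_2 l2_grad_iff)
  next
    assume ?r
    then obtain \<phi>1 \<phi>2 where "H1_per_grad \<phi>1 (\<lambda>x. E x $ 1 - E0 $ 1)" "H1_per_grad \<phi>2 (\<lambda>x. E x $ 2 - E0 $ 2)"
      by (auto simp: forall_2 l2_grad_iff)
    moreover have "E = (\<lambda>x. E0 + vector [E x $ 1 - E0 $ 1, E x $ 2 - E0 $ 2])"
      by (simp add: fun_eq_iff vec_eq_iff forall_2)
    ultimately show ?l by blast
  qed
  thus ?thesis by (simp add: cell_field_def)
qed

lemma cell_field_L2: "cell_field A E0 E \<Longrightarrow> L2_per (\<lambda>x. E x $ i)"
  unfolding cell_field_iff by (rule L2_per_shift[OF l2_gradD]) blast

lemma composite_coef: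
  assumes "composite A" shows "coef (\<lambda>x. A x $ i $ j)"
proof -
  from assms obtain C where C: "compact C" "range A \<subseteq> C" and A: "periodic A" "A \<in> borel_measurable lebesgue"
    by (auto simp: composite_def)
  have "bounded (range A)" using C bounded_subset compact_imp_bounded by blast
  hence "bounded ((\<lambda>B. B $ i $ j) ` range A)"
    by (rule bounded_linear_image) (intro bounded_linear_compose[OF bounded_linear_vec_nth bounded_linear_vec_nth])
  moreover have "(\<lambda>B::block. B $ i $ j) \<in> borel_measurable borel"
    by (intro borel_measurable_continuous_onI continuous_intros)
  from measurable_compose[OF A(2) this] have "(\<lambda>x. A x $ i $ j) \<in> borel_measurable lebesgue" .
  ultimately show ?thesis using A(1) by (auto simp: coef_def periodic_def image_image)
qed

lemma composite_flux_L2: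
  assumes "composite A" "\<And>i. L2_per (\<lambda>x. E x $ i)" shows "L2_per (\<lambda>x. (A x *b E x) $ i)"
  unfolding block_apply_nth by (intro L2_per_add L2_per_matvec composite_coef assms)

text \<open>The energy of the difference vanishes, as for a scalar conductor. The tensor is positive
  only jointly in both components, so their contributions are added before positivity is
  used.\<close>

lemma cell_field_unique:
  assumes A: "composite A" and E: "cell_field A E0 E" and F: "cell_field A E0 F"
  shows "AE x in cm. E x = F x"
proof -
  have L: "L2_per (\<lambda>x. E x $ i)" "L2_per (\<lambda>x. F x $ i)" for i
    by (intro cell_field_L2[OF E] cell_field_L2[OF F])+
  define G where "G x = E x - F x" for x
  have gG: "l2_grad (\<lambda>x. G x $ i)" for i
    using l2_grad_diff[of "\<lambda>x. E x $ i - E0 $ i" "\<lambda>x. F x $ i - E0 $ i"] E F by (simp add: G_def cell_field_iff)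
  have dG: "div_free (\<lambda>x. (A x *b G x) $ i)" for i
  proof -
    have "div_free (\<lambda>x. (A x *b E x) $ i + (-1) *\<^sub>R (A x *b F x) $ i)"
      using E F unfolding cell_field_iff
      by (intro div_free_add div_free_scaleR L2_per_scaleR composite_flux_L2 A L) auto
    thus ?thesis by (simp add: G_def block_apply_nth matrix_vector_mult_diff_distrib algebra_simps)
  qed
  have LA: "L2_per (\<lambda>x. (A x *b G x) $ i)" for i by (intro composite_flux_L2 A l2_gradD gG)
  have Apos: "E \<noteq> 0 \<Longrightarrow> E \<bullet> (A x *b E) > 0" for E x
    using A by (auto simp: composite_def Sym_pos_def)
  have nn: "G x \<bullet> (A x *b G x) \<ge> 0" for x
    using Apos[of "G x" x] by (cases "G x = 0") auto
  have eq: "G x \<bullet> (A x *b G x) = (A x *b G x) $ 1 \<bullet> G x $ 1 + (A x *b G x) $ 2 \<bullet> G x $ 2" for x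
    by (simp add: inner_vec_def[of "G x"] sum_2 inner_commute)
  have i: "integrable cm (\<lambda>x. (A x *b G x) $ i \<bullet> G x $ i)" for i
    by (intro L2_inner_integrable LA l2_gradD gG)
  have "(\<integral>x. G x \<bullet> (A x *b G x) \<partial>cm) = 0"
    unfolding eq by (simp add: i div_free_orth[OF dG LA gG])
  moreover have "integrable cm (\<lambda>x. G x \<bullet> (A x *b G x))" unfolding eq using i by simp
  ultimately have "AE x in cm. G x \<bullet> (A x *b G x) = 0"
    using nn integral_nonneg_eq_0_iff_AE[of cm "\<lambda>x. G x \<bullet> (A x *b G x)"] by simp
  thus ?thesis
  proof eventually_elim
    case (elim x)
    hence "G x = 0" using Apos[of "G x" x] by auto
    thus ?case by (simp add: G_def)
  qed
qed

lemma effective_tensor_eqI: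
  assumes A: "composite A" and T: "is_effective_tensor A T" shows "effective_tensor A = T"
  unfolding effective_tensor_def
proof (rule the_equality)
  show "is_effective_tensor A T" by (rule T)
  fix T' assume T': "is_effective_tensor A T'"
  show "T' = T"
  proof (rule block_eqI)
    fix E0
    from spec[OF T[unfolded is_effective_tensor_def set_integral_cm], of E0]
    obtain E where E: "cell_field A E0 E" "T *b E0 = (\<integral>x. A x *b E x \<partial>cm)" by blast
    from spec[OF T'[unfolded is_effective_tensor_def set_integral_cm], of E0]
    obtain F where F: "cell_field A E0 F" "T' *b E0 = (\<integral>x. A x *b F x \<partial>cm)" by blast
    have L: "L2_per (\<lambda>x. E x $ i)" "L2_per (\<lambda>x. F x $ i)" for i
      by (intro cell_field_L2[OF E(1)] cell_field_L2[OF F(1)])+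
    have "(\<integral>x. (A x *b F x) $ i \<partial>cm) = (\<integral>x. (A x *b E x) $ i \<partial>cm)" for i
    proof (rule integral_cong_AE)
      show "AE x in cm. (A x *b F x) $ i = (A x *b E x) $ i"
        using cell_field_unique[OF A E(1) F(1)] by eventually_elim simp
    qed (auto intro!: borel_measurable_integrable L2_integrable composite_flux_L2 A L)
    hence "(\<integral>x. A x *b F x \<partial>cm) $ i = (\<integral>x. A x *b E x \<partial>cm) $ i" for i
      unfolding tens_integral[OF L2_integrable[OF composite_flux_L2[OF A L(1)]]]
        tens_integral[OF L2_integrable[OF composite_flux_L2[OF A L(2)]]] .
    hence "(\<integral>x. A x *b F x \<partial>cm) = (\<integral>x. A x *b E x \<partial>cm)"
      by (subst vec_eq_iff) blast
    thus "T' *b E0 = T *b E0" using E F by simp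
  qed
qed

text \<open>\<open>P\<close> is the pointwise inverse of \<open>L\<close>. For \<open>M = Rperp ** \<sigma>\<close> the last assumption is the
  condition \<open>L\<^sup>-\<^sup>1 + 2 M R\<^sub>\<bottom> < 0\<close> of the set \<open>M19\<close>.\<close>

locale tensor_composite = unimodular_conductor +
  fixes L P :: "vec2 \<Rightarrow> mat2"
  assumes comp: "composite (\<lambda>x. frakL (L x) (Rperp ** \<sigma> x))"
    and P_coef: "coef P"
    and LP: "L x *v (P x *v v) = v"
    and P_sym: "(P x *v v) \<bullet> w = v \<bullet> (P x *v w)"
    and P_pos: "v \<noteq> 0 \<Longrightarrow> (P x *v v) \<bullet> v > 0"
    and P_less: "v \<noteq> 0 \<Longrightarrow> (P x *v v) \<bullet> v < 2 * ((\<sigma> x *v (Rperp *v v)) \<bullet> (Rperp *v v))"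
begin

lemma RK_L2: "L2_per (\<lambda>x. Rperp *v K c x)"
  by (intro L2_per_Rperp K_L2)

lemma PRK_L2: "L2_per (\<lambda>x. P x *v (Rperp *v K c x))"
  by (intro L2_per_matvec P_coef RK_L2)

text \<open>\<open>S\<close> acts on the mean of h. The corresponding mean of j is that vector
  rotated back, so the inverse of the effective \<open>L\<close> is the conjugate \<open>N\<close>
  of \<open>S\<close> by the rotation.\<close>

definition S :: mat2
  where "S = matrix (\<lambda>c. \<chi> i. \<integral>x. (P x *v (Rperp *v K c x)) \<bullet> (Rperp *v K (axis i 1) x) \<partial>cm)"

lemma PRK_integrable: "integrable cm (\<lambda>x. (P x *v (Rperp *v K c x)) \<bullet> (Rperp *v K d x))"
  by (intro L2_inner_integrable PRK_L2 RK_L2)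

lemma S_inner: "(S *v c) \<bullet> d = (\<integral>x. (P x *v (Rperp *v K c x)) \<bullet> (Rperp *v K d x) \<partial>cm)"
proof -
  let ?f = "\<lambda>c. \<chi> i. \<integral>x. (P x *v (Rperp *v K c x)) \<bullet> (Rperp *v K (axis i 1) x) \<partial>cm"
  have "linear ?f"
    by (rule linearI)
       (simp_all add: vec_eq_iff K_add K_scale matrix_vector_right_distrib matrix_vector_mult_scaleR
          inner_add_left PRK_integrable)
  from matrix_works[OF this[unfolded linear_matrix_vector_mul_eq[symmetric]]]
  have "S *v c = ?f c" by (simp add: S_def)
  hence "(S *v c) \<bullet> d = (\<integral>x. (P x *v (Rperp *v K c x)) \<bullet> (Rperp *v (d $ 1 *\<^sub>R K (axis 1 1) x + d $ 2 *\<^sub>R K (axis 2 1) x)) \<partial>cm)"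
    by (simp add: inner_vec2[of _ d] matrix_vector_right_distrib matrix_vector_mult_scaleR
          inner_add_right PRK_integrable mult.commute)
  thus ?thesis unfolding K_split[of d, symmetric] .
qed

lemma S_sym: "(S *v c) \<bullet> d = c \<bullet> (S *v d)"
proof -
  have "(P x *v (Rperp *v K c x)) \<bullet> (Rperp *v K d x) = (P x *v (Rperp *v K d x)) \<bullet> (Rperp *v K c x)" for x
    using P_sym[of x "Rperp *v K c x" "Rperp *v K d x"] by (simp add: inner_commute)
  thus ?thesis unfolding inner_commute[of c] S_inner by simp
qed

text \<open>This matrix is \<open>P x\<close> conjugated by the rotation; it turns the form of
  \<open>P\<close> on rotated fields into a form on the fields \<open>K c\<close>, where
  \<open>integral_K_pos\<close> applies.\<close>

lemma PR_coef: "coef (\<lambda>x. - (Rperp ** P x ** Rperp))"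
proof -
  have c: "continuous_on UNIV (\<lambda>B::mat2. - (Rperp ** B ** Rperp))"
    unfolding matrix_matrix_mult_def by (intro continuous_intros)
  have bl: "bounded_linear (\<lambda>B::mat2. - (Rperp ** B ** Rperp))"
    by (rule bounded_linearI'[where 'a=mat2])
       (auto simp: vec_eq_iff forall_2 matrix_matrix_mult_def sum_2 algebra_simps)
  have "bounded ((\<lambda>B. - (Rperp ** B ** Rperp)) ` range P)"
    using P_coef by (intro bounded_linear_image[OF _ bl]) (auto simp: coef_def)
  moreover have "(\<lambda>x. - (Rperp ** P x ** Rperp)) \<in> borel_measurable lebesgue"
    using P_coef measurable_compose[OF _ borel_measurable_continuous_onI[OF c]] by (auto simp: coef_def)
  ultimately show ?thesis using P_coef by (auto simp: coef_def periodic_def image_image)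
qed

lemma PR_inner: "(- (Rperp ** B ** Rperp) *v v) \<bullet> w = (B *v (Rperp *v v)) \<bullet> (Rperp *v w)"
  by (simp add: inner_Rperp(1) matrix_vector_mul_assoc[symmetric] matvec_minus_left
      inner_commute[of "_ *v (Rperp *v v)"])

lemma S_pos: "c \<noteq> 0 \<Longrightarrow> (S *v c) \<bullet> c > 0"
proof -
  assume c: "c \<noteq> 0"
  have "(\<integral>x. (- (Rperp ** P x ** Rperp) *v K c x) \<bullet> K c x \<partial>cm) > 0"
  proof (rule integral_K_pos[OF PR_coef _ c])
    fix x and v :: vec2 assume "v \<noteq> 0"
    hence "Rperp *v v \<noteq> 0" using inner_Rperp(2)[of v v] by auto
    thus "(- (Rperp ** P x ** Rperp) *v v) \<bullet> v > 0" unfolding PR_inner by (rule P_pos)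
  qed
  thus ?thesis unfolding PR_inner S_inner .
qed

lemma S_less: "c \<noteq> 0 \<Longrightarrow> (S *v c) \<bullet> c < 2 * ((s *v c) \<bullet> c)"
proof -
  assume c: "c \<noteq> 0"
  have "(\<integral>x. ((2 *\<^sub>R \<sigma> x + Rperp ** P x ** Rperp) *v K c x) \<bullet> K c x \<partial>cm) > 0"
  proof (rule integral_K_pos[OF _ _ c])
    have "(\<lambda>x. - (Rperp ** P x ** Rperp)) \<in> borel_measurable lebesgue" "\<sigma> \<in> borel_measurable lebesgue"
      using PR_coef \<sigma>_coef by (auto simp: coef_def)
    hence "(\<lambda>x. 2 *\<^sub>R \<sigma> x - - (Rperp ** P x ** Rperp)) \<in> borel_measurable lebesgue" by measurable
    moreover have "bounded ((\<lambda>x. 2 *\<^sub>R \<sigma> x - - (Rperp ** P x ** Rperp)) ` UNIV)"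
      using PR_coef \<sigma>_coef by (intro bounded_minus_comp bounded_scaleR_comp) (auto simp: coef_def)
    ultimately show "coef (\<lambda>x. 2 *\<^sub>R \<sigma> x + Rperp ** P x ** Rperp)"
      using P_coef \<sigma>_coef by (auto simp: coef_def periodic_def)
    fix x and v :: vec2 assume v: "v \<noteq> 0"
    hence "Rperp *v v \<noteq> 0" using inner_Rperp(2)[of v v] by auto
    from P_less[OF this, of x] have "(- (Rperp ** P x ** Rperp) *v v) \<bullet> v < 2 * ((\<sigma> x *v v) \<bullet> v)"
      unfolding PR_inner by (simp add: inner_Rperp(4) matvec_minus_right)
    thus "((2 *\<^sub>R \<sigma> x + Rperp ** P x ** Rperp) *v v) \<bullet> v > 0"
      by (simp add: matrix_vector_mult_add_rdistrib inner_add_left matvec_minus_left scaleR_matrix_vector_assoc[symmetric])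
  qed
  also have "(\<lambda>x. ((2 *\<^sub>R \<sigma> x + Rperp ** P x ** Rperp) *v K c x) \<bullet> K c x)
      = (\<lambda>x. 2 * ((\<sigma> x *v K c x) \<bullet> K c x) - (P x *v (Rperp *v K c x)) \<bullet> (Rperp *v K c x))"
    unfolding PR_inner[symmetric]
    by (simp add: fun_eq_iff matrix_vector_mult_add_rdistrib inner_add_left matvec_minus_left scaleR_matrix_vector_assoc[symmetric])
  also have "(\<integral>x. 2 * ((\<sigma> x *v K c x) \<bullet> K c x) - (P x *v (Rperp *v K c x)) \<bullet> (Rperp *v K c x) \<partial>cm)
      = 2 * ((s *v c) \<bullet> c) - (S *v c) \<bullet> c"
    unfolding s_inner S_inner by (simp add: PRK_integrable L2_inner_integrable \<sigma>K_L2 K_L2)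
  finally show ?thesis by simp
qed

text \<open>The inverse of the effective \<open>L\<close>.\<close>

definition N :: mat2 where "N = - (Rperp ** S ** Rperp)"

lemma N_inner: "(N *v v) \<bullet> w = (S *v (Rperp *v v)) \<bullet> (Rperp *v w)"
  unfolding N_def by (rule PR_inner)

lemma N_mult: "N *v (Rperp *v w) = Rperp *v (S *v w)"
  by (simp add: N_def matrix_vector_mul_assoc[symmetric] matvec_minus_left matvec_minus_right inner_Rperp(4))

lemma N_pos: "v \<noteq> 0 \<Longrightarrow> (N *v v) \<bullet> v > 0"
  and N_less: "v \<noteq> 0 \<Longrightarrow> (N *v v) \<bullet> v < 2 * ((s *v (Rperp *v v)) \<bullet> (Rperp *v v))"
  and N_sym: "transpose N = N"
proof -
  have nz: "Rperp *v v \<noteq> 0" if "v \<noteq> 0" for v using that inner_Rperp(2)[of v v] by auto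
  show "v \<noteq> 0 \<Longrightarrow> (N *v v) \<bullet> v > 0" "v \<noteq> 0 \<Longrightarrow> (N *v v) \<bullet> v < 2 * ((s *v (Rperp *v v)) \<bullet> (Rperp *v v))"
    unfolding N_inner using S_pos S_less nz by blast+
  show "transpose N = N"
    by (rule symI) (metis N_inner S_sym inner_commute)
qed

lemma N_invertible: "invertible N"
  using N_pos by (rule pos_invertible)

theorem effective: "is_effective_tensor (\<lambda>x. frakL (L x) (Rperp ** \<sigma> x)) (frakL (matrix_inv N) (Rperp ** s))"
  unfolding is_effective_tensor_def set_integral_cm
proof
  fix E0 :: tens
  define p q where "p = E0 $ 1" and "q = E0 $ 2"
  \<comment> \<open>The mean of e1 is \<open>p\<close> exactly when that of R e1 is
    \<open>Rperp *v p\<close>. Tested against \<open>K c\<close>, the latter mean is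
    \<open>s *v q + S *v h0\<close>, which dictates \<open>h0\<close>.\<close>
  define h0 where "h0 = matrix_inv S *v (Rperp *v p - s *v q)"
  have Sh0: "S *v h0 = Rperp *v p - s *v q"
    unfolding h0_def by (rule matrix_inv_mult(2)[OF pos_invertible[OF S_pos]])
  define h where "h = K h0"
  \<comment> \<open>\<open>F\<close> is minus the rotated L^-1 j. Subtracting it from the flux of
    \<open>e\<close> makes \<open>Q\<close> the rotation of e1.\<close>
  define F where "F x = Rperp *v (P x *v (Rperp *v h x))" for x
  have LF: "L2_per F" unfolding F_def h_def by (intro L2_per_Rperp PRK_L2)
  obtain e where e: "l2_grad (\<lambda>x. e x - q)" "div_free (\<lambda>x. \<sigma> x *v e x - F x)"
    by (rule div_solve[OF LF])
  have Le: "L2_per e" by (rule L2_per_shift[OF l2_gradD[OF e(1)]])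
  define Q where "Q x = \<sigma> x *v e x - F x" for x
  have LQ: "L2_per Q" unfolding Q_def by (intro L2_per_diff L2_\<sigma> Le LF)
  have dQ: "div_free Q" using e(2) by (simp add: Q_def[abs_def])
  have Qmean: "(\<integral>x. Q x \<partial>cm) = Rperp *v p"
  proof -
    have "(\<integral>x. Q x \<partial>cm) \<bullet> c = (Rperp *v p) \<bullet> c" for c
    proof -
      have "(\<integral>x. Q x \<partial>cm) \<bullet> c = (\<integral>x. Q x \<bullet> K c x \<partial>cm)"
        by (rule div_curl[OF dQ LQ K_grad, symmetric])
      also have "(\<lambda>x. Q x \<bullet> K c x) = (\<lambda>x. (\<sigma> x *v K c x) \<bullet> e x + (P x *v (Rperp *v h x)) \<bullet> (Rperp *v K c x))"
      proof
        fix x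
        have "(\<sigma> x *v e x) \<bullet> K c x = (\<sigma> x *v K c x) \<bullet> e x"
          using \<sigma>_sym[of x "e x" "K c x"] by (simp add: inner_commute)
        thus "Q x \<bullet> K c x = (\<sigma> x *v K c x) \<bullet> e x + (P x *v (Rperp *v h x)) \<bullet> (Rperp *v K c x)"
          by (simp add: Q_def F_def inner_diff_left inner_Rperp(1))
      qed
      also have "(\<integral>x. (\<sigma> x *v K c x) \<bullet> e x + (P x *v (Rperp *v h x)) \<bullet> (Rperp *v K c x) \<partial>cm)
          = (\<integral>x. (\<sigma> x *v K c x) \<bullet> e x \<partial>cm) + (S *v h0) \<bullet> c"
        unfolding S_inner h_def by (simp add: PRK_integrable L2_inner_integrable \<sigma>K_L2 Le)
      also have "(\<integral>x. (\<sigma> x *v K c x) \<bullet> e x \<partial>cm) = (s *v c) \<bullet> q"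
        unfolding s_mult by (rule div_curl[OF K_div \<sigma>K_L2 e(1)])
      also have "(s *v c) \<bullet> q = (s *v q) \<bullet> c"
        using sym_inner[OF s_sym, of c q] by (simp add: inner_commute)
      finally show ?thesis by (simp add: Sh0 inner_diff_left)
    qed
    thus ?thesis using vector_eq_rdot by blast
  qed
  define E where "E x = (vector [- (Rperp *v Q x), e x] :: tens)" for x
  have E1: "E x $ 1 = - (Rperp *v Q x)" and E2: "E x $ 2 = e x" for x by (simp_all add: E_def)
  \<comment> \<open>The field is built so that e1 + M e2 equals
    \<open>- (P x *v (Rperp *v h x))\<close>; applying \<open>L x\<close> cancels
    \<open>P x\<close>, and the flux no longer depends on \<open>L\<close>.\<close>
  have flux1: "(frakL (L x) (Rperp ** \<sigma> x) *b E x) $ 1 = - (Rperp *v (h x + e x))" for x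
  proof -
    have "E x $ 1 + (Rperp ** \<sigma> x) *v E x $ 2 = - (P x *v (Rperp *v h x))"
      unfolding E1 E2
      by (simp add: matrix_vector_mul_assoc[symmetric] Q_def F_def matrix_vector_mult_diff_distrib inner_Rperp(4))
    thus ?thesis
      unfolding frakL_apply E2
      by (simp add: matvec_minus_right LP matrix_vector_right_distrib)
  qed
  have symx: "transpose (\<sigma> x) = \<sigma> x" for x using conducting by (auto simp: conducting_composite_def)
  have flux2: "(frakL (L x) (Rperp ** \<sigma> x) *b E x) $ 2 = - (\<sigma> x *v h x) + Q x" for x
  proof -
    have q: "E x $ 1 + (Rperp ** \<sigma> x) *v E x $ 2 = - (P x *v (Rperp *v h x))"
      unfolding E1 E2
      by (simp add: matrix_vector_mul_assoc[symmetric] Q_def F_def matrix_vector_mult_diff_distrib inner_Rperp(4))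
    show ?thesis
      unfolding frakL_apply(2) q unfolding E1 matvec_minus_right LP transpose_Rperp_mult[OF symx] inner_Rperp(4)
      by simp
  qed
  have gE: "l2_grad (\<lambda>x. E x $ i - E0 $ i)" for i
  proof -
    have eq: "Rperp *v (Rperp *v p + - Q x) = - (Rperp *v Q x) - p" for x
      using inner_Rperp(4)[of p] by (simp add: matrix_vector_mult_diff_distrib)
    have "l2_grad (\<lambda>x. Rperp *v (Rperp *v p + - Q x))"
    proof (rule l2_grad_Rperp)
      show "div_free (\<lambda>x. Rperp *v p + - Q x)"
        by (intro div_free_add div_free_const div_free_minus dQ L2_per_const L2_per_minus LQ)
      show "L2_per (\<lambda>x. Rperp *v p + - Q x)" by (intro L2_per_add L2_per_const L2_per_minus LQ)
      show "(\<integral>x. Rperp *v p + - Q x \<partial>cm) = 0" using L2_integrable[OF LQ] Qmean by (simp add: prob_cm)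
    qed
    hence "l2_grad (\<lambda>x. - (Rperp *v Q x) - p)"
      unfolding eq .
    thus ?thesis using e(1) exhaust_2[of i] by (auto simp: E1 E2 p_def q_def)
  qed
  have Lh: "L2_per h" unfolding h_def by (rule K_L2)
  have Lhe: "L2_per (\<lambda>x. h x + e x)" by (intro L2_per_add Lh Le)
  \<comment> \<open>Fluctuations and means are separated: rotated gradients and constants are both
    divergence-free.\<close>
  have "div_free (\<lambda>x. - (Rperp *v ((h x - h0) + (e x - q)) + Rperp *v (h0 + q)))"
    using K_grad[of h0] e(1) unfolding h_def
    by (intro div_free_minus div_free_add div_free_Rperp l2_grad_add div_free_const L2_per_const L2_per_Rperp L2_per_add l2_gradD)
  hence d1: "div_free (\<lambda>x. - (Rperp *v (h x + e x)))"
    by (simp add: matrix_vector_right_distrib matrix_vector_mult_diff_distrib)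
  have d2: "div_free (\<lambda>x. - (\<sigma> x *v h x) + Q x)"
    unfolding h_def by (intro div_free_add div_free_minus K_div dQ L2_per_minus \<sigma>K_L2 LQ)
  have "div_free (\<lambda>x. (frakL (L x) (Rperp ** \<sigma> x) *b E x) $ i)" for i
    using exhaust_2[of i] d1 d2 by (auto simp: flux1 flux2)
  with gE have cell: "cell_field (\<lambda>x. frakL (L x) (Rperp ** \<sigma> x)) E0 E"
    by (simp add: cell_field_iff)
  have LEi: "L2_per (\<lambda>x. E x $ i)" for i by (rule L2_per_shift[OF l2_gradD[OF gE]])
  note ti = tens_integral[OF L2_integrable[OF composite_flux_L2[OF comp LEi]]]
  have i1: "(\<integral>x. - (Rperp *v (h x + e x)) \<partial>cm) = - (Rperp *v (h0 + q))"
    using L2_integrable[OF Lh] L2_integrable[OF Le] l2_grad_shift_mean[OF e(1)] K_mean[of h0]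
    by (simp add: integral_Rperp L2_integrable[OF Lhe] h_def)
  have i2: "(\<integral>x. - (\<sigma> x *v h x) + Q x \<partial>cm) = - (s *v h0) + Rperp *v p"
    using L2_integrable[OF \<sigma>K_L2] L2_integrable[OF LQ] by (simp add: h_def Qmean s_mult)
  \<comment> \<open>The effective counterpart of e1 + M e2 = L^-1 j, for mean fields: the mean of j
    is \<open>- (Rperp *v h0)\<close>.\<close>
  have key: "matrix_inv N *v (p + (Rperp ** s) *v q) = - (Rperp *v h0)"
  proof -
    have "p + (Rperp ** s) *v q = - (N *v (Rperp *v h0))"
      by (simp add: N_mult Sh0 matrix_vector_mult_diff_distrib inner_Rperp(4) matrix_vector_mul_assoc[symmetric])
    thus ?thesis by (simp add: matvec_minus_right matrix_inv_mult(1)[OF N_invertible])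
  qed
  have r1: "(frakL (matrix_inv N) (Rperp ** s) *b E0) $ 1 = - (Rperp *v (h0 + q))"
    unfolding frakL_apply p_def[symmetric] q_def[symmetric] key
    by (simp add: matrix_vector_right_distrib)
  have r2: "(frakL (matrix_inv N) (Rperp ** s) *b E0) $ 2 = - (s *v h0) + Rperp *v p"
    unfolding frakL_apply(2) p_def[symmetric] q_def[symmetric] key
    unfolding matvec_minus_right transpose_Rperp_mult[OF s_sym] inner_Rperp(4) by simp
  have "(\<integral>x. frakL (L x) (Rperp ** \<sigma> x) *b E x \<partial>cm) $ i = (frakL (matrix_inv N) (Rperp ** s) *b E0) $ i" for i
  proof -
    have "(\<integral>x. frakL (L x) (Rperp ** \<sigma> x) *b E x \<partial>cm) $ 1 = (frakL (matrix_inv N) (Rperp ** s) *b E0) $ 1"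
      unfolding ti flux1 i1 r1 ..
    moreover have "(\<integral>x. frakL (L x) (Rperp ** \<sigma> x) *b E x \<partial>cm) $ 2 = (frakL (matrix_inv N) (Rperp ** s) *b E0) $ 2"
      unfolding ti flux2 i2 r2 ..
    ultimately show ?thesis using exhaust_2[of i] by (elim disjE) (simp_all only:)
  qed
  hence "frakL (matrix_inv N) (Rperp ** s) *b E0 = (\<integral>x. frakL (L x) (Rperp ** \<sigma> x) *b E x \<partial>cm)"
    by (subst vec_eq_iff) simp
  with cell show "\<exists>E. cell_field (\<lambda>x. frakL (L x) (Rperp ** \<sigma> x)) E0 E
      \<and> frakL (matrix_inv N) (Rperp ** s) *b E0 = (\<integral>x. frakL (L x) (Rperp ** \<sigma> x) *b E x \<partial>cm)" by blast
qed

text \<open>Duality absorbs the entries of \<open>s\<close> into the fields and turns them into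
  fluxes of \<sigma>. What remains is antisymmetric in two plane vectors, hence a multiple of their
  determinant.\<close>

lemma trace_N:
  assumes tr: "\<And>x. trace (P x ** \<sigma> x) = 2 * w x"
  shows "trace (N ** s) = 2 * (\<integral>x. D x * w x \<partial>cm)" "integrable cm (\<lambda>x. D x * w x)"
proof -
  define k where "k i x = K (axis i 1) x" for i x
  define G where "G i j x = (P x *v (Rperp *v k i x)) \<bullet> (Rperp *v k j x)" for i j x
  have Gi: "integrable cm (G i j)" for i j unfolding G_def k_def using PRK_integrable by simp
  have Sij: "S $ j $ i = (\<integral>x. G i j x \<partial>cm)" for i j
    using S_inner[of "axis i 1" "axis j 1"] unfolding G_def k_def by (simp add: inner_axis matrix_vector_mult_basis column_def)
  \<comment> \<open>Integrand of \<open>trace (N ** s)\<close>: conjugation by the rotation replaces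
    \<open>S\<close> by its cofactors, which can be shifted onto \<open>s\<close>.\<close>
  define T where "T x = s $ 2 $ 2 * G 1 1 x - s $ 1 $ 2 * G 1 2 x - s $ 1 $ 2 * G 2 1 x + s $ 1 $ 1 * G 2 2 x" for x
  have s12: "s $ 2 $ 1 = s $ 1 $ 2" using s_sym by (simp add: sym_nth)
  have Ti: "integrable cm T" unfolding T_def using Gi by simp
  have trT: "trace (N ** s) = (\<integral>x. T x \<partial>cm)"
    unfolding T_def using Gi
    by (simp add: Sij[symmetric] trace_def sum_2 matrix_matrix_mult_def N_def s12 algebra_simps)
  have ae: "AE x in cm. T x = 2 * (D x * w x)"
    using rotated_flux
  proof eventually_elim
    case (elim x)
    have r: "Rperp *v (\<sigma> x *v k i x) = - (s $ 2 $ i) *\<^sub>R k 1 x + s $ 1 $ i *\<^sub>R k 2 x" for i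
      using elim[rule_format, of i] exhaust_2[of i]
      unfolding k_def[symmetric] by (subst (asm) K_split) (auto simp: matvec_nth axis_def k_def)
    have "T x = (P x *v (Rperp *v k 1 x)) \<bullet> (Rperp *v (- (Rperp *v (\<sigma> x *v k 2 x))))
        + (P x *v (Rperp *v k 2 x)) \<bullet> (Rperp *v (Rperp *v (\<sigma> x *v k 1 x)))"
      unfolding r T_def G_def
      by (simp add: matrix_vector_right_distrib matrix_vector_mult_scaleR matrix_vector_mult_diff_distrib inner_add_right inner_diff_right s12 algebra_simps)
    also have "\<dots> = (Rperp *v k 1 x) \<bullet> ((P x ** \<sigma> x) *v k 2 x) - (Rperp *v k 2 x) \<bullet> ((P x ** \<sigma> x) *v k 1 x)"
      by (simp add: matvec_minus_right inner_Rperp(4) P_sym matrix_vector_mul_assoc[symmetric])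
    \<comment> \<open>For any 2x2 matrix \<open>B\<close>, \<open>(Rperp *v u) \<bullet> (B *v v) -
      (Rperp *v v) \<bullet> (B *v u)\<close> is \<open>trace B\<close> times
      \<open>(Rperp *v u) \<bullet> v\<close>.\<close>
    also have "\<dots> = D x * trace (P x ** \<sigma> x)"
      by (simp add: D_def k_def[symmetric] inner_vec2 matvec_nth trace_def sum_2 algebra_simps)
    finally show ?case using tr[of x] by simp
  qed
  have dm: "D \<in> borel_measurable cm" using D_integrable by simp
  have "(\<lambda>x. trace (P x ** \<sigma> x) / 2) = w" using tr by auto
  moreover have "(\<lambda>x. trace (P x ** \<sigma> x) / 2) \<in> borel_measurable cm"
  proof -
    have c: "continuous_on UNIV (\<lambda>(A, B). trace ((A::mat2) ** (B::mat2)) / 2)"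
      unfolding trace_def matrix_matrix_mult_def split_beta by (intro continuous_intros) auto
    have m: "P \<in> borel_measurable cm" "\<sigma> \<in> borel_measurable cm"
      using P_coef \<sigma>_coef by (auto simp: coef_def intro: measurable_restrict_space1)
    show ?thesis
      using borel_measurable_continuous_Pair[OF m, of "\<lambda>A B. trace (A ** B) / 2"] c by (simp add: split_beta)
  qed
  ultimately have wm: "w \<in> borel_measurable cm" by simp
  have m2: "(\<lambda>x. 2 * (D x * w x)) \<in> borel_measurable cm" using dm wm by measurable
  have "integrable cm (\<lambda>x. 2 * (D x * w x))"
    using Ti ae m2 by (subst integrable_cong_AE[symmetric, OF _ m2 ae]) auto
  thus i: "integrable cm (\<lambda>x. D x * w x)" by simp
  have "(\<integral>x. T x \<partial>cm) = (\<integral>x. 2 * (D x * w x) \<partial>cm)"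
    using Ti by (intro integral_cong_AE m2 ae) auto
  with trT show "trace (N ** s) = 2 * (\<integral>x. D x * w x \<partial>cm)" by simp
qed

end

section \<open>The algebraic constraints on the coefficients\<close>

text \<open>The cofactor formula, visibly continuous where the determinant does not vanish;
  \<open>matrix_inv\<close> is defined by choice.\<close>

definition inv2 :: "mat2 \<Rightarrow> mat2"
  where "inv2 A = (1 / det A) *\<^sub>R - (Rperp ** transpose A ** Rperp)"

lemma inv2:
  assumes "det A \<noteq> 0" shows "A *v (inv2 A *v v) = v" "inv2 A *v (A *v v) = v" "matrix_inv A = inv2 A"
proof -
  have e: "inv2 A $ 1 $ 1 = A $ 2 $ 2 / det A" "inv2 A $ 1 $ 2 = - (A $ 1 $ 2 / det A)"
    "inv2 A $ 2 $ 1 = - (A $ 2 $ 1 / det A)" "inv2 A $ 2 $ 2 = A $ 1 $ 1 / det A"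
    by (simp_all add: inv2_def matrix_matrix_mult_def sum_2 transpose_def)
  show 1: "A *v (inv2 A *v v) = v" for v
    using assms by (simp add: vec_eq_iff forall_2 matvec_nth e divide_simps) (simp add: det_2 algebra_simps)
  show 2: "inv2 A *v (A *v v) = v" for v
    using assms by (simp add: vec_eq_iff forall_2 matvec_nth e divide_simps) (simp add: det_2 algebra_simps)
  show "matrix_inv A = inv2 A" by (rule matrix_inv_eqI(1)[OF 1 2])
qed

lemma pos_det:
  assumes "transpose A = (A::mat2)" "\<And>v. v \<noteq> 0 \<Longrightarrow> (A *v v) \<bullet> v > 0" shows "A $ 1 $ 1 > 0" "det A > 0"
proof -
  have s: "A $ 2 $ 1 = A $ 1 $ 2" using assms(1) by (simp add: sym_nth)
  have "(axis 1 1 :: vec2) \<noteq> 0" by (simp add: axis_eq_0_iff)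
  from assms(2)[OF this] show a: "A $ 1 $ 1 > 0" by (simp add: inner_vec2 matvec_nth axis_def)
  let ?v = "vector [- (A $ 1 $ 2), A $ 1 $ 1] :: vec2"
  have "?v \<noteq> 0" using a by (simp add: vec_eq_iff forall_2)
  from assms(2)[OF this] have "A $ 1 $ 1 * det A > 0"
    by (simp add: inner_vec2 matvec_nth det_2 s algebra_simps)
  thus "det A > 0" using a by (simp add: zero_less_mult_iff)
qed

text \<open>A real 2x2 root of minus the identity has trace zero: otherwise \<open>b\<close>
  vanishes and the real square \<open>a * a\<close> would be -1. Trace zero is the symmetry of
  \<sigma>, and a diagonal entry of the square gives its determinant.\<close>

lemma square_neg_one:
  assumes "M ** M = - mat 1" "\<sigma> = - (Rperp ** M)"
  shows "M = Rperp ** \<sigma>" "transpose \<sigma> = \<sigma>" "det \<sigma> = 1"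
proof -
  define a b c d where "a = M $ 1 $ 1" "b = M $ 1 $ 2" "c = M $ 2 $ 1" "d = M $ 2 $ 2"
  note abcd = this[symmetric]
  have 1: "(M ** M) $ i $ j = - mat 1 $ i $ j" for i j using assms(1) by simp
  have e: "a * a + b * c = -1" "a * b + b * d = 0" "c * a + d * c = 0" "c * b + d * d = -1"
    using 1[of 1 1] 1[of 1 2] 1[of 2 1] 1[of 2 2]
    by (simp_all add: matrix_matrix_mult_def sum_2 mat_def abcd)
  have "a + d = 0"
  proof (rule ccontr)
    assume n: "a + d \<noteq> 0"
    have "b * (a + d) = 0" using e by (simp add: algebra_simps)
    hence "b = 0" using n by simp
    hence "a * a = -1" using e by simp
    thus False using zero_le_square[of a] by linarith
  qed
  hence d: "d = - a" by simp
  have se: "\<sigma> $ 1 $ 1 = c" "\<sigma> $ 1 $ 2 = d" "\<sigma> $ 2 $ 1 = - a" "\<sigma> $ 2 $ 2 = - b"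
    by (simp_all add: assms(2) matrix_matrix_mult_def sum_2 abcd)
  show "M = Rperp ** \<sigma>" by (simp add: vec_eq_iff forall_2 matrix_matrix_mult_def sum_2 se abcd)
  show "transpose \<sigma> = \<sigma>" by (simp add: sym_nth se d)
  show "det \<sigma> = 1" using e(1) by (simp add: det_2 se d algebra_simps)
qed

lemma inner_tens: "(E::tens) \<bullet> F = E $ 1 \<bullet> F $ 1 + E $ 2 \<bullet> F $ 2"
  by (simp add: inner_vec_def[of E] sum_2)

lemma frakL_quadratic:
  assumes \<sigma>: "transpose \<sigma> = \<sigma>"
  shows "E \<bullet> (frakL L (Rperp ** \<sigma>) *b E) = (E $ 1 + Rperp *v (\<sigma> *v E $ 2)) \<bullet> (L *v (E $ 1 + Rperp *v (\<sigma> *v E $ 2)))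
    + 2 * (E $ 2 \<bullet> (Rperp *v E $ 1))"
proof -
  define q where "q = E $ 1 + Rperp *v (\<sigma> *v E $ 2)"
  have q: "E $ 1 + (Rperp ** \<sigma>) *v E $ 2 = q" by (simp add: q_def matrix_vector_mul_assoc)
  have "E $ 2 \<bullet> - (\<sigma> *v (Rperp *v (L *v q))) = (Rperp *v (\<sigma> *v E $ 2)) \<bullet> (L *v q)"
    using sym_inner[OF \<sigma>, of "E $ 2" "Rperp *v (L *v q)"] by (simp add: inner_Rperp(1))
  thus ?thesis unfolding inner_tens frakL_apply q transpose_Rperp_mult[OF \<sigma>] q_def[symmetric]
    using inner_Rperp(1)[of "E $ 2" "E $ 1"]
    by (simp add: inner_diff_right inner_add_right q_def inner_add_left) (simp add: inner_commute)
qed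

lemma frakL_symmetric:
  assumes \<sigma>: "transpose \<sigma> = \<sigma>" and L: "transpose L = L"
  shows "(frakL L (Rperp ** \<sigma>) *b E) \<bullet> F = E \<bullet> (frakL L (Rperp ** \<sigma>) *b F)"
proof -
  define q where "q E = E $ 1 + Rperp *v (\<sigma> *v E $ 2)" for E :: tens
  have q: "E $ 1 + (Rperp ** \<sigma>) *v E $ 2 = q E" for E by (simp add: q_def matrix_vector_mul_assoc)
  have m: "- (\<sigma> *v (Rperp *v w)) \<bullet> v = w \<bullet> (Rperp *v (\<sigma> *v v))" for v w
    by (simp add: sym_inner[OF \<sigma>] inner_Rperp(1))
  have *: "(frakL L (Rperp ** \<sigma>) *b E) \<bullet> F = (L *v q E) \<bullet> q F - (Rperp *v E $ 2) \<bullet> F $ 1 + (Rperp *v E $ 1) \<bullet> F $ 2" for E F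
    unfolding inner_tens frakL_apply q transpose_Rperp_mult[OF \<sigma>] inner_add_left inner_diff_left m
    by (simp add: q_def[of F] inner_add_right)
  show ?thesis
    unfolding inner_commute[of E] * using sym_inner[OF L, of "q E" "q F"]
      inner_Rperp(1)[of "E $ 2" "F $ 1"] inner_Rperp(1)[of "E $ 1" "F $ 2"]
    by (simp add: inner_commute)
qed

lemma Sym_pos_block_11:
  assumes "B \<in> Sym_pos" shows "transpose (B $ 1 $ 1) = B $ 1 $ 1" "v \<noteq> 0 \<Longrightarrow> ((B $ 1 $ 1) *v v) \<bullet> v > 0"
    "det (B $ 1 $ 1) > 0"
proof -
  have e: "(axis 1 v :: tens) \<bullet> (B *b axis 1 w) = v \<bullet> ((B $ 1 $ 1) *v w)" for v w
    by (simp add: inner_tens block_apply_nth axis_def)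
  show s: "transpose (B $ 1 $ 1) = B $ 1 $ 1"
  proof (rule symI)
    fix v w
    have "(B *b axis 1 v) \<bullet> axis 1 w = axis 1 v \<bullet> (B *b axis 1 w)" using assms by (simp add: Sym_pos_def)
    thus "((B $ 1 $ 1) *v v) \<bullet> w = v \<bullet> ((B $ 1 $ 1) *v w)"
      using e[of w v] e[of v w] by (simp add: inner_commute)
  qed
  show p: "((B $ 1 $ 1) *v v) \<bullet> v > 0" if "v \<noteq> 0" for v
  proof -
    have "(axis 1 v :: tens) \<noteq> 0" using that by (simp add: axis_eq_0_iff)
    hence "(axis 1 v :: tens) \<bullet> (B *b axis 1 v) > 0" using assms by (auto simp: Sym_pos_def)
    thus ?thesis by (simp add: e inner_commute)
  qed
  show "det (B $ 1 $ 1) > 0" by (rule pos_det(2)[OF s p])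
qed

text \<open>For fixed second component \<open>e\<close>, the form of a symmetric positive
  \<open>L\<close> is smallest where e1 + M e2 is \<open>P *v w\<close> with \<open>w\<close> the
  rotation of \<open>e\<close>. Its value there is exactly the gap in the claimed
  inequality.\<close>

lemma Sym_pos_strict:
  assumes B: "frakL L (Rperp ** \<sigma>) \<in> Sym_pos" and \<sigma>: "transpose \<sigma> = \<sigma>" and P: "\<And>v. L *v (P *v v) = v"
    and w: "w \<noteq> 0"
  shows "(P *v w) \<bullet> w < 2 * ((\<sigma> *v (Rperp *v w)) \<bullet> (Rperp *v w))"
proof -
  define e where "e = - (Rperp *v w)"
  have Re: "Rperp *v e = w" by (simp add: e_def matvec_minus_right inner_Rperp(4))
  define E :: tens where "E = vector [P *v w - Rperp *v (\<sigma> *v e), e]"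
  have "e \<noteq> 0" using w Re by auto
  hence "E \<noteq> 0" by (auto simp: E_def vec_eq_iff[of _ "0::tens"] forall_2)
  hence "0 < E \<bullet> (frakL L (Rperp ** \<sigma>) *b E)" using B by (simp add: Sym_pos_def)
  also have "\<dots> = (P *v w) \<bullet> w + 2 * (e \<bullet> (Rperp *v (P *v w) + \<sigma> *v e))"
    unfolding frakL_quadratic[OF \<sigma>]
    by (simp add: E_def P matrix_vector_mult_diff_distrib inner_Rperp(4))
  also have "e \<bullet> (Rperp *v (P *v w)) = - ((P *v w) \<bullet> w)"
    using inner_Rperp(1)[of e "P *v w"] Re by (simp add: inner_commute)
  hence "e \<bullet> (Rperp *v (P *v w) + \<sigma> *v e) = - ((P *v w) \<bullet> w) + e \<bullet> (\<sigma> *v e)"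
    by (simp add: inner_add_right)
  finally show ?thesis by (simp add: e_def matvec_minus_right inner_commute)
qed

text \<open>A multiple of \<sigma> splits into two rank-one matrices, so \<open>a\<close> times the
  trace is the form of \<open>P\<close> at two vectors. At each of them the bound in
  \<open>less\<close> equals \<open>2 * a\<close>, whence the constant 4.\<close>

lemma trace_bounds:
  assumes \<sigma>: "transpose \<sigma> = \<sigma>" "det \<sigma> = 1" "\<And>v. v \<noteq> 0 \<Longrightarrow> (\<sigma> *v v) \<bullet> v > 0"
    and P: "transpose P = P" "\<And>v. v \<noteq> 0 \<Longrightarrow> (P *v v) \<bullet> v > 0"
    and less: "\<And>v. v \<noteq> 0 \<Longrightarrow> (P *v v) \<bullet> v < 2 * ((\<sigma> *v (Rperp *v v)) \<bullet> (Rperp *v v))"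
  shows "0 < trace (P ** \<sigma>)" "trace (P ** \<sigma>) < 4"
proof -
  obtain a b c where A: "\<sigma> $ 1 $ 1 = a" "\<sigma> $ 1 $ 2 = b" "\<sigma> $ 2 $ 1 = b" "\<sigma> $ 2 $ 2 = c"
    using \<sigma>(1) by (auto simp: sym_nth)
  have a: "a > 0" using pos_det(1)[OF \<sigma>(1,3)] by (simp add: A)
  have d: "a * c = 1 + b * b" using \<sigma>(2) by (simp add: det_2 A)
  \<comment> \<open>\<open>a \<sigma> = u u\<^sup>T + v v\<^sup>T\<close>\<close>
  define u v :: vec2 where "u = vector [a, b]" and "v = vector [0, 1]"
  have nz: "u \<noteq> 0" "v \<noteq> 0" using a by (auto simp: u_def v_def vec_eq_iff forall_2)
  have tr: "a * trace (P ** \<sigma>) = (P *v u) \<bullet> u + (P *v v) \<bullet> v"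
  proof -
    have "a * trace (P ** \<sigma>) = a * (P $ 1 $ 1 * a) + a * (P $ 1 $ 2 * b) + a * (P $ 2 $ 1 * b) + P $ 2 $ 2 * (a * c)"
      by (simp add: trace_def sum_2 matrix_matrix_mult_def A algebra_simps)
    thus ?thesis unfolding d by (simp add: u_def v_def inner_vec2 matvec_nth algebra_simps)
  qed
  have "(\<sigma> *v (Rperp *v u)) \<bullet> (Rperp *v u) = a * (a * c) - a * (b * b)"
    by (simp add: u_def inner_vec2 matvec_nth A algebra_simps)
  hence qu: "(\<sigma> *v (Rperp *v u)) \<bullet> (Rperp *v u) = a" unfolding d by (simp add: algebra_simps)
  have qv: "(\<sigma> *v (Rperp *v v)) \<bullet> (Rperp *v v) = a"
    by (simp add: v_def inner_vec2 matvec_nth A)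
  have "a * trace (P ** \<sigma>) > 0" using P(2)[OF nz(1)] P(2)[OF nz(2)] tr by linarith
  thus "0 < trace (P ** \<sigma>)" using a by (simp add: zero_less_mult_iff)
  have "a * trace (P ** \<sigma>) < a * 4" using less[OF nz(1)] less[OF nz(2)] tr qu qv by linarith
  thus "trace (P ** \<sigma>) < 4" using a by simp
qed

text \<open>The threshold 1/2 is where the coefficient \<open>2 - 1 / \<mu>\<close>, left after
  completing the square, becomes positive.\<close>

lemma frakL_isotropic_Sym_pos:
  assumes \<sigma>: "transpose \<sigma> = \<sigma>" "det \<sigma> = 1" "\<And>v. v \<noteq> 0 \<Longrightarrow> (\<sigma> *v v) \<bullet> v > 0" and \<mu>: "\<mu> > 1/2"
  shows "frakL (\<mu> *\<^sub>R \<sigma>) (Rperp ** \<sigma>) \<in> Sym_pos"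
proof -
  have pos: "E \<bullet> (frakL (\<mu> *\<^sub>R \<sigma>) (Rperp ** \<sigma>) *b E) > 0" if E: "E \<noteq> 0" for E
  proof -
    define e q where "e = E $ 2" and "q = E $ 1 + Rperp *v (\<sigma> *v e)"
    define z where "z = Rperp *v (\<sigma> *v e)"
    have z: "\<sigma> *v z = Rperp *v e" unfolding z_def by (rule sym_det_1_Rperp[OF \<sigma>(1,2)])
    \<comment> \<open>completes the square in \<open>q\<close>\<close>
    define r where "r = q - (1 / \<mu>) *\<^sub>R z"
    have E1: "E $ 1 = q - Rperp *v (\<sigma> *v e)" by (simp add: q_def)
    have zz: "(\<sigma> *v z) \<bullet> z = (\<sigma> *v e) \<bullet> e" unfolding z unfolding z_def by (simp add: inner_Rperp(2) inner_commute)
    have zq: "(\<sigma> *v z) \<bullet> q = - (e \<bullet> (Rperp *v q))" unfolding z by (rule inner_Rperp(1))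
    have qz: "(\<sigma> *v q) \<bullet> z = (\<sigma> *v z) \<bullet> q" using sym_inner[OF \<sigma>(1), of q z] by (simp add: inner_commute)
    have "E \<bullet> (frakL (\<mu> *\<^sub>R \<sigma>) (Rperp ** \<sigma>) *b E) = \<mu> * ((\<sigma> *v q) \<bullet> q) + 2 * (e \<bullet> (Rperp *v q)) + 2 * ((\<sigma> *v e) \<bullet> e)"
      unfolding frakL_quadratic[OF \<sigma>(1)] e_def[symmetric] q_def[symmetric] E1
      by (simp add: matrix_vector_mult_diff_distrib inner_Rperp(4) inner_diff_right inner_add_right
          scaleR_matrix_vector_assoc[symmetric] inner_commute algebra_simps)
    also have "\<dots> = \<mu> * ((\<sigma> *v r) \<bullet> r) + (2 - 1 / \<mu>) * ((\<sigma> *v e) \<bullet> e)"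
      unfolding r_def using \<mu>
      by (simp add: matrix_vector_mult_diff_distrib matrix_vector_mult_scaleR inner_diff_left inner_diff_right zz zq qz field_simps)
    also have "\<dots> > 0"
    proof (cases "e = 0")
      case True
      hence "r = E $ 1" by (simp add: r_def q_def z_def)
      moreover have "E $ 1 \<noteq> 0" using E True by (auto simp: e_def vec_eq_iff[of E] forall_2)
      ultimately have "(\<sigma> *v r) \<bullet> r > 0" using \<sigma>(3) by simp
      thus ?thesis using True \<mu> by simp
    next
      case False
      have "(2 - 1 / \<mu>) * ((\<sigma> *v e) \<bullet> e) > 0" using \<mu> \<sigma>(3)[OF False] by (intro mult_pos_pos) (auto simp: field_simps)
      moreover have "\<mu> * ((\<sigma> *v r) \<bullet> r) \<ge> 0" using \<mu> \<sigma>(3)[of r] by (cases "r = 0") (auto simp: less_imp_le)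
      ultimately show ?thesis by linarith
    qed
    finally show ?thesis .
  qed
  have "transpose (\<mu> *\<^sub>R \<sigma>) = \<mu> *\<^sub>R \<sigma>" using \<sigma>(1) by (simp add: sym_nth)
  from frakL_symmetric[OF \<sigma>(1) this] pos show ?thesis by (auto simp: Sym_pos_def)
qed

text \<open>By Cayley-Hamilton and determinant 1, the trace times \<sigma> is the identity plus the
  square of \<sigma>, so the upper bound on \<sigma> yields a uniform lower bound.\<close>

lemma conductor_of_coef:
  assumes c: "coef \<sigma>" and \<sigma>: "\<And>x. transpose (\<sigma> x) = \<sigma> x" "\<And>x. det (\<sigma> x) = 1" "\<And>x v. v \<noteq> 0 \<Longrightarrow> (\<sigma> x *v v) \<bullet> v > 0"
  shows "conducting_composite \<sigma>"
proof -
  obtain C where C: "\<And>x. norm (\<sigma> x) \<le> C" using c by (auto simp: coef_def bounded_iff)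
  have ent: "\<sigma> x $ i $ j \<le> C" for x i j
  proof -
    have "\<bar>\<sigma> x $ i $ j\<bar> \<le> norm (\<sigma> x)"
      using component_le_norm_cart[of "\<sigma> x $ i" j] Finite_Cartesian_Product.norm_nth_le[of "\<sigma> x" i] by linarith
    thus ?thesis using C[of x] by linarith
  qed
  \<comment> \<open>Any point of the plane shows that the bound is positive, since a diagonal entry
    is.\<close>
  have C0: "C > 0" using pos_det(1)[OF \<sigma>(1,3)] ent[of undefined 1 1] by (meson less_le_trans)
  have "v \<bullet> (\<sigma> x *v v) \<ge> (1 / (2 * C)) * (norm v)\<^sup>2" for x v
  proof -
    obtain p q r where A: "\<sigma> x $ 1 $ 1 = p" "\<sigma> x $ 1 $ 2 = q" "\<sigma> x $ 2 $ 1 = q" "\<sigma> x $ 2 $ 2 = r"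
      using \<sigma>(1)[of x] by (auto simp: sym_nth)
    have d: "p * r - q * q = 1" using \<sigma>(2)[of x] by (simp add: det_2 A)
    have "(p + r) * (v \<bullet> (\<sigma> x *v v)) = (v \<bullet> v) * (p * r - q * q) + (\<sigma> x *v v) \<bullet> (\<sigma> x *v v)"
      by (simp add: inner_vec2 matvec_nth A algebra_simps)
    hence "(p + r) * (v \<bullet> (\<sigma> x *v v)) \<ge> v \<bullet> v" unfolding d by simp
    moreover have "(p + r) * (v \<bullet> (\<sigma> x *v v)) \<le> 2 * C * (v \<bullet> (\<sigma> x *v v))"
    proof (rule mult_right_mono)
      show "p + r \<le> 2 * C" using ent[of x 1 1] ent[of x 2 2] by (simp add: A)
      show "0 \<le> v \<bullet> (\<sigma> x *v v)" using \<sigma>(3)[of v x] by (cases "v = 0") (auto simp: inner_commute less_imp_le)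
    qed
    ultimately have "v \<bullet> v \<le> 2 * C * (v \<bullet> (\<sigma> x *v v))" by linarith
    thus ?thesis using C0 by (simp add: power2_norm_eq_inner field_simps)
  qed
  moreover have "1 / (2 * C) > 0" using C0 by simp
  ultimately show ?thesis using c \<sigma>(1) unfolding conducting_composite_def coef_def by blast
qed

section \<open>Effective tensors with values in M19 and M7\<close>

text \<open>Continuity is asked for on \<open>C\<close> only, because \<open>f\<close> will involve
  inverses and reciprocals of traces; compactness of \<open>C\<close> then gives
  boundedness.\<close>

lemma coef_compose:
  assumes A: "periodic A" "A \<in> borel_measurable lebesgue" "range A \<subseteq> C" and C: "compact C" and f: "continuous_on C f"
  shows "coef (\<lambda>x. f (A x))"
proof -
  have "A \<in> lebesgue \<rightarrow>\<^sub>M restrict_space borel C"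
    by (rule measurable_restrict_space2) (use A in auto)
  from measurable_compose[OF this borel_measurable_continuous_on_restrict[OF f]]
  have "(\<lambda>x. f (A x)) \<in> borel_measurable lebesgue" .
  moreover have "bounded (f ` C)" using C f compact_continuous_image compact_imp_bounded by blast
  hence "bounded (range (\<lambda>x. f (A x)))" by (rule bounded_subset) (use A(3) in auto)
  ultimately show ?thesis using A(1) by (auto simp: coef_def periodic_def)
qed

lemma continuous_on_matrix_mult [continuous_intros]:
  "continuous_on T f \<Longrightarrow> continuous_on T g \<Longrightarrow> continuous_on T (\<lambda>x. (f x :: mat2) ** (g x :: mat2))"
  unfolding matrix_matrix_mult_def by (intro continuous_intros)

lemma continuous_on_transpose [continuous_intros]:
  "continuous_on T f \<Longrightarrow> continuous_on T (\<lambda>x. transpose (f x :: mat2))"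
  unfolding transpose_def by (intro continuous_intros)

lemma continuous_on_inv2:
  assumes "continuous_on T f" "\<And>x. x \<in> T \<Longrightarrow> det (f x) \<noteq> 0" shows "continuous_on T (\<lambda>x. inv2 (f x))"
  unfolding inv2_def det_2 using assms(2)[unfolded det_2] by (intro continuous_intros assms(1)) auto

lemma continuous_on_frakL:
  assumes "continuous_on T f" "continuous_on T g" shows "continuous_on T (\<lambda>x. frakL (f x) (g x))"
proof -
  have "continuous_on T (\<lambda>x. frakL (f x) (g x) $ i $ j)" for i j
    using exhaust_2[of i] exhaust_2[of j]
    by (elim disjE) (simp_all add: frakL_nth, (intro continuous_intros assms)+)
  hence "continuous_on T (\<lambda>x. \<chi> i j. frakL (f x) (g x) $ i $ j)" by (intro continuous_on_vec_lambda)
  thus ?thesis by simp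
qed

section \<open>Symmetry of the effective \<open>L\<close> and membership in
  \<open>M19\<close>\<close>

context tensor_composite
begin

lemma effective_tensor_eq:
  "effective_tensor (\<lambda>x. frakL (L x) (Rperp ** \<sigma> x)) = frakL (matrix_inv N) (Rperp ** s)"
  by (rule effective_tensor_eqI[OF comp effective])

lemma N_inv_inv: "matrix_inv (matrix_inv N) = N"
  by (rule matrix_inv_eqI) (simp_all add: matrix_inv_mult N_invertible)

lemma N_inv_sym: "transpose (matrix_inv N) = matrix_inv N"
proof (rule symI)
  fix v w
  show "(matrix_inv N *v v) \<bullet> w = v \<bullet> (matrix_inv N *v w)"
    using sym_inner[OF N_sym, of "matrix_inv N *v v" "matrix_inv N *v w"]
    by (simp add: matrix_inv_mult N_invertible)
qed

lemma effective_M19: "frakL (matrix_inv N) (Rperp ** s) \<in> M19"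
proof -
  have "(Rperp ** s) ** (Rperp ** s) = - mat 1"
    by (simp add: matrix_eq matrix_vector_mul_assoc[symmetric] s_Rperp inner_Rperp(4) matvec_minus_left)
  moreover have "pos_def (matrix_inv N)"
    unfolding pos_def_def
  proof (intro allI impI)
    fix v :: vec2 assume "v \<noteq> 0"
    hence "matrix_inv N *v v \<noteq> 0" using matrix_inv_mult(2)[OF N_invertible, of v] by auto
    from N_pos[OF this] show "0 < v \<bullet> (matrix_inv N *v v)" by (simp add: matrix_inv_mult N_invertible)
  qed
  moreover have "neg_def (matrix_inv (matrix_inv N) + 2 *\<^sub>R (Rperp ** s ** Rperp))"
    unfolding neg_def_def N_inv_inv
  proof (intro allI impI)
    fix v :: vec2 assume "v \<noteq> 0"
    from N_less[OF this] show "v \<bullet> ((N + 2 *\<^sub>R (Rperp ** s ** Rperp)) *v v) < 0"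
      using inner_Rperp(1)[of v "s *v (Rperp *v v)"]
      by (simp add: matrix_vector_mult_add_rdistrib inner_add_right scaleR_matrix_vector_assoc[symmetric]
          matrix_vector_mul_assoc[symmetric] inner_commute)
  qed
  ultimately show ?thesis unfolding M19_def using N_inv_sym by blast
qed

end

theorem mainTheorem4:
  fixes L M \<sigma> :: "real^2 \<Rightarrow> real^2^2" and \<mu> :: "real^2 \<Rightarrow> real"
  assumes "composite (\<lambda>x. frakL (L x) (M x))"
    and "\<And>x. frakL (L x) (M x) \<in> M19"
    and "\<And>x. transpose (L x) = L x"
    and "\<And>x. \<sigma> x = - (Rperp ** M x)"
    and "\<And>x. \<mu> x = 2 / trace (matrix_inv (L x) ** \<sigma> x)"
  shows "conducting_composite \<sigma>
    \<and> composite (\<lambda>x. frakL (\<mu> x *\<^sub>R \<sigma> x) (Rperp ** \<sigma> x))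
    \<and> (\<forall>x. frakL (\<mu> x *\<^sub>R \<sigma> x) (Rperp ** \<sigma> x) \<in> M7)
    \<and> (\<exists>L' M' \<mu>' \<sigma>'.
          effective_tensor (\<lambda>x. frakL (L x) (M x)) = frakL L' M'
        \<and> transpose L' = L'
        \<and> frakL L' M' \<in> M19
        \<and> \<sigma>' = effective_conductivity \<sigma>
        \<and> effective_tensor (\<lambda>x. frakL (\<mu> x *\<^sub>R \<sigma> x) (Rperp ** \<sigma> x))
            = frakL (\<mu>' *\<^sub>R \<sigma>') (Rperp ** \<sigma>')
        \<and> frakL (\<mu>' *\<^sub>R \<sigma>') (Rperp ** \<sigma>') \<in> M7
        \<and> M' = Rperp ** \<sigma>'
        \<and> trace (matrix_inv L' ** \<sigma>') = 2 / \<mu>')"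
proof -
  define A where "A x = frakL (L x) (M x)" for x
  define P where "P x = inv2 (L x)" for x
  obtain C where C: "compact C" "C \<subseteq> Sym_pos" "range A \<subseteq> C" and A: "periodic A" "A \<in> borel_measurable lebesgue"
    using assms(1) by (auto simp: composite_def A_def[abs_def])
  have A11: "A x $ 1 $ 1 = L x" for x by (simp add: A_def frakL_nth)
  have ASym: "A x \<in> Sym_pos" for x using C by auto
  have Ldet: "det (L x) > 0" for x using Sym_pos_block_11(3)[OF ASym] by (simp add: A11)
  have Lnz: "det (L x) \<noteq> 0" for x using Ldet[of x] by simp
  note LP = inv2[OF Lnz, folded P_def]
  have M2: "M x ** M x = - mat 1" for x
  proof -
    from assms(2)[of x] obtain L0 M0 where eq: "frakL (L x) (M x) = frakL L0 M0" and "M0 ** M0 = - mat 1"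
      by (auto simp: M19_def)
    \<comment> \<open>\<open>M19\<close> merely provides some representing pair; invertibility of
      \<open>L x\<close> makes the pair unique.\<close>
    moreover have "M x = M0"
    proof -
      have "L x = L0" "L x ** M x - Rperp = L0 ** M0 - Rperp"
        using arg_cong[OF eq, of "\<lambda>B. B $ 1 $ 1"] arg_cong[OF eq, of "\<lambda>B. B $ 1 $ 2"] by (simp_all add: frakL_nth)
      hence "L x ** M x = L x ** M0" by simp
      hence "L x *v (M x *v v) = L x *v (M0 *v v)" for v by (simp add: matrix_vector_mul_assoc)
      hence "M x *v v = M0 *v v" for v by (metis LP(2))
      thus ?thesis by (simp add: matrix_eq)
    qed
    ultimately show ?thesis by simp
  qed

  \<comment> \<open>The coefficients as functions of the tensor value, so that periodicity,
    measurability and boundedness pass through composition with \<open>A\<close>.\<close>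
  define l where "l B = B $ 1 $ 1" for B :: block
  define m where "m B = inv2 (l B) ** (B $ 1 $ 2 + Rperp)" for B
  define sg where "sg B = - (Rperp ** m B)" for B
  define mu where "mu B = 2 / trace (inv2 (l B) ** sg B)" for B
  \<comment> \<open>\<open>M ** M = - mat 1\<close> is a closed condition, and on it positivity of the tensor already implies
    the strict inequality in \<open>M19\<close>. So \<open>\<mu>\<close> stays away from 1/2 on the compact set \<open>C0\<close>.\<close>
  define C0 where "C0 = {B \<in> C. (m B ** m B, frakL (l B) (m B) - B) = (- mat 1, 0)}"
  have ldet: "det (l B) \<noteq> 0" if "B \<in> C" for B
    using Sym_pos_block_11(3)[of B] C(2) that by (auto simp: l_def)
  have lc: "continuous_on T l" for T unfolding l_def[abs_def] by (intro continuous_intros)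
  have invc: "continuous_on C (\<lambda>B. inv2 (l B))" by (intro continuous_on_inv2 lc ldet)
  have mc: "continuous_on C m" unfolding m_def[abs_def] by (intro continuous_intros invc)
  have sc: "continuous_on C sg" unfolding sg_def[abs_def] by (intro continuous_intros mc)
  have C0C: "C0 \<subseteq> C" by (auto simp: C0_def)
  have "closed C0"
    unfolding C0_def
    by (intro continuous_closed_preimage_constant continuous_intros continuous_on_frakL mc lc compact_imp_closed C)
  hence C0: "compact C0" using C(1) C0C compact_Int_closed[of C C0] by (simp add: inf.absorb2)

  have props: "transpose (sg B) = sg B" "det (sg B) = 1" "\<And>v. v \<noteq> 0 \<Longrightarrow> (sg B *v v) \<bullet> v > 0"
    "transpose (inv2 (l B)) = inv2 (l B)" "\<And>v. v \<noteq> 0 \<Longrightarrow> (inv2 (l B) *v v) \<bullet> v > 0"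
    "\<And>v. v \<noteq> 0 \<Longrightarrow> (inv2 (l B) *v v) \<bullet> v < 2 * ((sg B *v (Rperp *v v)) \<bullet> (Rperp *v v))"
    "0 < trace (inv2 (l B) ** sg B)" "trace (inv2 (l B) ** sg B) < 4"
    if B: "B \<in> C0" for B
  proof -
    have BS: "B \<in> Sym_pos" and Beq: "frakL (l B) (m B) = B" and mm: "m B ** m B = - mat 1"
      using B C(2) by (auto simp: C0_def)
    note sq = square_neg_one[OF mm sg_def]
    show s: "transpose (sg B) = sg B" and d: "det (sg B) = 1" by (rule sq)+
    have BC: "B \<in> C" using B C0C by blast
    note inv = inv2[OF ldet[OF BC]]
    have ls: "transpose (l B) = l B" and lp: "\<And>v. v \<noteq> 0 \<Longrightarrow> (l B *v v) \<bullet> v > 0"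
      using Sym_pos_block_11[OF BS] by (auto simp: l_def)
    show isym: "transpose (inv2 (l B)) = inv2 (l B)"
    proof (rule symI)
      fix v w
      show "(inv2 (l B) *v v) \<bullet> w = v \<bullet> (inv2 (l B) *v w)"
        using sym_inner[OF ls, of "inv2 (l B) *v v" "inv2 (l B) *v w"] by (simp add: inv)
    qed
    show ip: "(inv2 (l B) *v v) \<bullet> v > 0" if "v \<noteq> 0" for v
    proof -
      have "inv2 (l B) *v v \<noteq> 0" using that inv(1)[of v] by auto
      from lp[OF this] show ?thesis by (simp add: inv inner_commute)
    qed
    show less: "(inv2 (l B) *v v) \<bullet> v < 2 * ((sg B *v (Rperp *v v)) \<bullet> (Rperp *v v))" if "v \<noteq> 0" for v
      by (rule Sym_pos_strict[of "l B", OF _ s inv(1) that]) (use BS Beq sq(1) in simp)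
    \<comment> \<open>The rotated form of \<sigma> lies above half of the positive form of
      \<open>inv2 (l B)\<close>, hence is positive as well.\<close>
    show sp: "(sg B *v v) \<bullet> v > 0" if v: "v \<noteq> 0" for v
    proof -
      have "Rperp *v v \<noteq> 0" using v inner_Rperp(2)[of v v] by auto
      from ip[OF this] less[OF this] show ?thesis by (simp add: inner_Rperp(4) matvec_minus_right)
    qed
    show "0 < trace (inv2 (l B) ** sg B)" "trace (inv2 (l B) ** sg B) < 4"
      using trace_bounds[OF s d sp isym ip less] by blast+
  qed

  have mA: "m (A x) = M x" for x
  proof -
    have "m (A x) = P x ** (L x ** M x)" by (simp add: m_def l_def A11 P_def) (simp add: A_def frakL_nth)
    thus ?thesis by (simp add: matrix_eq matrix_vector_mul_assoc[symmetric] LP)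
  qed
  have lA: "l (A x) = L x" for x by (simp add: l_def A11)
  have sA: "sg (A x) = \<sigma> x" for x by (simp add: sg_def mA assms(4))
  have PA: "inv2 (l (A x)) = P x" for x by (simp add: lA P_def)
  have AC0: "A x \<in> C0" for x using C(3) M2[of x] by (auto simp: C0_def mA lA A_def[symmetric])
  hence rA: "range A \<subseteq> C0" by auto
  note props' = props[OF AC0, unfolded sA PA]
  \<comment> \<open>The reciprocal of \<mu>: the trace is linear in \<open>P\<close>, so it is
    \<open>w\<close> rather than \<mu> that averages.\<close>
  define w where "w x = trace (P x ** \<sigma> x) / 2" for x
  have w: "0 < w x" "w x < 2" for x using props'(7,8)[of x] by (simp_all add: w_def)
  have muA: "mu (A x) = \<mu> x" and \<mu>w: "\<mu> x = 1 / w x" for x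
    unfolding mu_def PA sA assms(5) LP(3) w_def by simp_all
  have \<mu>: "\<mu> x > 1/2" for x using w[of x] by (simp add: \<mu>w field_simps)
  have MR: "M x = Rperp ** \<sigma> x" for x by (rule square_neg_one(1)[OF M2 assms(4)])

  have "coef (\<lambda>x. sg (A x))" by (rule coef_compose[OF A rA C0 continuous_on_subset[OF sc C0C]])
  hence cond: "conducting_composite \<sigma>"
    unfolding sA by (rule conductor_of_coef) (rule props')+
  have Pc: "coef P"
    using coef_compose[OF A rA C0 continuous_on_subset[OF invc C0C]] unfolding PA .
  have trc: "continuous_on C0 (\<lambda>B. trace (inv2 (l B) ** sg B))"
    unfolding trace_def
    by (intro continuous_intros continuous_on_subset[OF sc C0C] continuous_on_subset[OF invc C0C])
  have muc: "continuous_on C0 mu"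
    unfolding mu_def[abs_def] by (intro continuous_intros trc) (auto dest!: props(7))
  define F where "F B = frakL (mu B *\<^sub>R sg B) (Rperp ** sg B)" for B
  have Fc: "continuous_on C0 F" unfolding F_def[abs_def]
    by (intro continuous_on_frakL continuous_intros muc continuous_on_subset[OF sc C0C])
  have FS: "F B \<in> Sym_pos" if B: "B \<in> C0" for B
    unfolding F_def
  proof (rule frakL_isotropic_Sym_pos[OF props(1,2,3)[OF B]])
    show "1/2 < mu B" using props(7,8)[OF B] by (simp add: mu_def field_simps)
  qed
  have FA: "F (A x) = frakL (\<mu> x *\<^sub>R \<sigma> x) (Rperp ** \<sigma> x)" for x by (simp add: F_def muA sA)
  have comp2: "composite (\<lambda>x. frakL (\<mu> x *\<^sub>R \<sigma> x) (Rperp ** \<sigma> x))"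
    unfolding composite_def FA[symmetric]
  proof (intro conjI exI[of _ "F ` C0"])
    have "coef (\<lambda>x. F (A x))" by (rule coef_compose[OF A rA C0 Fc])
    thus "periodic (\<lambda>x. F (A x))" "(\<lambda>x. F (A x)) \<in> borel_measurable lebesgue" by (auto simp: coef_def)
    show "compact (F ` C0)" by (rule compact_continuous_image[OF Fc C0])
  qed (use FS rA in auto)
  have pd: "pos_def T" if "\<And>v. v \<noteq> 0 \<Longrightarrow> (T *v v) \<bullet> v > 0" for T
    using that by (auto simp: pos_def_def inner_commute)
  have inM7: "frakL (\<mu> x *\<^sub>R \<sigma> x) (Rperp ** \<sigma> x) \<in> M7" for x
    unfolding M7_def using props'(1,2)[of x] pd[OF props'(3)] \<mu>[of x] by blast

  interpret I: tensor_composite \<sigma> L P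
  proof
    show "composite (\<lambda>x. frakL (L x) (Rperp ** \<sigma> x))" using assms(1) by (simp add: MR)
    show "(P x *v v) \<bullet> u = v \<bullet> (P x *v u)" for x v u by (rule sym_inner[OF props'(4)])
  qed (use cond Pc LP props' in auto)

  \<comment> \<open>The inverse of \<open>\<mu> x *\<^sub>R \<sigma> x\<close>, since a symmetric
    matrix of determinant 1 is inverted by conjugation with the rotation.\<close>
  define P7 where "P7 x = w x *\<^sub>R - (Rperp ** \<sigma> x ** Rperp)" for x
  have P7_inner: "(P7 x *v v) \<bullet> u = w x * ((\<sigma> x *v (Rperp *v v)) \<bullet> (Rperp *v u))" for x v u
    unfolding P7_def scaleR_matrix_vector_assoc[symmetric] inner_scaleR_left I.PR_inner ..
  have Rnz: "Rperp *v v \<noteq> 0" if "v \<noteq> 0" for v using that inner_Rperp(2)[of v v] by auto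
  \<comment> \<open>Both interpretations share \<sigma>, hence the fields \<open>K\<close>, the
    determinant \<open>D\<close> and the matrix \<open>s\<close>; only \<open>L\<close> and its
    inverse differ.\<close>
  interpret J: tensor_composite \<sigma> "\<lambda>x. \<mu> x *\<^sub>R \<sigma> x" P7
  proof
    show "composite (\<lambda>x. frakL (\<mu> x *\<^sub>R \<sigma> x) (Rperp ** \<sigma> x))" by (rule comp2)
    have "continuous_on C0 (\<lambda>B. (trace (inv2 (l B) ** sg B) / 2) *\<^sub>R - (Rperp ** sg B ** Rperp))"
      by (intro continuous_intros trc continuous_on_subset[OF sc C0C]) simp
    from coef_compose[OF A rA C0 this] show "coef P7" by (simp add: P7_def[abs_def] w_def PA sA)
    fix x and v u :: vec2
    show "(\<mu> x *\<^sub>R \<sigma> x) *v (P7 x *v v) = v"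
      using w(1)[of x] by (simp add: P7_def \<mu>w scaleR_matrix_vector_assoc[symmetric] matrix_vector_mult_scaleR matvec_minus_left matvec_minus_right
         matrix_vector_mul_assoc[symmetric] I.\<sigma>_Rperp inner_Rperp(4))
    show "(P7 x *v v) \<bullet> u = v \<bullet> (P7 x *v u)"
      unfolding inner_commute[of v] P7_inner
      using I.\<sigma>_sym[of x "Rperp *v v" "Rperp *v u"] by (simp add: inner_commute)
    show "v \<noteq> 0 \<Longrightarrow> 0 < (P7 x *v v) \<bullet> v"
      unfolding P7_inner using w(1)[of x] props'(3)[OF Rnz] by simp
    show "v \<noteq> 0 \<Longrightarrow> (P7 x *v v) \<bullet> v < 2 * ((\<sigma> x *v (Rperp *v v)) \<bullet> (Rperp *v v))"
      unfolding P7_inner using w(2)[of x] props'(3)[OF Rnz] by simp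
  qed

  have "trace (P x ** \<sigma> x) = 2 * w x" for x by (simp add: w_def)
  note tr = I.trace_N[OF this]
  \<comment> \<open>The reciprocal of \<open>\<mu>'\<close>: the mean of \<open>w\<close> with
    \<open>D\<close> as probability density.\<close>
  define \<tau> where "\<tau> = (\<integral>x. I.D x * w x \<partial>cm)"
  have \<tau>0: "\<tau> > 0" unfolding \<tau>_def by (rule I.integral_D_mult[OF tr(2) w(1)])
  have \<tau>2: "\<tau> < 2"
  proof -
    have i: "integrable cm (\<lambda>x. I.D x * (2 - w x))"
      using tr(2) I.D_integrable by (simp add: right_diff_distrib)
    have "0 < (\<integral>x. I.D x * (2 - w x) \<partial>cm)" by (rule I.integral_D_mult[OF i]) (use w(2) in simp)
    also have "\<dots> = 2 - \<tau>" using tr(2) I.D_integrable by (simp add: right_diff_distrib I.integral_D \<tau>_def)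
    finally show ?thesis by simp
  qed
  \<comment> \<open>On rotated fields the form of \<open>P7\<close> is \<open>w\<close> times that
    of \<sigma> on the fields, which \<open>K_\<sigma>_K\<close> makes proportional to the constant
    form \<open>s\<close> at almost every point.\<close>
  have JS: "(J.S *v c) \<bullet> d = \<tau> * ((I.s *v c) \<bullet> d)" for c d
  proof -
    have "(J.S *v c) \<bullet> d = (\<integral>x. I.D x * w x * ((I.s *v c) \<bullet> d) \<partial>cm)"
      unfolding J.S_inner
    proof (rule integral_cong_AE)
      show "AE x in cm. (P7 x *v (Rperp *v I.K c x)) \<bullet> (Rperp *v I.K d x) = I.D x * w x * ((I.s *v c) \<bullet> d)"
        using I.K_\<sigma>_K
      proof eventually_elim
        case (elim x)
        thus ?case unfolding P7_inner by (simp add: inner_Rperp(4) matvec_minus_right)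
      qed
    qed (use J.PRK_integrable tr(2) in auto)
    thus ?thesis by (simp add: \<tau>_def)
  qed
  have JSv: "J.S *v c = \<tau> *\<^sub>R (I.s *v c)" for c
  proof -
    have "(J.S *v c) \<bullet> d = (\<tau> *\<^sub>R (I.s *v c)) \<bullet> d" for d by (simp add: JS)
    thus ?thesis using vector_eq_rdot by blast
  qed
  have JN: "J.N *v v = - (\<tau> *\<^sub>R (Rperp *v (I.s *v (Rperp *v v))))" for v
    by (simp add: J.N_def matvec_minus_left matrix_vector_mul_assoc[symmetric] JSv matrix_vector_mult_scaleR)
  have JNi: "matrix_inv J.N = (1 / \<tau>) *\<^sub>R I.s"
    by (rule matrix_inv_eqI)
       (use \<tau>0 in \<open>simp_all add: JN scaleR_matrix_vector_assoc[symmetric] matrix_vector_mult_scaleR matvec_minus_right I.s_Rperp inner_Rperp(4)\<close>)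

  have eff1: "effective_tensor (\<lambda>x. frakL (L x) (M x)) = frakL (matrix_inv I.N) (Rperp ** I.s)"
    using I.effective_tensor_eq by (simp add: MR)
  have eff2: "effective_tensor (\<lambda>x. frakL (\<mu> x *\<^sub>R \<sigma> x) (Rperp ** \<sigma> x)) = frakL ((1 / \<tau>) *\<^sub>R I.s) (Rperp ** I.s)"
    using J.effective_tensor_eq unfolding JNi .
  have "frakL ((1 / \<tau>) *\<^sub>R I.s) (Rperp ** I.s) \<in> M7"
    unfolding M7_def using I.s_sym I.det_s pd[OF I.s_pos] \<tau>0 \<tau>2 by (auto simp: field_simps intro!: exI[of _ "1 / \<tau>"] exI[of _ I.s])
  moreover have "trace (matrix_inv (matrix_inv I.N) ** I.s) = 2 / (1 / \<tau>)"
    unfolding I.N_inv_inv tr(1) \<tau>_def by simp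
  ultimately show ?thesis
    using cond comp2 inM7 eff1 eff2 I.N_inv_sym I.effective_M19 I.effective_conductivity[symmetric]
    by (intro conjI allI exI[of _ "matrix_inv I.N"] exI[of _ "Rperp ** I.s"] exI[of _ "1 / \<tau>"] exI[of _ I.s])
       (assumption | rule refl)+
qed

end
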